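(* Let $E$ and $F$ be Polish spaces. For each $x\in F$ let $P_x$ be a Markov kernel on $E$ such that for every $A\in\mathcal{B}(E)$ the map $(x,y)\mapsto P_x(y,A)$ is measurable. Let $X=(X_t)_{t\in\mathbb{Z}}$ be a stationary $F$-valued process on a probability space $(\Omega,\mathcal{A},\mathbb{P})$, and let $p\ge1$ be an integer. Assume: (A4) There exist measurable maps $V:E\to(0,\infty)$ and $\lambda,b:F^p\to(0,\infty)$ such that for all $(x_1,\ldots,x_p)\in F^p$, $$[P_{x_1}\cdots P_{x_p}]V\le \lambda(x_p,x_{p-1},\ldots,x_1)V+b(x_p,x_{p-1},\ldots,x_1),$$ with $\mathbb{E}\log^+\lambda(X_p,\ldots,X_1)<\infty$, $\mathbb{E}\log^+ b(X_p,\ldots,X_1)<\infty$, and $$\limsup_{n\to\infty}\prod_{k=0}^{n-1}\lambda\big(X_{-1-kp},\ldots,X_{-(k+1)p}\big)^{1/n}<1\quad\text{a.s.}$$ (A5) There exists a measurable $\eta:(0,\infty)\times F^p\to(0,1)$ such that for every $R>0$ there is a probability kernel $\nu_R$ from $F^p$ to $E$ with $$[P_{x_1}\cdots P_{x_p}](y,A)\ge \eta(R,x_p,\ldots,x_1)\,\nu_R(x_p,\ldots,x_1,A)$$ for all $(x_1,\ldots,x_p)\in F^p$, $y\in V^{-1}([0,R])$, $A\in\mathcal{B}(E)$. Then there exists a stationary process $((Y_t,X_t))_{t\in\mathbb{Z}}$ (with $(X_t)$ distributed as the given environment) satisfying $$\mathbb{P}\left(Y_t\in A\mid X,Y_{t-1},Y_{t-2},\ldots\right)=P_{X_{t-1}}(Y_{t-1},A),\qquad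 t\in\mathbb{Z},\ A\in\mathcal{B}(E),$$ and the distribution of such a process is unique. If in addition $(X_t)_{t\in\mathbb{Z}}$ is ergodic, then $((Y_t,X_t))_{t\in\mathbb{Z}}$ is also ergodic.
   Context: $\log^+(u)=\log(\max(u,1))$. The product of Markov kernels $R,S$ on $E$ is $RS(y,A)=\int_E R(y,dy')S(y',A)$, and $PV(y)=\int P(y,dy')V(y')$. In the conditional-distribution identity, $X$ denotes the whole sequence $(X_s)_{s\in\mathbb{Z}}$. *)

theory Defs
  imports "HOL-Probability.Probability"
begin

definition logplus :: "real \<Rightarrow> real" where
  "logplus u = ln (max u 1)"

definition path_space :: "'a measure \<Rightarrow> (int \<Rightarrow> 'a) measure" where
  "path_space N = (\<Pi>\<^sub>M s\<in>(UNIV::int set). N)"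

definition shift :: "(int \<Rightarrow> 'a) \<Rightarrow> (int \<Rightarrow> 'a)" where
  "shift \<omega> = (\<lambda>s. \<omega> (s + 1))"

definition stationary_law :: "'a measure \<Rightarrow> (int \<Rightarrow> 'a) measure \<Rightarrow> bool" where
  "stationary_law N Q \<longleftrightarrow> sets Q = sets (path_space N) \<and> distr Q (path_space N) shift = Q"

definition ergodic_law :: "(int \<Rightarrow> 'a) measure \<Rightarrow> bool" where
  "ergodic_law Q \<longleftrightarrow>
     (\<forall>B\<in>sets Q. shift -` B \<inter> space Q = B \<longrightarrow> measure Q B = 0 \<or> measure Q B = 1)"

definition law :: "'w measure \<Rightarrow> 'a measure \<Rightarrow> (int \<Rightarrow> 'w \<Rightarrow> 'a) \<Rightarrow> (int \<Rightarrow> 'a) measure" where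
  "law M N X = distr M (path_space N) (\<lambda>\<omega> s. X s \<omega>)"

definition prob_kernel_on :: "'b measure \<Rightarrow> 'a measure \<Rightarrow> ('b \<Rightarrow> 'a measure) \<Rightarrow> bool" where
  "prob_kernel_on S T K \<longleftrightarrow>
     (\<forall>y\<in>space S. prob_space (K y) \<and> sets (K y) = sets T) \<and>
     (\<forall>A\<in>sets T. (\<lambda>y. emeasure (K y) A) \<in> borel_measurable S)"

fun kcomp :: "'e measure \<Rightarrow> ('e \<Rightarrow> 'e measure) list \<Rightarrow> 'e \<Rightarrow> 'e measure" where
  "kcomp N [] = (\<lambda>y. return N y)"
| "kcomp N (K # Ks) = (\<lambda>y. K y \<bind> kcomp N Ks)"

text \<open>Tuples in F^p are functions on {1..p}. revtup p xs is the tuple (x_p, x_(p-1), ..., x_1),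
  i.e. its k-th coordinate is x_(p+1-k).\<close>
definition revtup :: "nat \<Rightarrow> (nat \<Rightarrow> 'f) \<Rightarrow> (nat \<Rightarrow> 'f)" where
  "revtup p xs = (\<lambda>k\<in>{1..p}. xs (p + 1 - k))"

text \<open>sigma(X, Y_(t-1), Y_(t-2), ...) on the path space of (Y_s, X_s)_s.\<close>
definition past_sigma :: "int \<Rightarrow> (int \<Rightarrow> 'e::topological_space \<times> 'f::topological_space) measure" where
  "past_sigma t = vimage_algebra (space (path_space (borel \<Otimes>\<^sub>M borel)))
      (\<lambda>\<omega>. ((\<lambda>s. snd (\<omega> s)), (\<lambda>j::nat. fst (\<omega> (t - 1 - int j)))))
      (path_space (borel::'f measure) \<Otimes>\<^sub>M (\<Pi>\<^sub>M j\<in>(UNIV::nat set). (borel::'e measure)))"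

text \<open>Q is the law of a stationary process ((Y_t,X_t))_t whose X-marginal is LX and with
  P(Y_t \<in> A | X, Y_(t-1), Y_(t-2), ...) = P_(X_(t-1)) (Y_(t-1), A) a.s.\<close>
definition solution_law ::
  "('f::topological_space \<Rightarrow> 'e::topological_space \<Rightarrow> 'e measure) \<Rightarrow> (int \<Rightarrow> 'f) measure
     \<Rightarrow> (int \<Rightarrow> 'e \<times> 'f) measure \<Rightarrow> bool" where
  "solution_law P LX Q \<longleftrightarrow>
     prob_space Q \<and> stationary_law (borel \<Otimes>\<^sub>M borel) Q \<and>
     distr Q (path_space borel) (\<lambda>\<omega> s. snd (\<omega> s)) = LX \<and>
     (\<forall>t. \<forall>A\<in>sets (borel::'e measure).
        AE \<omega> in Q. real_cond_exp Q (past_sigma t) (\<lambda>\<omega>. indicator A (fst (\<omega> t))) \<omega>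
                    = measure (P (snd (\<omega> (t - 1))) (fst (\<omega> (t - 1)))) A)"

end

theory Submission
  imports Defs
begin

text \<open>
  Put \<open>S = F^Z \<times> E\<close> and let \<open>kern\<close> move \<open>(x, y)\<close> to \<open>(shift x, y')\<close> with \<open>y'\<close> drawn from \<open>P_(x_0)(y, .)\<close>.
  A solution is the path law of a \<open>kern\<close>-invariant probability on \<open>S\<close> whose first marginal is the law of
  the environment, and conversely such an invariant law extends to a two-sided process by Kolmogorov's theorem.

  Uniqueness uses (A5) only. If \<open>D - D'\<close> is the Hahn-Jordan decomposition of the difference of two
  invariant laws, with \<open>D\<close> carried by \<open>H\<close> and \<open>D'\<close> by its complement, then invariance forces \<open>kern^p\<close> to
  keep \<open>D\<close>-almost every point inside \<open>H\<close> and \<open>D'\<close>-almost every point outside. As \<open>D\<close> and \<open>D'\<close> have the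
  same first marginal, the minorizing measure of a common fibre would have to be carried by both sets.

  Existence does not need convergence of the laws \<open>rho_n\<close> of the chain started at time \<open>- n p\<close>. The drift
  bounds the conditional mean of \<open>V\<close> given the environment uniformly in \<open>n\<close>, so by (A5) all \<open>rho_n\<close> dominate
  a common measure charging almost every fibre. The increasing limit of the lattice infima of
  \<open>rho_n, rho_(n+1), ...\<close> is therefore nonzero on almost every fibre; it is invariant, and dividing by its
  shift-invariant marginal density normalises it.

  For ergodicity, a shift-invariant event is approximated by events of the remote past, hence conditioning a
  solution on it gives again a solution, which by uniqueness is the original one.
\<close>

text \<open>The minorization constant is positive on every fibre but has no lower bound common to
  all environments, so no uniform rate of contraction is at hand. It is therefore used
  qualitatively: through null sets for uniqueness, through the order of measures for existence. It
  also holds only where \<open>V \<le> R\<close>. For uniqueness the part with \<open>V > R\<close>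
  disappears as R grows; for existence R is adapted to the environment by restricting to
  \<open>W \<le> R / 2\<close>, where \<open>W\<close> bounds the conditional mean of
  \<open>V\<close>. Finiteness of \<open>W\<close> is where the limsup condition and the logarithmic
  moment of \<open>b\<close> enter: products of \<open>lam\<close> over past blocks decay
  geometrically, while \<open>b\<close> along these blocks grows subexponentially. Drift and
  minorization concern \<open>p\<close> steps, a solution concerns one. Uniqueness passes to the
  \<open>p\<close>-th power of \<open>kern\<close>; existence has to come back from it, by summing
  over one period. Conditioning on an infinite past is reduced to finite windows of Y together with
  the entire environment, see \<open>clampY\<close>.\<close>

section \<open>Measures with a common fibration\<close>

text \<open>Differences \<open>M - N = D - D'\<close> of finite measures are written additively
  below, which keeps all values in \<open>ennreal\<close>. Monotone induction carries such an
  identity from sets to integrands.\<close>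

lemma nn_integral_add_measures:
  assumes sets: "sets M' = sets M" "sets N = sets M" "sets N' = sets M"
    and eq: "\<And>A. A \<in> sets M \<Longrightarrow> emeasure M A + emeasure M' A = emeasure N A + emeasure N' A"
    and h: "h \<in> borel_measurable M"
  shows "(\<integral>\<^sup>+x. h x \<partial>M) + (\<integral>\<^sup>+x. h x \<partial>M') = (\<integral>\<^sup>+x. h x \<partial>N) + (\<integral>\<^sup>+x. h x \<partial>N')"
  using h
proof (induction rule: borel_measurable_induct)
  case (cong f g)
  have "space M' = space M" "space N = space M" "space N' = space M"
    using sets by (auto dest: sets_eq_imp_space_eq)
  then show ?case using cong by (simp cong: nn_integral_cong_simp)
next
  case (set A)
  then show ?case using eq[of A] sets by simp
next
  case (mult u c)
  have [measurable]: "u \<in> borel_measurable M" "u \<in> borel_measurable M'" "u \<in> borel_measurable N"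
     "u \<in> borel_measurable N'"
    using mult(2) sets by (simp_all cong: measurable_cong_sets)
  show ?case using mult(4) by (simp add: nn_integral_cmult distrib_left[symmetric])
next
  case (add u v)
  have [measurable]: "u \<in> borel_measurable M" "u \<in> borel_measurable M'" "u \<in> borel_measurable N"
     "u \<in> borel_measurable N'" "v \<in> borel_measurable M" "v \<in> borel_measurable M'"
     "v \<in> borel_measurable N" "v \<in> borel_measurable N'"
    using add sets by (simp_all cong: measurable_cong_sets)
  show ?case using add
    by (simp add: nn_integral_add) (metis (no_types, lifting) add.assoc add.commute)
next
  case (seq U)
  have [measurable]: "U i \<in> borel_measurable M" "U i \<in> borel_measurable M'" "U i \<in> borel_measurable N"
     "U i \<in> borel_measurable N'" for i
    using seq(1) sets by (simp_all cong: measurable_cong_sets)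
  have hx: "(SUP i. U i) = (\<lambda>x. SUP i. U i x)"
    by (simp add: fun_eq_iff SUP_apply image_comp)
  have inc: "incseq (\<lambda>i. \<integral>\<^sup>+x. U i x \<partial>L)" for L
    using \<open>incseq U\<close> by (auto simp: incseq_def le_fun_def intro!: nn_integral_mono)
  show ?case
    unfolding hx by (subst (1 2 3 4) nn_integral_monotone_convergence_SUP)
      (auto simp: \<open>incseq U\<close> seq.IH ennreal_SUP_add[symmetric] inc)
qed

text \<open>Monotone convergence in the measure instead of the integrand; in the \<open>seq\<close>
  case two suprema are exchanged. In \<open>invariant_below\<close> it lets a kernel pass to the
  limit measure.\<close>

lemma nn_integral_eq_SUP:
  fixes M :: "nat \<Rightarrow> 'a measure"
  assumes sets: "\<And>k. sets (M k) = sets N"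
    and inc: "\<And>A. A \<in> sets N \<Longrightarrow> incseq (\<lambda>k. emeasure (M k) A)"
    and eq: "\<And>A. A \<in> sets N \<Longrightarrow> emeasure N A = (SUP k. emeasure (M k) A)"
    and h: "h \<in> borel_measurable N"
  shows "(\<integral>\<^sup>+x. h x \<partial>N) = (SUP k. \<integral>\<^sup>+x. h x \<partial>M k)"
proof -
  have inci: "incseq (\<lambda>k. \<integral>\<^sup>+x. u x \<partial>M k)" for u
  proof (rule incseq_SucI)
    fix k
    have "M k \<le> M (Suc k)"
      using inc by (subst le_measure) (auto simp: sets incseq_Suc_iff)
    then show "(\<integral>\<^sup>+x. u x \<partial>M k) \<le> (\<integral>\<^sup>+x. u x \<partial>M (Suc k))"
      by (intro nn_integral_mono_measure) (auto simp: sets)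
  qed
  have sp: "space (M k) = space N" for k
    using sets by (auto dest: sets_eq_imp_space_eq)
  show ?thesis using h
  proof (induction rule: borel_measurable_induct)
    case (cong f g)
    then show ?case using sp by (simp cong: nn_integral_cong_simp)
  next
    case (set A)
    then show ?case using eq[of A] sets by simp
  next
    case (mult u c)
    have [measurable]: "u \<in> borel_measurable N" "u \<in> borel_measurable (M k)" for k
      using mult(2) sets by (simp_all cong: measurable_cong_sets)
    show ?case using mult(4) by (simp add: nn_integral_cmult SUP_mult_left_ennreal)
  next
    case (add u v)
    have [measurable]: "u \<in> borel_measurable N" "u \<in> borel_measurable (M k)"
       "v \<in> borel_measurable N" "v \<in> borel_measurable (M k)" for k
      using add sets by (simp_all cong: measurable_cong_sets)
    show ?case using add by (simp add: nn_integral_add ennreal_SUP_add inci)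
  next
    case (seq U)
    have [measurable]: "U i \<in> borel_measurable N" "U i \<in> borel_measurable (M k)" for i k
      using seq(1) sets by (simp_all cong: measurable_cong_sets)
    have hx: "(SUP i. U i) = (\<lambda>x. SUP i. U i x)"
      by (simp add: fun_eq_iff SUP_apply image_comp)
    show ?case
      unfolding hx by (subst (1 2) nn_integral_monotone_convergence_SUP)
        (auto simp: \<open>incseq U\<close> seq.IH intro: SUP_commute)
  qed
qed

text \<open>\<open>D\<close> is \<open>M - N\<close> on the Hahn set \<open>H\<close>, and
  \<open>D'\<close> is \<open>N - M\<close> off \<open>H\<close>; each difference is nonnegative
  there. Restriction is done by indicator densities so that the sigma-algebra remains that of
  \<open>M\<close>.\<close>

lemma jordan_decomposition:
  assumes "finite_measure M" "finite_measure N" and sets: "sets N = sets M"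
  obtains D D' H where "sets D = sets M" "sets D' = sets M" "finite_measure D" "finite_measure D'"
    "H \<in> sets M" "emeasure D (space M - H) = 0" "emeasure D' H = 0"
    "\<And>h. h \<in> borel_measurable M \<Longrightarrow>
      (\<integral>\<^sup>+x. h x \<partial>M) + (\<integral>\<^sup>+x. h x \<partial>D') = (\<integral>\<^sup>+x. h x \<partial>N) + (\<integral>\<^sup>+x. h x \<partial>D)"
proof -
  interpret M: finite_measure M by fact
  interpret N: finite_measure N by fact
  obtain H where H[measurable]: "H \<in> sets M"
    and H1: "\<And>X. X \<in> sets M \<Longrightarrow> X \<subseteq> H \<Longrightarrow> emeasure N X \<le> emeasure M X"
    and H2: "\<And>X. X \<in> sets M \<Longrightarrow> X \<inter> H = {} \<Longrightarrow> emeasure M X \<le> emeasure N X"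
    using finite_unsigned_Hahn_decomposition[OF assms] by metis
  note [measurable_cong] = sets
  have sp: "space N = space M" using sets by (rule sets_eq_imp_space_eq)
  let ?r = "\<lambda>L B. density L (indicator B)"
  have r: "emeasure (?r L B) A = emeasure L (A \<inter> B)" if "sets L = sets M" "A \<in> sets M" "B \<in> sets M" for L A B
    using that by (subst emeasure_density) (auto simp flip: indicator_inter_arith simp: ac_simps)
  have fin: "finite_measure (?r L B)" if "finite_measure L" "sets L = sets M" "B \<in> sets M" for L B
  proof (rule finite_measureI)
    interpret finite_measure L by fact
    show "emeasure (?r L B) (space (?r L B)) \<noteq> \<infinity>"
      using that sets_eq_imp_space_eq[OF that(2)] by (simp add: r)
  qed
  define D where "D = diff_measure (?r M H) (?r N H)"
  define D' where "D' = diff_measure (?r N (space M - H)) (?r M (space M - H))"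
  have fins: "finite_measure (?r M H)" "finite_measure (?r N H)"
     "finite_measure (?r N (space M - H))" "finite_measure (?r M (space M - H))"
    by (rule fin; simp add: assms)+
  have D: "emeasure D A = emeasure M (A \<inter> H) - emeasure N (A \<inter> H)" if "A \<in> sets M" for A
  proof -
    have "emeasure D A = emeasure (?r M H) A - emeasure (?r N H) A"
      unfolding D_def using that by (intro emeasure_diff_measure fins) (simp_all add: r sets H1)
    then show ?thesis using that by (simp add: r sets)
  qed
  have D': "emeasure D' A = emeasure N (A \<inter> (space M - H)) - emeasure M (A \<inter> (space M - H))" if "A \<in> sets M" for A
  proof -
    have "(B \<inter> (space M - H)) \<inter> H = {}" for B by auto
    then have "emeasure D' A = emeasure (?r N (space M - H)) A - emeasure (?r M (space M - H)) A"
      unfolding D'_def using that by (intro emeasure_diff_measure fins) (simp_all add: r sets H2)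
    then show ?thesis using that by (simp add: r sets)
  qed
  have sD: "sets D = sets M" "sets D' = sets M"
    by (simp_all add: D_def D'_def sets)
  show thesis
  proof
    show "sets D = sets M" "sets D' = sets M" by fact+
    have "emeasure D (space D) \<noteq> \<infinity>" "emeasure D' (space D') \<noteq> \<infinity>"
      using sD[THEN sets_eq_imp_space_eq] by (auto simp: D D')
    then show "finite_measure D" "finite_measure D'" by (auto intro: finite_measureI)
    show "H \<in> sets M" by fact
    have "(space M - H) \<inter> H = {}" "H \<inter> (space M - H) = {}" by auto
    then show "emeasure D (space M - H) = 0" "emeasure D' H = 0"
      by (simp_all add: D D')
  next
    fix h :: "'a \<Rightarrow> ennreal" assume "h \<in> borel_measurable M"
    then show "(\<integral>\<^sup>+x. h x \<partial>M) + (\<integral>\<^sup>+x. h x \<partial>D') = (\<integral>\<^sup>+x. h x \<partial>N) + (\<integral>\<^sup>+x. h x \<partial>D)"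
    proof (rule nn_integral_add_measures[rotated -1])
      fix A assume A[measurable]: "A \<in> sets M"
      have split: "emeasure L A = emeasure L (A \<inter> H) + emeasure L (A \<inter> (space M - H))" if "sets L = sets M" for L
      proof -
        have "A = (A \<inter> H) \<union> (A \<inter> (space M - H))" using sets.sets_into_space[OF A] by auto
        moreover have "emeasure L ((A \<inter> H) \<union> (A \<inter> (space M - H))) = emeasure L (A \<inter> H) + emeasure L (A \<inter> (space M - H))"
          using that by (intro plus_emeasure[symmetric]) auto
        ultimately show ?thesis by simp
      qed
      let ?H' = "space M - H"
      have a: "emeasure M (A \<inter> H) = emeasure N (A \<inter> H) + D A" 
        unfolding D[OF A] using H1[of "A \<inter> H"] by (simp add: add_diff_inverse_ennreal)
      have b: "emeasure N (A \<inter> ?H') = emeasure M (A \<inter> ?H') + D' A" 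
        unfolding D'[OF A] using H2[of "A \<inter> ?H'"] by (subst add_diff_inverse_ennreal) auto
      show "emeasure M A + emeasure D' A = emeasure N A + emeasure D A"
        unfolding split[OF refl] split[OF sets] a b by (simp add: ac_simps)
    qed (auto simp: sD sets)
  qed
qed

text \<open>Let \<open>D - D'\<close> be the Jordan decomposition of the difference. Its two parts
  have equal mass on every fibre set, and \<open>J\<close> preserves their separation by
  \<open>H\<close>. Over a fibre, \<open>N R\<close> cannot vanish both on \<open>H\<close> and off
  \<open>H\<close>; so, up to null sets, one of the two parts has no points with
  \<open>v \<le> R\<close> there. Letting R grow kills both parts.\<close>

lemma fibred_minorization_unique:
  fixes c :: "nat \<Rightarrow> 'b \<Rightarrow> ennreal" and v :: "'a \<Rightarrow> real"
  assumes \<rho>: "\<rho> \<in> space (prob_algebra S)" and \<rho>': "\<rho>' \<in> space (prob_algebra S)"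
    and J[measurable]: "J \<in> S \<rightarrow>\<^sub>M prob_algebra S"
    and inv: "\<rho> \<bind> J = \<rho>" "\<rho>' \<bind> J = \<rho>'"
    and pr[measurable]: "pr \<in> S \<rightarrow>\<^sub>M T"
    and v[measurable]: "v \<in> borel_measurable S"
    and marg: "distr \<rho> T pr = distr \<rho>' T pr"
    and N[measurable]: "\<And>R. 0 < R \<Longrightarrow> N R \<in> T \<rightarrow>\<^sub>M prob_algebra S"
    and c: "\<And>R x. 0 < R \<Longrightarrow> x \<in> space T \<Longrightarrow> 0 < c R x"
    and minor: "\<And>R z A. 0 < R \<Longrightarrow> z \<in> space S \<Longrightarrow> v z \<le> real R \<Longrightarrow> A \<in> sets S \<Longrightarrow>
      c R (pr z) * emeasure (N R (pr z)) A \<le> emeasure (J z) A"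
  shows "\<rho> = \<rho>'"
proof -
  have sets\<rho>: "sets \<rho> = sets S" "sets \<rho>' = sets S" and P: "prob_space \<rho>" "prob_space \<rho>'"
    using \<rho> \<rho>' by (auto simp: space_prob_algebra)
  interpret P: prob_space \<rho> by fact
  interpret P': prob_space \<rho>' by fact
  obtain D D' H where sD: "sets D = sets \<rho>" "sets D' = sets \<rho>" and fD: "finite_measure D" "finite_measure D'"
    and H: "H \<in> sets \<rho>" and null: "emeasure D (space \<rho> - H) = 0" "emeasure D' H = 0"
    and eq: "\<And>h. h \<in> borel_measurable \<rho> \<Longrightarrow>
      (\<integral>\<^sup>+x. h x \<partial>\<rho>) + (\<integral>\<^sup>+x. h x \<partial>D') = (\<integral>\<^sup>+x. h x \<partial>\<rho>') + (\<integral>\<^sup>+x. h x \<partial>D)"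
    using jordan_decomposition[of \<rho> \<rho>'] P.finite_measure_axioms P'.finite_measure_axioms sets\<rho> by metis
  interpret D: finite_measure D by fact
  interpret D': finite_measure D' by fact
  note [measurable_cong] = sets\<rho> sD
  have sp: "space \<rho> = space S" "space \<rho>' = space S" "space D = space S" "space D' = space S"
    using sets\<rho> sD by (auto dest: sets_eq_imp_space_eq)
  have H[measurable]: "H \<in> sets S" using H sets\<rho> by simp
  have HU: "H \<union> (space S - H) = space S" and HU2: "H \<union> space S = space S" using sets.sets_into_space[OF H] by auto
  have eqA: "emeasure \<rho> A + emeasure D' A = emeasure \<rho>' A + emeasure D A" if [measurable]: "A \<in> sets S" for A
    using eq[of "indicator A"] by simp
  have fibre: "emeasure D' (pr -` B \<inter> space S) = emeasure D (pr -` B \<inter> space S)"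
    if [measurable]: "B \<in> sets T" for B
  proof -
    have "emeasure \<rho> (pr -` B \<inter> space S) = emeasure \<rho>' (pr -` B \<inter> space S)"
      using arg_cong[OF marg, of "\<lambda>L. emeasure L B"] by (simp add: emeasure_distr sp)
    then show ?thesis using eqA[of "pr -` B \<inter> space S"] by simp
  qed
  have mass: "emeasure D' (space S) = emeasure D (space S)"
    using eqA[of "space S"] P.emeasure_space_1 P'.emeasure_space_1 by (simp add: sp)
  have JH: "emeasure (L \<bind> J) H = (\<integral>\<^sup>+z. emeasure (J z) H \<partial>L)" if "sets L = sets S" for L
  proof (cases "space L = {}")
    case True
    then show ?thesis using sets_eq_imp_space_eq[OF that] P.not_empty sp by simp
  next
    case False
    have "J \<in> L \<rightarrow>\<^sub>M subprob_algebra S"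
      using that measurable_prob_algebraD[OF J] by (simp cong: measurable_cong_sets)
    then show ?thesis using False by (intro emeasure_bind[where N=S]) auto
  qed
  have Jm[measurable]: "(\<lambda>z. emeasure (J z) A) \<in> borel_measurable S" if "A \<in> sets S" for A
    using measurable_compose[OF measurable_prob_algebraD[OF J] measurable_emeasure_subprob_algebra[OF that]] .
  have Jp: "prob_space (J z)" "sets (J z) = sets S" "space (J z) = space S" if "z \<in> space S" for z
    using measurable_space[OF J that] by (auto simp: space_prob_algebra dest: sets_eq_imp_space_eq)
  have J_compl: "emeasure (J z) (space S - H) = 1 - emeasure (J z) H" if "z \<in> space S" for z
  proof -
    interpret Jz: prob_space "J z" using that by (rule Jp)
    show ?thesis
      using emeasure_compl[of H "J z"] Jz.emeasure_space_1 by (simp add: Jp[OF that])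
  qed
  have J_le1: "emeasure (J z) H \<le> 1" if "z \<in> space S" for z
    using prob_space.emeasure_le_1[OF Jp(1)[OF that]] by simp
  \<comment> \<open>Integrating \<open>J z H\<close> is where invariance enters. The left side is at
    most the mass of \<open>D\<close>, so the last integral is 0 and \<open>J z H = 1\<close> for
    \<open>D\<close>-almost all z.\<close>
  have int: "(\<integral>\<^sup>+z. emeasure (J z) H \<partial>D) = emeasure D (space S) + (\<integral>\<^sup>+z. emeasure (J z) H \<partial>D')"
  proof -
    have 1: "emeasure \<rho> H = emeasure \<rho>' H + emeasure D (space S)"
    proof -
      have "emeasure D (space S) = emeasure D H + emeasure D (space S - H)"
        by (subst plus_emeasure) (auto simp: HU2 sp)
      then show ?thesis using eqA[of H] null by (simp add: sp)
    qed
    have 2: "emeasure \<rho> H + (\<integral>\<^sup>+z. emeasure (J z) H \<partial>D') = emeasure \<rho>' H + (\<integral>\<^sup>+z. emeasure (J z) H \<partial>D)"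
      using eq[of "\<lambda>z. emeasure (J z) H"] JH[of \<rho>] JH[of \<rho>'] inv by (simp add: sets\<rho>)
    show ?thesis
      using 1 2 by (simp add: add.assoc)
  qed
  have intD: "(\<integral>\<^sup>+z. emeasure (J z) H \<partial>D) \<le> emeasure D (space S)"
    using nn_integral_mono[of D "\<lambda>z. emeasure (J z) H" "\<lambda>_. 1"] J_le1 by (simp add: sp)
  then have "(\<integral>\<^sup>+z. emeasure (J z) H \<partial>D') = 0" and intD_eq: "(\<integral>\<^sup>+z. emeasure (J z) H \<partial>D) = emeasure D (space S)"
    using int D.emeasure_finite[of "space S"]
    by (cases "\<integral>\<^sup>+z. emeasure (J z) H \<partial>D'"; cases "\<integral>\<^sup>+z. emeasure (J z) H \<partial>D"; cases "emeasure D (space S)";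
        simp add: ennreal_plus[symmetric] top_unique del: ennreal_plus)+
  then have aeD': "AE z in D'. emeasure (J z) H = 0"
    by (subst (asm) nn_integral_0_iff_AE) auto
  have "(\<integral>\<^sup>+z. emeasure (J z) (space S - H) \<partial>D) = (\<integral>\<^sup>+z. 1 - emeasure (J z) H \<partial>D)"
    by (intro nn_integral_cong) (auto simp: J_compl sp)
  also have "\<dots> = (\<integral>\<^sup>+z. 1 \<partial>D) - (\<integral>\<^sup>+z. emeasure (J z) H \<partial>D)"
    using intD_eq D.emeasure_finite by (intro nn_integral_diff) (auto simp: J_le1 sp)
  also have "\<dots> = 0"
    using intD_eq D.emeasure_finite by (simp add: sp)
  finally have aeD: "AE z in D. emeasure (J z) (space S - H) = 0"
    by (subst (asm) nn_integral_0_iff_AE) auto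
  have bound: "emeasure D (space S) \<le> emeasure D {z\<in>space S. real R < v z} + emeasure D' {z\<in>space S. real R < v z}"
    if R: "0 < R" for R
  proof -
    note [measurable] = N[OF R]
    have [measurable]: "(\<lambda>x. emeasure (N R x) A) \<in> borel_measurable T" if "A \<in> sets S" for A
      using measurable_compose[OF measurable_prob_algebraD[OF N[OF R]] measurable_emeasure_subprob_algebra[OF that]] .
    \<comment> \<open>Fibres are sorted by the minorizing measure: over \<open>B\<close> it charges
      the complement of \<open>H\<close>, which excludes \<open>D\<close>-points with
      \<open>v \<le> R\<close>; over the rest it charges \<open>H\<close>, which excludes
      \<open>D'\<close>-points with \<open>v \<le> R\<close>.\<close>
    define B where "B = {x\<in>space T. emeasure (N R x) H = 0}"
    have [measurable]: "B \<in> sets T" unfolding B_def by measurable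
    have Np: "emeasure (N R x) (space S - H) \<noteq> 0" if "x \<in> B" for x
    proof
      assume 0: "emeasure (N R x) (space S - H) = 0"
      have x: "x \<in> space T" using that by (simp add: B_def)
      have p: "prob_space (N R x)" "sets (N R x) = sets S" "space (N R x) = space S"
        using measurable_space[OF N[OF R] x] by (auto simp: space_prob_algebra dest: sets_eq_imp_space_eq)
      have "emeasure (N R x) (space S) = emeasure (N R x) H + emeasure (N R x) (space S - H)"
        by (subst plus_emeasure) (auto simp: p HU2)
      then show False using 0 that prob_space.emeasure_space_1[OF p(1)] by (simp add: p B_def)
    qed
    have zero: "emeasure (N R (pr z)) A = 0" if "z \<in> space S" "v z \<le> real R" "A \<in> sets S" "emeasure (J z) A = 0" for z A
      using minor[OF R that(1,2,3)] c[OF R, of "pr z"] measurable_space[OF pr that(1)] that(4) by auto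
    have "AE z in D. real R < v z \<or> pr z \<notin> B"
      using aeD AE_space by eventually_elim (metis H Np not_less sets.compl_sets sp(3) zero)
    then have 1: "emeasure D (pr -` B \<inter> space S) \<le> emeasure D {z\<in>space S. real R < v z}"
      by (intro emeasure_mono_AE) (auto elim!: eventually_mono simp: sp)
    have "AE z in D'. real R < v z \<or> pr z \<in> B"
      using aeD' AE_space
    proof eventually_elim
      case (elim z)
      then have "v z \<le> real R \<Longrightarrow> emeasure (N R (pr z)) H = 0" by (intro zero) (auto simp: sp)
      then show ?case using elim(2) measurable_space[OF pr]
        by (cases "v z \<le> real R") (auto simp: B_def sp)
    qed
    then have 2: "emeasure D' (pr -` (space T - B) \<inter> space S) \<le> emeasure D' {z\<in>space S. real R < v z}"
      by (intro emeasure_mono_AE) (auto elim!: eventually_mono simp: sp)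
    have "emeasure D (space S) = emeasure D (pr -` B \<inter> space S) + emeasure D (pr -` (space T - B) \<inter> space S)"
    proof -
      have m: "pr -` C \<inter> space S \<in> sets D" if "C \<in> sets T" for C
        using measurable_sets[OF pr that] by (simp add: sD sets\<rho>)
      show ?thesis using measurable_space[OF pr]
        by (subst plus_emeasure) (auto intro!: arg_cong[where f="emeasure D"] m)
    qed
    \<comment> \<open>Equality of the marginals exchanges \<open>D\<close> for \<open>D'\<close>
      over the second kind of fibres, so that both estimates bound the one mass of
      \<open>D\<close>.\<close>
    also have "emeasure D (pr -` (space T - B) \<inter> space S) = emeasure D' (pr -` (space T - B) \<inter> space S)"
      by (rule fibre[symmetric]) simp
    finally show ?thesis using add_mono[OF 1 2] by simp
  qed
  have lim: "(\<lambda>R. emeasure L {z\<in>space S. real R < v z}) \<longlonglongrightarrow> 0" if "finite_measure L" "sets L = sets S" for L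
  proof -
    interpret L: finite_measure L by fact
    note [measurable_cong] = that(2)
    have spL: "space L = space S" using that(2) by (rule sets_eq_imp_space_eq)
    have "(\<lambda>R. emeasure L {z\<in>space S. real R < v z}) \<longlonglongrightarrow> emeasure L (\<Inter>R::nat. {z\<in>space S. real R < v z})"
      by (intro Lim_emeasure_decseq) (auto simp: decseq_def that(2))
    also have "(\<Inter>R::nat. {z\<in>space S. real R < v z}) = {}"
      by (auto, metis reals_Archimedean2 less_asym)
    finally show ?thesis by simp
  qed
  have "(\<lambda>R. emeasure D {z\<in>space S. real R < v z} + emeasure D' {z\<in>space S. real R < v z}) \<longlonglongrightarrow> 0 + 0"
    using lim fD sD sets\<rho> by (intro tendsto_add) auto
  then have "emeasure D (space S) \<le> 0 + 0"
    by (rule LIMSEQ_le_const) (use bound in \<open>auto intro!: exI[of _ 1]\<close>)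
  then have D0: "emeasure D (space S) = 0" by simp
  show ?thesis
  proof (rule measure_eqI)
    fix A assume "A \<in> sets \<rho>"
    then have [measurable]: "A \<in> sets S" by (simp add: sets\<rho>)
    have "emeasure D A \<le> 0" "emeasure D' A \<le> 0"
      using D0 mass emeasure_space[of D A] emeasure_space[of D' A] by (auto simp: sp)
    then show "emeasure \<rho> A = emeasure \<rho>' A" using eqA[of A] by simp
  qed (simp add: sets\<rho>)
qed

section \<open>Kernels and the order of measures\<close>

text \<open>The order applied to the complement of a set gives the reverse inequality on the set,
  because the total masses agree. This turns sub-invariance under a probability kernel into
  invariance.\<close>

lemma le_measure_mass_eq:
  assumes sets: "sets M = sets N" and le: "M \<le> N" and mass: "emeasure N (space N) \<le> emeasure M (space M)"
    and "finite_measure N"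
  shows "M = N"
proof (rule measure_eqI[OF sets])
  interpret finite_measure N by fact
  have sp: "space M = space N" using sets by (rule sets_eq_imp_space_eq)
  fix A assume A: "A \<in> sets M"
  have m: "emeasure M B \<le> emeasure N B" for B
    using le_measureD3[OF le sets] .
  have split: "emeasure L (space L) = emeasure L A + emeasure L (space L - A)" if "A \<in> sets L" for L
    using sets.sets_into_space[OF that] that 
    by (subst plus_emeasure) (auto simp: Un_absorb1)
  have "emeasure N A + emeasure N (space N - A) \<le> emeasure M A + emeasure M (space N - A)"
    using mass split[of M] split[of N] A sets by (simp add: sp)
  also have "\<dots> \<le> emeasure M A + emeasure N (space N - A)"
    by (intro add_left_mono m)
  finally have "emeasure N A \<le> emeasure M A"
    using emeasure_finite[of "space N - A"] by (simp add: top_unique)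
  then show "emeasure M A = emeasure N A" using m[of A] by simp
qed

lemma emeasure_bind_kernel:
  assumes J: "J \<in> S \<rightarrow>\<^sub>M prob_algebra R" and M: "sets M = sets S" and ne: "space S \<noteq> {}" and A: "A \<in> sets R"
  shows "emeasure (M \<bind> J) A = (\<integral>\<^sup>+z. emeasure (J z) A \<partial>M)"
proof -
  have "J \<in> M \<rightarrow>\<^sub>M subprob_algebra R"
    using M measurable_prob_algebraD[OF J] by (simp cong: measurable_cong_sets)
  then show ?thesis
    using ne sets_eq_imp_space_eq[OF M] A by (intro emeasure_bind) auto
qed

lemma sets_bind_kernel:
  assumes J: "J \<in> S \<rightarrow>\<^sub>M prob_algebra R" and M: "sets M = sets S" and ne: "space S \<noteq> {}"
  shows "sets (M \<bind> J) = sets R"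
proof -
  have "J \<in> M \<rightarrow>\<^sub>M subprob_algebra R"
    using M measurable_prob_algebraD[OF J] by (simp cong: measurable_cong_sets)
  then show ?thesis
    using ne sets_eq_imp_space_eq[OF M] by (intro sets_bind_measurable) auto
qed

lemma nn_integral_bind_kernel:
  assumes J: "J \<in> S \<rightarrow>\<^sub>M prob_algebra R" and M: "sets M = sets S" and f: "f \<in> borel_measurable R"
  shows "(\<integral>\<^sup>+x. f x \<partial>(M \<bind> J)) = (\<integral>\<^sup>+z. \<integral>\<^sup>+x. f x \<partial>J z \<partial>M)"
proof -
  have "J \<in> M \<rightarrow>\<^sub>M subprob_algebra R"
    using M measurable_prob_algebraD[OF J] by (simp cong: measurable_cong_sets)
  then show ?thesis using f by (intro nn_integral_bind) auto
qed

lemma measurable_emeasure_prob_kernel: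
  assumes J: "J \<in> S \<rightarrow>\<^sub>M prob_algebra R" and A: "A \<in> sets R"
  shows "(\<lambda>z. emeasure (J z) A) \<in> borel_measurable S"
  using measurable_compose[OF measurable_prob_algebraD[OF J] measurable_emeasure_subprob_algebra[OF A]] .

lemma bind_kernel_mass:
  assumes J: "J \<in> S \<rightarrow>\<^sub>M prob_algebra R" and M: "sets M = sets S" and ne: "space S \<noteq> {}"
  shows "emeasure (M \<bind> J) (space R) = emeasure M (space S)"
proof -
  have sp: "space M = space S" using M by (rule sets_eq_imp_space_eq)
  have "emeasure (M \<bind> J) (space R) = (\<integral>\<^sup>+z. emeasure (J z) (space R) \<partial>M)"
    using assms by (intro emeasure_bind_kernel) auto
  also have "\<dots> = (\<integral>\<^sup>+z. 1 \<partial>M)"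
    using measurable_space[OF J] sp
    by (intro nn_integral_cong) (auto intro!: in_space_prob_algebra)
  finally show ?thesis by (simp add: sp)
qed

lemma bind_kernel_mono:
  assumes J: "J \<in> S \<rightarrow>\<^sub>M prob_algebra R" and M: "sets M = sets S" "sets N = sets S" and ne: "space S \<noteq> {}"
    and le: "M \<le> N"
  shows "M \<bind> J \<le> N \<bind> J"
proof (subst le_measure)
  show "sets (M \<bind> J) = sets (N \<bind> J)"
    using sets_bind_kernel[OF J _ ne] M by simp
  have "emeasure (M \<bind> J) A \<le> emeasure (N \<bind> J) A" if "A \<in> sets R" for A
    using that M le
    by (subst (1 2) emeasure_bind_kernel[OF J]) (auto intro!: nn_integral_mono_measure simp: ne)
  then show "\<forall>A\<in>sets (M \<bind> J). emeasure (M \<bind> J) A \<le> emeasure (N \<bind> J) A"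
    using sets_bind_kernel[OF J M(1) ne] by simp
qed

text \<open>A kernel is monotone on measures, so \<open>J\<close> maps the infimum
  \<open>L k\<close> of the laws from index k on below \<open>L (Suc k)\<close>. In the limit
  \<theta> is sub-invariant, and as \<open>J\<close> preserves mass it is invariant. Domination is
  asked from index 1 on only, since an initial law carried by one point of each fibre need not
  dominate anything useful.\<close>

lemma invariant_below:
  fixes \<rho> :: "nat \<Rightarrow> 'a measure"
  assumes J: "J \<in> S \<rightarrow>\<^sub>M prob_algebra S" and \<rho>: "\<And>n. \<rho> n \<in> space (prob_algebra S)"
    and step: "\<And>n. \<rho> (Suc n) = \<rho> n \<bind> J"
  obtains \<theta> where "sets \<theta> = sets S" "subprob_space \<theta>" "\<theta> \<bind> J = \<theta>"
    "\<And>\<kappa>. sets \<kappa> = sets S \<Longrightarrow> (\<And>n. 1 \<le> n \<Longrightarrow> \<kappa> \<le> \<rho> n) \<Longrightarrow> \<kappa> \<le> \<theta>"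
proof -
  have sr: "sets (\<rho> n) = sets S" "space (\<rho> n) = space S" and pr: "prob_space (\<rho> n)" for n
    using \<rho>[of n] by (auto simp: space_prob_algebra dest: sets_eq_imp_space_eq)
  have ne: "space S \<noteq> {}" using prob_space.not_empty[OF pr[of 0]] sr by simp
  define L where "L k = (INF n\<in>{k..}. \<rho> n)" for k
  have L_le: "L k \<le> \<rho> n" if "k \<le> n" for k n
    unfolding L_def using that by (intro INF_lower) auto
  have L_ge: "\<kappa> \<le> L k" if "\<And>n. k \<le> n \<Longrightarrow> \<kappa> \<le> \<rho> n" for k \<kappa>
    unfolding L_def using that by (intro INF_greatest) auto
  \<comment> \<open>The order compares spaces first, then sigma-algebras, then values. Squeezing
    \<open>L k\<close> between the null measure and \<open>\<rho> k\<close> is what identifies its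
    space and its sigma-algebra.\<close>
  have null: "null_measure S \<le> L k" for k
    by (intro L_ge) (subst le_measure, auto simp: sr)
  have spL: "space (L k) = space S" for k
    using le_measureD1[OF null[of k]] le_measureD1[OF L_le[of k k]] sr by auto
  have sL: "sets (L k) = sets S" for k
    using le_measureD2[OF null[of k]] le_measureD2[OF L_le[of k k]] sr spL by auto
  have incL: "L k \<le> L l" if "k \<le> l" for k l
    using that by (intro L_ge L_le) auto
  have LJ: "L k \<bind> J \<le> L (Suc k)" for k
  proof (rule L_ge)
    fix n assume "Suc k \<le> n"
    then obtain m where m: "n = Suc m" "k \<le> m" by (cases n) auto
    show "L k \<bind> J \<le> \<rho> n"
      unfolding m step by (intro bind_kernel_mono[OF J] sL sr ne L_le m)
  qed
  define \<theta> where "\<theta> = (SUP k. L k)"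
  have s\<theta>: "sets \<theta> = sets S"
    unfolding \<theta>_def by (rule sets_SUP) (auto simp: sL)
  have sp\<theta>: "space \<theta> = space S" using s\<theta> by (rule sets_eq_imp_space_eq)
  have e\<theta>: "emeasure \<theta> A = (SUP k. emeasure (L k) A)" if "A \<in> sets S" for A
    unfolding \<theta>_def
  proof (rule emeasure_SUP_chain[where N=S])
    show "Complete_Partial_Order.chain (\<le>) (range L)"
      unfolding Complete_Partial_Order.chain_def using incL by (metis (mono_tags, lifting) imageE nat_le_linear)
  qed (auto simp: sL that)
  have incA: "incseq (\<lambda>k. emeasure (L k) A)" for A
    using incL by (auto simp: incseq_def sL intro!: le_measureD3)
  have fin: "emeasure \<theta> (space S) \<le> 1"
    unfolding e\<theta>[OF sets.top]
  proof (rule SUP_least)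
    fix k 
    have "emeasure (L k) (space S) \<le> emeasure (\<rho> k) (space S)"
      by (intro le_measureD3 L_le) (auto simp: sL sr)
    then show "emeasure (L k) (space S) \<le> 1"
      using prob_space.emeasure_space_1[OF pr[of k]] by (simp add: sr)
  qed
  interpret \<theta>: finite_measure \<theta>
    by (rule finite_measureI) (use fin in \<open>auto simp: sp\<theta> top_unique\<close>)
  have "\<theta> \<bind> J \<le> \<theta>"
  proof (subst le_measure)
    show "sets (\<theta> \<bind> J) = sets \<theta>"
      using sets_bind_kernel[OF J s\<theta> ne] s\<theta> by simp
    have "emeasure (\<theta> \<bind> J) A \<le> emeasure \<theta> A" if A: "A \<in> sets S" for A
    proof -
      have "emeasure (\<theta> \<bind> J) A = (\<integral>\<^sup>+z. emeasure (J z) A \<partial>\<theta>)"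
        by (rule emeasure_bind_kernel[OF J s\<theta> ne A])
      also have "\<dots> = (SUP k. \<integral>\<^sup>+z. emeasure (J z) A \<partial>L k)"
        using measurable_emeasure_prob_kernel[OF J A] s\<theta>
        by (intro nn_integral_eq_SUP) (auto simp: sL e\<theta> incA cong: measurable_cong_sets)
      also have "\<dots> = (SUP k. emeasure (L k \<bind> J) A)"
        by (subst emeasure_bind_kernel[OF J sL ne A]) simp
      also have "\<dots> \<le> (SUP k. emeasure (L (Suc k)) A)"
        using LJ by (intro SUP_mono' le_measureD3) (auto simp: sL sets_bind_kernel[OF J sL ne])
      also have "\<dots> \<le> emeasure \<theta> A"
        unfolding e\<theta>[OF A] by (rule SUP_least) (rule SUP_upper, simp)
      finally show ?thesis .
    qed
    then show "\<forall>A\<in>sets (\<theta> \<bind> J). emeasure (\<theta> \<bind> J) A \<le> emeasure \<theta> A"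
      using sets_bind_kernel[OF J s\<theta> ne] by simp
  qed
  then have inv: "\<theta> \<bind> J = \<theta>"
    using bind_kernel_mass[OF J s\<theta> ne] sets_bind_kernel[OF J s\<theta> ne] sets_eq_imp_space_eq[OF sets_bind_kernel[OF J s\<theta> ne]]
    by (intro le_measure_mass_eq) (auto simp: s\<theta> sp\<theta> \<theta>.finite_measure_axioms)
  show thesis
  proof (rule that[OF s\<theta> _ inv])
    show "subprob_space \<theta>" using fin ne by (intro subprob_spaceI) (simp_all add: sp\<theta>)
  next
    fix \<kappa> assume "sets \<kappa> = sets S" "\<And>n. 1 \<le> n \<Longrightarrow> \<kappa> \<le> \<rho> n"
    then have "\<kappa> \<le> L 1" by (intro L_ge) auto
    also have "L 1 \<le> \<theta>" unfolding \<theta>_def by (rule SUP_upper) simp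
    finally show "\<kappa> \<le> \<theta>" .
  qed
qed

section \<open>Invariant densities, ergodicity, approximation by an algebra\<close>

text \<open>As \<open>M\<close> is invariant, the image under \<open>T\<close> of the measure with
  density f has density f composed with \<open>T'\<close>. Densities are almost everywhere unique,
  and composing with \<open>T\<close> gives the claim.\<close>

lemma invariant_density:
  assumes "finite_measure M" and T[measurable]: "T \<in> M \<rightarrow>\<^sub>M M" and T'[measurable]: "T' \<in> M \<rightarrow>\<^sub>M M"
    and inv: "\<And>x. x \<in> space M \<Longrightarrow> T' (T x) = x"
    and M: "distr M M T = M" and f[measurable]: "f \<in> borel_measurable M"
    and N: "distr (density M f) M T = density M f"
  shows "AE x in M. f (T x) = f x"
proof -
  interpret finite_measure M by fact
  have "density M (\<lambda>x. f (T' x)) = density M f"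
  proof (rule measure_eqI)
    fix A assume "A \<in> sets (density M (\<lambda>x. f (T' x)))"
    then have A[measurable]: "A \<in> sets M" by simp
    have "emeasure (density M (\<lambda>x. f (T' x))) A = (\<integral>\<^sup>+x. f (T' x) * indicator A x \<partial>distr M M T)"
      by (simp add: emeasure_density M)
    also have "\<dots> = (\<integral>\<^sup>+x. f (T' (T x)) * indicator A (T x) \<partial>M)"
      by (subst nn_integral_distr) auto
    also have "\<dots> = (\<integral>\<^sup>+x. f x * indicator (T -` A \<inter> space M) x \<partial>M)"
      by (intro nn_integral_cong) (auto simp: inv indicator_def)
    also have "\<dots> = emeasure (distr (density M f) M T) A"
      by (simp add: emeasure_density emeasure_distr)
    finally show "emeasure (density M (\<lambda>x. f (T' x))) A = emeasure (density M f) A"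
      by (simp add: N)
  qed simp
  then have "AE x in M. f (T' x) = f x"
    by (subst (asm) density_unique_iff) auto
  then have "AE x in distr M M T. f (T' x) = f x" unfolding M .
  then have "AE x in M. f (T' (T x)) = f (T x)"
    by (subst (asm) AE_distr_iff) auto
  with AE_space show ?thesis by eventually_elim (simp add: inv)
qed

text \<open>The density f of \<open>N\<close> is constant along almost every orbit, so the event f >
  1 is null or full up to null sets; as f has mean one, only f = 1 remains.\<close>

lemma ergodic_absolutely_continuous_unique:
  assumes "prob_space M" and T[measurable]: "T \<in> M \<rightarrow>\<^sub>M M" and T'[measurable]: "T' \<in> M \<rightarrow>\<^sub>M M"
    and inv: "\<And>x. x \<in> space M \<Longrightarrow> T' (T x) = x"
    and M: "distr M M T = M"
    and erg: "\<And>B. B \<in> sets M \<Longrightarrow> T -` B \<inter> space M = B \<Longrightarrow> measure M B = 0 \<or> measure M B = 1"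
    and N: "prob_space N" "sets N = sets M" "distr N M T = N" "absolutely_continuous M N"
  shows "N = M"
proof -
  interpret prob_space M by fact
  interpret N: prob_space N by fact
  obtain f where f[measurable]: "f \<in> borel_measurable M" and Nf: "N = density M f"
    using Radon_Nikodym[OF N(4,2)] by metis
  have ae1: "AE x in M. f (T x) = f x"
    using invariant_density[OF finite_measure_axioms T T' inv M f] N(3) by (simp add: Nf)
  have Tn[measurable]: "(T ^^ n) \<in> M \<rightarrow>\<^sub>M M" for n
    by (induction n) (auto simp: id_def intro: measurable_comp[OF _ T])
  have Minv: "distr M M (T ^^ n) = M" for n
  proof (induction n)
    case 0 then show ?case by (simp add: id_def distr_id)
  next
    case (Suc n)
    have "distr M M (T ^^ Suc n) = distr (distr M M (T ^^ n)) M T"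
      by (subst distr_distr) auto
    then show ?case using Suc M by (simp add: o_def)
  qed
  have "AE x in distr M M (T ^^ n). f (T x) = f x" for n
    unfolding Minv by (rule ae1)
  then have aeSuc: "AE x in M. f (T ((T ^^ n) x)) = f ((T ^^ n) x)" for n
    by (subst (asm) AE_distr_iff) auto
  have aen: "AE x in M. f ((T ^^ n) x) = f x" for n
  proof (induction n)
    case (Suc n)
    then show ?case using aeSuc[of n] by eventually_elim simp
  qed simp
  \<comment> \<open>The density is invariant only almost everywhere, while ergodicity is assumed for
    exactly invariant events. The limsup along the orbit agrees with f almost everywhere and is
    exactly invariant, since it ignores the first term.\<close>
  define d where "d x = limsup (\<lambda>n. f ((T ^^ n) x))" for x
  have [measurable]: "d \<in> borel_measurable M" unfolding d_def by measurable
  have "AE x in M. \<forall>n. f ((T ^^ n) x) = f x"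
    using aen by (simp add: AE_all_countable)
  then have df: "AE x in M. d x = f x"
    by eventually_elim (simp add: d_def Limsup_const)
  have dT: "d (T x) = d x" for x
    using limsup_shift[of "\<lambda>n. f ((T ^^ n) x)"] by (simp add: d_def funpow_swap1)
  define H where "H = {x\<in>space M. 1 < d x}"
  have H[measurable]: "H \<in> sets M" unfolding H_def by measurable
  have "T -` H \<inter> space M = H"
    using measurable_space[OF T] by (auto simp: H_def dT)
  then consider "measure M H = 0" | "measure M H = 1" using erg[OF H] by auto
  moreover have int1: "(\<integral>\<^sup>+x. f x \<partial>M) = 1"
    using N.emeasure_space_1 by (simp add: Nf emeasure_density cong: nn_integral_cong_simp)
  ultimately have "AE x in M. f x = 1"
  proof cases
    case 1
    then have "AE x in M. x \<notin> H"
      by (subst AE_iff_measurable[OF H]) (auto simp: emeasure_eq_measure H_def)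
    with df AE_space have le: "AE x in M. f x \<le> 1"
      by eventually_elim (auto simp: H_def)
    have "(\<integral>\<^sup>+x. 1 - f x \<partial>M) = (\<integral>\<^sup>+x. 1 \<partial>M) - (\<integral>\<^sup>+x. f x \<partial>M)"
      using le int1 by (intro nn_integral_diff) auto
    also have "\<dots> = 0" by (simp add: int1 emeasure_space_1)
    finally have "AE x in M. 1 - f x = 0"
      by (subst (asm) nn_integral_0_iff_AE) auto
    with le show ?thesis by eventually_elim (simp add: diff_eq_0_iff_ennreal)
  next
    case 2
    then have "AE x in M. x \<in> H" by (simp add: prob_eq_1)
    with df have gt: "AE x in M. 1 < f x"
      by eventually_elim (auto simp: H_def)
    then have "(\<integral>\<^sup>+x. f x - 1 \<partial>M) = (\<integral>\<^sup>+x. f x \<partial>M) - (\<integral>\<^sup>+x. 1 \<partial>M)"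
      by (intro nn_integral_diff) (auto simp: emeasure_space_1 elim: eventually_mono)
    also have "\<dots> = 0" by (simp add: int1 emeasure_space_1)
    finally have "AE x in M. f x - 1 = 0"
      by (subst (asm) nn_integral_0_iff_AE) auto
    with gt have "AE x in M. False" by eventually_elim (auto simp: diff_eq_0_iff_ennreal)
    then show ?thesis by simp
  qed
  then have "density M f = density M (\<lambda>_. 1)" by (intro density_cong) auto
  then show ?thesis by (simp add: Nf density_1)
qed

lemma algebra_approximation:
  assumes "finite_measure M" and alg: "algebra \<Omega> G" and sets: "sets M = sigma_sets \<Omega> G"
    and A: "A \<in> sets M" and e: "0 < (e::real)"
  shows "\<exists>B\<in>G. measure M ((A - B) \<union> (B - A)) < e"
proof -
  interpret finite_measure M by fact
  interpret G: algebra \<Omega> G by fact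
  have GM: "B \<in> sets M" if "B \<in> G" for B using that sets by auto
  have sp: "space M = \<Omega>"
    using sets_eq_imp_space_eq[of M "sigma \<Omega> G"] sets G.space_closed by (simp add: sets_measure_of space_measure_of_conv)
  have "A \<in> sigma_sets \<Omega> G" using A sets by simp
  then show ?thesis using e
  proof (induction arbitrary: e)
    case (Basic a)
    then show ?case by (auto intro!: bexI[of _ a])
  next
    case Empty
    then show ?case by (auto intro!: bexI[of _ "{}"])
  next
    case (Compl a)
    then obtain B where B: "B \<in> G" "measure M ((a - B) \<union> (B - a)) < e" by auto
    have "a \<subseteq> \<Omega>" using Compl(1) G.space_closed sigma_sets_into_sp by blast
    then have "(\<Omega> - a - (\<Omega> - B)) \<union> (\<Omega> - B - (\<Omega> - a)) = (a - B) \<union> (B - a)"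
      using B(1) G.space_closed by auto
    then show ?case using B by (intro bexI[of _ "\<Omega> - B"]) auto
  next
    case (Union a)
    have a[measurable]: "a i \<in> sets M" for i using Union(1) sets by simp
    let ?U = "\<lambda>n. \<Union>i<n. a i"
    have "(\<lambda>n. measure M (?U n)) \<longlonglongrightarrow> measure M (\<Union>n. ?U n)"
      by (intro finite_Lim_measure_incseq) (auto simp: incseq_def, force)
    also have "(\<Union>n. ?U n) = (\<Union>i. a i)" by auto
    finally have "eventually (\<lambda>n. measure M (\<Union>i. a i) - e / 2 < measure M (?U n)) sequentially"
      by (rule order_tendstoD) (use \<open>0 < e\<close> in simp)
    then obtain n where n: "measure M (\<Union>i. a i) - measure M (?U n) < e / 2"
      by (auto simp: eventually_sequentially field_simps)
    \<comment> \<open>The n approximation errors add up to at most e/2, the other half being spent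
      on truncating the union; \<open>n + 1\<close> keeps the denominator positive when n =
      0.\<close>
    have "\<forall>i. \<exists>B\<in>G. measure M ((a i - B) \<union> (B - a i)) < e / (2 * (real n + 1))"
      using \<open>0 < e\<close> by (intro allI Union.IH) auto
    then obtain B where B: "\<And>i. B i \<in> G" "\<And>i. measure M ((a i - B i) \<union> (B i - a i)) < e / (2 * (real n + 1))"
      by metis
    note [measurable] = GM[OF B(1)]
    let ?B = "\<Union>i<n. B i"
    let ?D = "\<lambda>i. (a i - B i) \<union> (B i - a i)"
    have "measure M (((\<Union>i. a i) - ?B) \<union> (?B - (\<Union>i. a i))) \<le> measure M (((\<Union>i. a i) - ?U n) \<union> (\<Union>i<n. ?D i))"
      by (intro finite_measure_mono) auto
    also have "\<dots> \<le> measure M ((\<Union>i. a i) - ?U n) + measure M (\<Union>i<n. ?D i)"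
      by (intro measure_Un_le) auto
    also have "measure M ((\<Union>i. a i) - ?U n) = measure M (\<Union>i. a i) - measure M (?U n)"
      by (intro finite_measure_Diff) auto
    also have "measure M (\<Union>i<n. ?D i) \<le> (\<Sum>i<n. measure M (?D i))"
      by (intro measure_UNION_le) auto
    also have "\<dots> \<le> (\<Sum>i<n. e / (2 * (real n + 1)))"
      using B(2) by (intro sum_mono) (auto intro: less_imp_le)
    also have "\<dots> \<le> e / 2"
      using \<open>0 < e\<close> by (simp add: field_simps)
    finally have "measure M (((\<Union>i. a i) - ?B) \<union> (?B - (\<Union>i. a i))) < e"
      using n by simp
    moreover have "?B \<in> G" using B(1) by auto
    ultimately show ?case by blast
  qed
qed

section \<open>Paths and the Markov property\<close>

lemma space_path_space: "space (path_space N) = UNIV \<rightarrow>\<^sub>E space N"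
  by (simp add: path_space_def space_PiM)

lemma space_path_borel [simp]: "space (path_space borel) = UNIV"
  by (simp add: space_path_space PiE_UNIV_domain)

lemma space_path_pair [simp]: "space (path_space (borel \<Otimes>\<^sub>M borel)) = UNIV"
  by (simp add: space_path_space PiE_UNIV_domain space_pair_measure)

lemma measurable_coord [measurable (raw)]: "(\<lambda>\<omega>. \<omega> s) \<in> path_space N \<rightarrow>\<^sub>M N"
  unfolding path_space_def by (rule measurable_component_singleton) simp

lemma measurable_path_spaceI:
  assumes "\<And>s. (\<lambda>x. f x s) \<in> M \<rightarrow>\<^sub>M N"
  shows "f \<in> M \<rightarrow>\<^sub>M path_space N"
  unfolding path_space_def
  by (rule measurable_PiM_single') (auto simp: PiE_UNIV_domain intro: assms measurable_space[OF assms])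

definition shiftk :: "int \<Rightarrow> (int \<Rightarrow> 'a) \<Rightarrow> (int \<Rightarrow> 'a)" where
  "shiftk k \<omega> = (\<lambda>s. \<omega> (s + k))"

lemma shift_eq_shiftk: "shift = shiftk 1"
  by (auto simp: shift_def shiftk_def fun_eq_iff)

lemma shiftk_shiftk: "shiftk j (shiftk k \<omega>) = shiftk (j + k) \<omega>"
  by (simp add: shiftk_def fun_eq_iff algebra_simps)

lemma shiftk_0 [simp]: "shiftk 0 \<omega> = \<omega>"
  by (simp add: shiftk_def)

lemma measurable_shiftk [measurable]: "shiftk k \<in> path_space N \<rightarrow>\<^sub>M path_space N"
  unfolding shiftk_def by (rule measurable_path_spaceI) measurable

lemma measurable_shift [measurable]: "shift \<in> path_space N \<rightarrow>\<^sub>M path_space N"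
  unfolding shift_eq_shiftk by measurable

text \<open>For negative k the law is first replaced by its own image under the shift by
  \<open>- k\<close>; then the two shifts cancel.\<close>

lemma stationary_shiftk:
  assumes "stationary_law N Q"
  shows "distr Q (path_space N) (shiftk k) = Q"
proof -
  have sQ[measurable_cong]: "sets Q = sets (path_space N)" and s: "distr Q (path_space N) (shiftk 1) = Q"
    using assms by (auto simp: stationary_law_def shift_eq_shiftk)
  have n: "distr Q (path_space N) (shiftk (int n)) = Q" for n
  proof (induction n)
    case 0
    have "distr Q (path_space N) (\<lambda>x. x) = Q" by (rule distr_id2) (simp add: sQ)
    then show ?case by (simp add: shiftk_def)
  next
    case (Suc n)
    have "distr (distr Q (path_space N) (shiftk (int n))) (path_space N) (shiftk 1) = distr Q (path_space N) (shiftk (int (Suc n)))"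
      by (subst distr_distr) (auto simp: o_def shiftk_shiftk)
    then show ?case by (simp add: Suc s)
  qed
  show ?thesis
  proof (cases "0 \<le> k")
    case True
    then show ?thesis using n[of "nat k"] by simp
  next
    case False
    then have k: "k + int (nat (- k)) = 0" by simp
    have "distr (distr Q (path_space N) (shiftk (int (nat (- k))))) (path_space N) (shiftk k) = distr Q (path_space N) (\<lambda>x. x)"
      by (subst distr_distr) (auto simp: o_def shiftk_shiftk k simp del: int_nat_eq)
    also have "\<dots> = Q" by (rule distr_id2) (simp add: sQ)
    finally show ?thesis by (simp only: n)
  qed
qed

section \<open>Windows of the first component with the environment kept whole\<close>

text \<open>What is retained is the entire environment and Y_a, ..., Y_b; outside the window Y is
  frozen at the nearer end. All windows thus live on the single space \<open>PE\<close> and nest by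
  \<open>clampY_clampY\<close>.\<close>

definition clampY :: "int \<Rightarrow> int \<Rightarrow> (int \<Rightarrow> 'e \<times> 'f) \<Rightarrow> (int \<Rightarrow> 'e \<times> 'f)" where
  "clampY a b \<omega> = (\<lambda>s. (fst (\<omega> (max a (min s b))), snd (\<omega> s)))"

text \<open>On a path frozen after \<open>t - 1\<close> this inserts a new value at time t and
  freezes it from there on, which gives the path clamped one step later
  (\<open>clampY_Suc\<close>).\<close>

definition setY :: "int \<Rightarrow> (int \<Rightarrow> 'e \<times> 'f) \<Rightarrow> 'e \<Rightarrow> (int \<Rightarrow> 'e \<times> 'f)" where
  "setY t \<omega> y = (\<lambda>s. if t \<le> s then (y, snd (\<omega> s)) else \<omega> s)"

definition obs :: "(int \<Rightarrow> 'e \<times> 'f) \<Rightarrow> (int \<Rightarrow> 'f) \<times> 'e" where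
  "obs \<omega> = ((\<lambda>s. snd (\<omega> s)), fst (\<omega> 0))"

text \<open>A section of observing at time a: coordinate 0 of the environment is placed at time a,
  and Y is constant.\<close>

definition start :: "int \<Rightarrow> (int \<Rightarrow> 'f) \<times> 'e \<Rightarrow> (int \<Rightarrow> 'e \<times> 'f)" where
  "start a z = (\<lambda>s. (snd z, fst z (s - a)))"

lemma obs_apply: "fst (obs \<omega>) = (\<lambda>s. snd (\<omega> s))" "snd (obs \<omega>) = fst (\<omega> 0)"
  by (simp_all add: obs_def)

lemma clampY_clampY: "a' \<le> a \<Longrightarrow> a \<le> b \<Longrightarrow> b \<le> b' \<Longrightarrow> clampY a b (clampY a' b' \<omega>) = clampY a b \<omega>"
  by (auto simp: clampY_def fun_eq_iff max_def min_def)

lemma clampY_Suc: "a \<le> b \<Longrightarrow> clampY a (b + 1) \<omega> = setY (b + 1) (clampY a b \<omega>) (fst (\<omega> (b + 1)))"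
  by (auto simp: clampY_def setY_def fun_eq_iff max_def min_def)

lemma clampY_setY: "a \<le> b \<Longrightarrow> clampY a b (setY (b + 1) \<omega> y) = clampY a b \<omega>"
  by (auto simp: clampY_def setY_def fun_eq_iff max_def min_def)

lemma clampY_at: "a \<le> s \<Longrightarrow> s \<le> b \<Longrightarrow> clampY a b \<omega> s = \<omega> s"
  by (auto simp: clampY_def max_def min_def)

lemma clampY_shiftk: "clampY a b (shiftk k \<omega>) = shiftk k (clampY (a + k) (b + k) \<omega>)"
  by (auto simp: clampY_def shiftk_def fun_eq_iff max_def min_def)

lemma clampY_self: "clampY a a \<omega> = start a (obs (shiftk a \<omega>))"
  by (auto simp: clampY_def shiftk_def start_def obs_def fun_eq_iff max_def min_def)

lemma obs_clampY: "obs (clampY 0 0 \<omega>) = obs \<omega>" and obs_shift_clampY: "obs (shift (clampY 0 1 \<omega>)) = obs (shift \<omega>)"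
  by (auto simp: obs_def clampY_def shift_def)

abbreviation PE :: "(int \<Rightarrow> 'e::topological_space \<times> 'f::topological_space) measure" where
  "PE \<equiv> path_space (borel \<Otimes>\<^sub>M borel)"

abbreviation PF :: "(int \<Rightarrow> 'f::topological_space) measure" where
  "PF \<equiv> path_space borel"

lemma measurable_clampY [measurable]: "clampY a b \<in> PE \<rightarrow>\<^sub>M PE"
  unfolding clampY_def by (intro measurable_path_spaceI measurable_Pair) measurable

lemma measurable_setY [measurable]:
  "(\<lambda>(\<omega>, y). setY t \<omega> y) \<in>
    (PE :: (int \<Rightarrow> 'e::topological_space \<times> 'f::topological_space) measure) \<Otimes>\<^sub>M borel \<rightarrow>\<^sub>M PE"
  unfolding setY_def split_beta'
proof (rule measurable_path_spaceI)
  fix s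
  have [measurable]: "(\<lambda>x. fst x s) \<in> PE \<Otimes>\<^sub>M (borel :: 'e measure) \<rightarrow>\<^sub>M borel \<Otimes>\<^sub>M (borel :: 'f measure)"
    by (rule measurable_compose[OF measurable_fst measurable_coord])
  show "(\<lambda>x. if t \<le> s then (snd x, snd (fst x s)) else fst x s) \<in>
      PE \<Otimes>\<^sub>M (borel :: 'e measure) \<rightarrow>\<^sub>M borel \<Otimes>\<^sub>M (borel :: 'f measure)"
    by (cases "t \<le> s") simp_all
qed

lemma measurable_setY1 [measurable]: "setY t \<omega> \<in> borel \<rightarrow>\<^sub>M PE"
  unfolding setY_def
proof (rule measurable_path_spaceI)
  show "(\<lambda>y. if t \<le> s then (y, snd (\<omega> s)) else \<omega> s) \<in> borel \<rightarrow>\<^sub>M borel \<Otimes>\<^sub>M borel" for s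
    by (cases "t \<le> s") (simp_all add: space_pair_measure)
qed

lemma measurable_envpath [measurable]: "(\<lambda>\<omega> s. snd (\<omega> s)) \<in> PE \<rightarrow>\<^sub>M PF"
  by (rule measurable_path_spaceI) measurable

lemma measurable_obs [measurable]: "obs \<in> PE \<rightarrow>\<^sub>M PF \<Otimes>\<^sub>M borel"
  unfolding obs_def by measurable

lemma measurable_start [measurable]: "start a \<in> PF \<Otimes>\<^sub>M borel \<rightarrow>\<^sub>M PE"
  unfolding start_def
  by (rule measurable_path_spaceI) (auto intro!: measurable_Pair measurable_compose[OF measurable_fst measurable_coord])

text \<open>Every measurable cylinder depends on finitely many times, so it is unaffected by freezing the
  first component outside a large window.\<close>
lemma eq_if_clampY_eq:
  assumes Q: "prob_space Q" "sets Q = sets PE" and Q': "sets Q' = sets PE"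
    and eq: "\<And>a b. a \<le> b \<Longrightarrow> distr Q PE (clampY a b) = distr Q' PE (clampY a b)"
  shows "Q = Q'"
proof (rule measure_eqI_PiM_infinite)
  interpret prob_space Q by fact
  show "finite_measure Q" by (rule finite_measure_axioms)
  show "sets Q = sets (\<Pi>\<^sub>M s\<in>UNIV. borel \<Otimes>\<^sub>M borel)" "sets Q' = sets (\<Pi>\<^sub>M s\<in>UNIV. borel \<Otimes>\<^sub>M borel)"
    using Q Q' by (simp_all add: path_space_def)
  fix A :: "int \<Rightarrow> ('a \<times> 'b) set" and J :: "int set"
  assume J: "finite J" "J \<subseteq> UNIV" and A: "\<And>i. i \<in> J \<Longrightarrow> A i \<in> sets (borel \<Otimes>\<^sub>M borel)"
  define C where "C = prod_emb UNIV (\<lambda>s. borel \<Otimes>\<^sub>M borel) J (Pi\<^sub>E J A)"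
  have C[measurable]: "C \<in> sets PE"
    unfolding C_def path_space_def using J A by (intro sets_PiM_I) auto
  \<comment> \<open>The sum of the absolute values bounds J on both sides and needs no separate
    treatment of the empty set.\<close>
  obtain a b where ab: "a \<le> b" "\<And>j. j \<in> J \<Longrightarrow> a \<le> j \<and> j \<le> b"
  proof
    show "- (\<Sum>j\<in>J. \<bar>j\<bar>) \<le> (\<Sum>j\<in>J. \<bar>j\<bar>)"
      using sum_nonneg[of J "\<lambda>j. \<bar>j\<bar>"] by simp
    fix j assume "j \<in> J"
    then have "\<bar>j\<bar> \<le> (\<Sum>j\<in>J. \<bar>j\<bar>)" using J(1) by (intro member_le_sum) auto
    then show "- (\<Sum>j\<in>J. \<bar>j\<bar>) \<le> j \<and> j \<le> (\<Sum>j\<in>J. \<bar>j\<bar>)" by auto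
  qed
  have inv: "clampY a b -` C = C"
    using ab by (auto simp: C_def prod_emb_iff PiE_iff clampY_at space_pair_measure extensional_def)
  have cl: "emeasure L C = emeasure (distr L PE (clampY a b)) C" if s: "sets L = sets PE" for L
  proof -
    have "clampY a b \<in> L \<rightarrow>\<^sub>M PE"
      using measurable_clampY by (simp only: measurable_cong_sets[OF s refl])
    then have "emeasure (distr L PE (clampY a b)) C = emeasure L (clampY a b -` C \<inter> space L)"
      using C by (rule emeasure_distr)
    then show ?thesis
      using sets_eq_imp_space_eq[OF s] by (simp only: inv space_path_pair Int_UNIV_right)
  qed
  show "emeasure Q (prod_emb UNIV (\<lambda>s. borel \<Otimes>\<^sub>M borel) J (Pi\<^sub>E J A))
      = emeasure Q' (prod_emb UNIV (\<lambda>s. borel \<Otimes>\<^sub>M borel) J (Pi\<^sub>E J A))"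
    unfolding C_def[symmetric] by (simp only: cl[OF Q(2)] cl[OF Q'] eq[OF ab(1)])
qed

lemma measure_eqI_pair:
  assumes "finite_measure Q" and sets: "sets Q = sets (M \<Otimes>\<^sub>M N)" "sets Q' = sets (M \<Otimes>\<^sub>M N)"
    and eq: "\<And>A B. A \<in> sets M \<Longrightarrow> B \<in> sets N \<Longrightarrow> emeasure Q (A \<times> B) = emeasure Q' (A \<times> B)"
  shows "Q = Q'"
proof (rule measure_eqI_generator_eq[OF Int_stable_pair_measure_generator pair_measure_closed])
  interpret finite_measure Q by fact
  show "sets Q = sigma_sets (space M \<times> space N) {a \<times> b |a b. a \<in> sets M \<and> b \<in> sets N}"
    "sets Q' = sigma_sets (space M \<times> space N) {a \<times> b |a b. a \<in> sets M \<and> b \<in> sets N}"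
    using sets by (simp_all add: sets_pair_measure)
  show "range (\<lambda>_::nat. space M \<times> space N) \<subseteq> {a \<times> b |a b. a \<in> sets M \<and> b \<in> sets N}"
    by auto
  show "emeasure Q (space M \<times> space N) \<noteq> \<infinity>" for i :: nat by simp
qed (auto simp: eq)

section \<open>The Markov property as a recursion over windows\<close>

locale random_kernel =
  fixes P :: "'f::polish_space \<Rightarrow> 'e::polish_space \<Rightarrow> 'e measure"
  assumes P_meas: "(\<lambda>(x, y). P x y) \<in> borel \<Otimes>\<^sub>M borel \<rightarrow>\<^sub>M prob_algebra borel"
begin

lemma measurable_P [measurable (raw)]:
  assumes "f \<in> M \<rightarrow>\<^sub>M borel" "g \<in> M \<rightarrow>\<^sub>M borel"
  shows "(\<lambda>w. P (f w) (g w)) \<in> M \<rightarrow>\<^sub>M prob_algebra borel"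
  using measurable_compose[OF measurable_Pair[OF assms] P_meas] by simp

lemma P_prob: "prob_space (P x y)" "sets (P x y) = sets borel" "space (P x y) = UNIV"
  using measurable_space[OF P_meas, of "(x, y)"]
  by (auto simp: space_prob_algebra space_pair_measure dest: sets_eq_imp_space_eq)

lemma measurable_emeasure_P:
  assumes "f \<in> M \<rightarrow>\<^sub>M borel" "g \<in> M \<rightarrow>\<^sub>M borel" "A \<in> sets borel"
  shows "(\<lambda>w. emeasure (P (f w) (g w)) A) \<in> borel_measurable M"
  using measurable_P[OF assms(1,2)] assms(3) by (rule measurable_emeasure_prob_kernel)

definition resamp :: "int \<Rightarrow> (int \<Rightarrow> 'e \<times> 'f) \<Rightarrow> (int \<Rightarrow> 'e \<times> 'f) measure" where
  "resamp t \<omega> = distr (P (snd (\<omega> (t - 1))) (fst (\<omega> (t - 1)))) PE (setY t \<omega>)"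

text \<open>The conditional law of Y_(b+1), tested only on events of the environment and a finite
  stretch of Y ending at b. These events are a pi-system generating the past, which is why the
  property is equivalent to the one with conditional expectations.\<close>

definition markov_law :: "(int \<Rightarrow> 'e \<times> 'f) measure \<Rightarrow> bool" where
  "markov_law Q \<longleftrightarrow> (\<forall>a b. \<forall>C\<in>sets PE. \<forall>A\<in>sets borel. a \<le> b \<longrightarrow>
     emeasure Q (clampY a b -` C \<inter> {\<omega>. fst (\<omega> (b + 1)) \<in> A}) =
     (\<integral>\<^sup>+\<omega>. indicator C (clampY a b \<omega>) * emeasure (P (snd (\<omega> b)) (fst (\<omega> b))) A \<partial>Q))"

lemma measurable_resamp [measurable]: "resamp t \<in> PE \<rightarrow>\<^sub>M prob_algebra PE"
  unfolding resamp_def by (rule measurable_distr_prob_space2) measurable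

text \<open>The Markov identity fixes the joint law of the clamped path and the next value on
  rectangles, hence everywhere; \<open>setY\<close> then glues the two together.\<close>

lemma markov_law_step:
  assumes m: "markov_law Q" and "prob_space Q" and sQ[measurable_cong]: "sets Q = sets PE" and ab: "a \<le> b"
  shows "distr Q PE (clampY a (b + 1)) = distr Q PE (clampY a b) \<bind> resamp (b + 1)"
proof -
  interpret prob_space Q by fact
  have spQ: "space Q = UNIV" using sets_eq_imp_space_eq[OF sQ] by simp
  define J1 where "J1 = distr Q (PE \<Otimes>\<^sub>M borel) (\<lambda>\<omega>. (clampY a b \<omega>, fst (\<omega> (b + 1))))"
  define g where "g \<omega> = distr (P (snd (\<omega> b)) (fst (\<omega> b))) (PE \<Otimes>\<^sub>M borel) (\<lambda>y. (clampY a b \<omega>, y))" for \<omega>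
  have g[measurable]: "g \<in> PE \<rightarrow>\<^sub>M prob_algebra (PE \<Otimes>\<^sub>M borel)"
    unfolding g_def by (rule measurable_distr_prob_space2) measurable
  have "J1 = Q \<bind> g"
  proof (rule measure_eqI_pair)
    interpret J1: prob_space J1 unfolding J1_def by (rule prob_space_distr) measurable
    show "finite_measure J1" by (rule J1.finite_measure_axioms)
    show "sets J1 = sets (PE \<Otimes>\<^sub>M borel)" by (simp add: J1_def)
    show "sets (Q \<bind> g) = sets (PE \<Otimes>\<^sub>M borel)"
      by (rule sets_bind_kernel[OF g sQ]) simp
    fix C :: "(int \<Rightarrow> 'e \<times> 'f) set" and A :: "'e set" assume [measurable]: "C \<in> sets PE" "A \<in> sets borel"
    have "emeasure J1 (C \<times> A) = emeasure Q (clampY a b -` C \<inter> {\<omega>. fst (\<omega> (b + 1)) \<in> A})"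
      unfolding J1_def by (subst emeasure_distr) (auto simp: spQ intro!: arg_cong[where f="emeasure Q"])
    also have "\<dots> = (\<integral>\<^sup>+\<omega>. indicator C (clampY a b \<omega>) * emeasure (P (snd (\<omega> b)) (fst (\<omega> b))) A \<partial>Q)"
      using m ab by (auto simp: markov_law_def)
    also have "\<dots> = (\<integral>\<^sup>+\<omega>. emeasure (g \<omega>) (C \<times> A) \<partial>Q)"
    proof (intro nn_integral_cong)
      fix \<omega>
      have "(\<lambda>y. (clampY a b \<omega>, y)) -` (C \<times> A) = (if clampY a b \<omega> \<in> C then A else {})" by auto
      then show "indicator C (clampY a b \<omega>) * emeasure (P (snd (\<omega> b)) (fst (\<omega> b))) A = emeasure (g \<omega>) (C \<times> A)"
        unfolding g_def by (subst emeasure_distr) (auto simp: P_prob measurable_cong_sets[OF P_prob(2) refl])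
    qed
    also have "\<dots> = emeasure (Q \<bind> g) (C \<times> A)"
      by (rule emeasure_bind_kernel[OF g sQ, symmetric]) auto
    finally show "emeasure J1 (C \<times> A) = emeasure (Q \<bind> g) (C \<times> A)" .
  qed
  have "clampY a (b + 1) = (\<lambda>\<omega> :: int \<Rightarrow> 'e \<times> 'f. setY (b + 1) (clampY a b \<omega>) (fst (\<omega> (b + 1))))"
    by (rule ext) (rule clampY_Suc[OF ab])
  then have "distr Q PE (clampY a (b + 1)) = distr J1 PE (\<lambda>(\<omega>, y). setY (b + 1) \<omega> y)"
    unfolding J1_def by (subst distr_distr) (auto simp: o_def)
  also have "\<dots> = Q \<bind> (\<lambda>\<omega>. distr (g \<omega>) PE (\<lambda>(\<omega>, y). setY (b + 1) \<omega> y))"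
    unfolding \<open>J1 = Q \<bind> g\<close>
    by (rule distr_bind[where K="PE \<Otimes>\<^sub>M borel"]) (auto simp: spQ intro: measurable_prob_algebraD)
  also have "\<dots> = Q \<bind> (\<lambda>\<omega>. resamp (b + 1) (clampY a b \<omega>))"
  proof (rule bind_cong[OF refl])
    fix \<omega>
    show "distr (g \<omega>) PE (\<lambda>(\<omega>, y). setY (b + 1) \<omega> y) = resamp (b + 1) (clampY a b \<omega>)"
      unfolding g_def resamp_def using ab
      by (subst distr_distr) (auto simp: o_def clampY_at measurable_cong_sets[OF P_prob(2) refl])
  qed
  also have "\<dots> = distr Q PE (clampY a b) \<bind> resamp (b + 1)"
    by (rule bind_distr[symmetric, where K=PE]) (auto simp: spQ intro: measurable_prob_algebraD)
  finally show ?thesis .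
qed

text \<open>The tested event is visible in the window from a to \<open>b + 1\<close>. Under
  \<open>resamp (b + 1)\<close> its past half is deterministic, because \<open>setY\<close> at
  \<open>b + 1\<close> leaves the window up to b alone, so only the factor from \<open>P\<close>
  remains.\<close>

lemma markov_lawI:
  assumes "prob_space Q" and sQ[measurable_cong]: "sets Q = sets PE"
    and step: "\<And>a b. a \<le> b \<Longrightarrow> distr Q PE (clampY a (b + 1)) = distr Q PE (clampY a b) \<bind> resamp (b + 1)"
  shows "markov_law Q"
  unfolding markov_law_def
proof (intro allI ballI impI)
  fix a b :: int and C :: "(int \<Rightarrow> 'e \<times> 'f) set" and A :: "'e set"
  assume [measurable]: "C \<in> sets PE" "A \<in> sets borel" and ab: "a \<le> b"
  have spQ: "space Q = UNIV" using sets_eq_imp_space_eq[OF sQ] by simp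
  let ?D = "{\<omega>. clampY a b \<omega> \<in> C \<and> fst (\<omega> (b + 1)) \<in> A}"
  have D: "?D \<in> sets PE"
  proof -
    have "{\<omega> \<in> space PE. clampY a b \<omega> \<in> C \<and> fst (\<omega> (b + 1)) \<in> A} \<in> sets PE" by measurable
    then show ?thesis by simp
  qed
  have cl: "clampY a b (clampY a (b + 1) \<omega>) = clampY a b \<omega>" for \<omega> :: "int \<Rightarrow> 'e \<times> 'f"
    using ab by (intro clampY_clampY) auto
  have "emeasure Q (clampY a b -` C \<inter> {\<omega>. fst (\<omega> (b + 1)) \<in> A}) = emeasure (distr Q PE (clampY a (b + 1))) ?D"
    using D ab by (subst emeasure_distr) (auto simp: spQ cl clampY_at intro!: arg_cong[where f="emeasure Q"])
  also have "\<dots> = (\<integral>\<^sup>+\<omega>. emeasure (resamp (b + 1) \<omega>) ?D \<partial>distr Q PE (clampY a b))"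
    unfolding step[OF ab] by (rule emeasure_bind_kernel[OF measurable_resamp]) (auto simp: D)
  also have "\<dots> = (\<integral>\<^sup>+\<omega>. emeasure (resamp (b + 1) (clampY a b \<omega>)) ?D \<partial>Q)"
    using measurable_emeasure_prob_kernel[OF measurable_resamp D] by (subst nn_integral_distr) auto
  also have "\<dots> = (\<integral>\<^sup>+\<omega>. indicator C (clampY a b \<omega>) * emeasure (P (snd (\<omega> b)) (fst (\<omega> b))) A \<partial>Q)"
  proof (intro nn_integral_cong)
    fix \<omega> :: "int \<Rightarrow> 'e \<times> 'f"
    have "clampY a b (setY (b + 1) (clampY a b \<omega>) y) = clampY a b \<omega>" for y
      using ab by (simp add: clampY_setY clampY_clampY)
    then have "setY (b + 1) (clampY a b \<omega>) -` ?D = (if clampY a b \<omega> \<in> C then A else {})"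
      by (auto simp: setY_def)
    then show "emeasure (resamp (b + 1) (clampY a b \<omega>)) ?D
        = indicator C (clampY a b \<omega>) * emeasure (P (snd (\<omega> b)) (fst (\<omega> b))) A"
      unfolding resamp_def using D ab
      by (subst emeasure_distr) (auto simp: P_prob clampY_at measurable_cong_sets[OF P_prob(2) refl])
  qed
  finally show "emeasure Q (clampY a b -` C \<inter> {\<omega>. fst (\<omega> (b + 1)) \<in> A}) =
     (\<integral>\<^sup>+\<omega>. indicator C (clampY a b \<omega>) * emeasure (P (snd (\<omega> b)) (fst (\<omega> b))) A \<partial>Q)" .
qed

text \<open>By stationarity the window consisting of the single time a has a law determined by
  \<open>obs\<close>; the Markov recursion then extends the window to the right, and windows
  determine the law.\<close>

lemma markov_law_unique:
  assumes Q: "markov_law Q" "prob_space Q" "sets Q = sets PE" "stationary_law (borel \<Otimes>\<^sub>M borel) Q"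
    and Q': "markov_law Q'" "prob_space Q'" "sets Q' = sets PE" "stationary_law (borel \<Otimes>\<^sub>M borel) Q'"
    and eq: "distr Q (PF \<Otimes>\<^sub>M borel) obs = distr Q' (PF \<Otimes>\<^sub>M borel) obs"
  shows "Q = Q'"
proof (rule eq_if_clampY_eq)
  have start: "distr L PE (clampY a a) = distr (distr L (PF \<Otimes>\<^sub>M borel) obs) PE (start a)"
    if [measurable_cong]: "sets L = sets PE" and s: "stationary_law (borel \<Otimes>\<^sub>M borel) L"
    for L :: "(int \<Rightarrow> 'e \<times> 'f) measure" and a
  proof -
    have "clampY a a = (\<lambda>\<omega> :: int \<Rightarrow> 'e \<times> 'f. start a (obs (shiftk a \<omega>)))"
      by (rule ext) (rule clampY_self)
    then have "distr L PE (clampY a a) = distr (distr L PE (shiftk a)) PE (\<lambda>\<omega>. start a (obs \<omega>))"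
      by (subst distr_distr) (auto simp: o_def)
    also have "\<dots> = distr L PE (\<lambda>\<omega>. start a (obs \<omega>))"
      by (simp add: stationary_shiftk[OF s])
    also have "\<dots> = distr (distr L (PF \<Otimes>\<^sub>M borel) obs) PE (start a)"
      by (subst distr_distr) (auto simp: o_def)
    finally show ?thesis .
  qed
  fix a b :: int assume "a \<le> b"
  then show "distr Q PE (clampY a b) = distr Q' PE (clampY a b)"
  proof (induction b rule: int_ge_induct)
    case base
    show ?case using eq Q Q' by (simp add: start)
  next
    case (step b)
    then show ?case using Q Q' by (simp add: markov_law_step)
  qed
qed fact+

definition kern :: "(int \<Rightarrow> 'f) \<times> 'e \<Rightarrow> ((int \<Rightarrow> 'f) \<times> 'e) measure" where
  "kern z = distr (P (fst z 0) (snd z)) (PF \<Otimes>\<^sub>M borel) (\<lambda>y. (shift (fst z), y))"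

lemma measurable_kern [measurable]: "kern \<in> PF \<Otimes>\<^sub>M borel \<rightarrow>\<^sub>M prob_algebra (PF \<Otimes>\<^sub>M borel)"
proof -
  have [measurable]: "(\<lambda>z. fst z 0) \<in> PF \<Otimes>\<^sub>M (borel :: 'e measure) \<rightarrow>\<^sub>M (borel :: 'f measure)"
    by (rule measurable_compose[OF measurable_fst measurable_coord])
  show ?thesis
    unfolding kern_def by (rule measurable_distr_prob_space2) measurable
qed

text \<open>Compare \<open>obs\<close> with \<open>obs\<close> after one shift: the latter sees Y_1
  and the shifted environment, and drawing Y_1 by \<open>resamp 1\<close> is precisely a step of
  \<open>kern\<close>. Stationarity identifies the two laws.\<close>

lemma markov_law_kern_invariant:
  assumes m: "markov_law Q" and "prob_space Q" and sQ[measurable_cong]: "sets Q = sets PE"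
    and stat: "stationary_law (borel \<Otimes>\<^sub>M borel) Q"
  shows "distr Q (PF \<Otimes>\<^sub>M borel) obs \<bind> kern = distr Q (PF \<Otimes>\<^sub>M borel) obs"
proof -
  interpret prob_space Q by fact
  have spQ: "space Q = UNIV" using sets_eq_imp_space_eq[OF sQ] by simp
  let ?S = "PF \<Otimes>\<^sub>M borel :: ((int \<Rightarrow> 'f) \<times> 'e) measure"
  have s1: "distr Q PE shift = Q" using stat by (simp add: stationary_law_def)
  have "distr Q ?S obs = distr (distr Q PE shift) ?S obs" by (simp add: s1)
  also have "\<dots> = distr (distr Q PE (clampY 0 1)) ?S (\<lambda>\<omega>. obs (shift \<omega>))"
    by (subst (1 2) distr_distr) (auto simp: o_def obs_shift_clampY)
  also have "\<dots> = distr (distr Q PE (clampY 0 0) \<bind> resamp 1) ?S (\<lambda>\<omega>. obs (shift \<omega>))"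
    using markov_law_step[OF m \<open>prob_space Q\<close> sQ, of 0 0] by simp
  also have "\<dots> = distr Q PE (clampY 0 0) \<bind> (\<lambda>\<omega>. distr (resamp 1 \<omega>) ?S (\<lambda>\<omega>. obs (shift \<omega>)))"
    by (rule distr_bind[where K=PE]) (auto intro: measurable_prob_algebraD)
  also have "\<dots> = distr Q PE (clampY 0 0) \<bind> (\<lambda>\<omega>. kern (obs \<omega>))"
  proof (rule bind_cong[OF refl])
    fix \<omega> :: "int \<Rightarrow> 'e \<times> 'f"
    have "obs (shift (setY 1 \<omega> y)) = (shift (fst (obs \<omega>)), y)" for y
      by (auto simp: obs_def setY_def shift_def)
    then show "distr (resamp 1 \<omega>) ?S (\<lambda>\<omega>. obs (shift \<omega>)) = kern (obs \<omega>)"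
      unfolding resamp_def kern_def
      by (subst distr_distr) (auto simp: o_def obs_apply measurable_cong_sets[OF P_prob(2) refl])
  qed
  also have "\<dots> = Q \<bind> (\<lambda>\<omega>. kern (obs (clampY 0 0 \<omega>)))"
    by (rule bind_distr[where K="?S"]) (auto simp: spQ intro!: measurable_prob_algebraD)
  also have "\<dots> = Q \<bind> (\<lambda>\<omega>. kern (obs \<omega>))" by (simp add: obs_clampY)
  also have "\<dots> = distr Q ?S obs \<bind> kern"
    by (rule bind_distr[symmetric, where K="?S"]) (auto simp: spQ intro!: measurable_prob_algebraD)
  finally show ?thesis by simp
qed

end

section \<open>The sigma-algebra of the past and conditional expectations\<close>

definition past_map :: "int \<Rightarrow> (int \<Rightarrow> 'e \<times> 'f) \<Rightarrow> (int \<Rightarrow> 'f) \<times> (nat \<Rightarrow> 'e)" where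
  "past_map t \<omega> = ((\<lambda>s. snd (\<omega> s)), (\<lambda>j. fst (\<omega> (t - 1 - int j))))"

abbreviation past_space :: "((int \<Rightarrow> 'f::topological_space) \<times> (nat \<Rightarrow> 'e::topological_space)) measure" where
  "past_space \<equiv> path_space borel \<Otimes>\<^sub>M (\<Pi>\<^sub>M j\<in>UNIV. borel)"

lemma past_sigma_eq: "past_sigma t = vimage_algebra UNIV (past_map t) past_space"
  by (simp add: past_sigma_def past_map_def[abs_def])

lemma space_past_space [simp]: "space past_space = UNIV"
  by (simp add: space_pair_measure space_PiM PiE_UNIV_domain)

lemma measurable_past_mapI:
  assumes "\<And>s. (\<lambda>\<omega>. snd (\<omega> s)) \<in> M \<rightarrow>\<^sub>M borel" "\<And>j. (\<lambda>\<omega>. fst (\<omega> (t - 1 - int j))) \<in> M \<rightarrow>\<^sub>M borel"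
  shows "past_map t \<in> M \<rightarrow>\<^sub>M past_space"
  unfolding past_map_def using assms
  by (intro measurable_Pair measurable_path_spaceI measurable_PiM_single') (auto simp: PiE_UNIV_domain)

lemma measurable_past_map [measurable]: "past_map t \<in> PE \<rightarrow>\<^sub>M past_space"
  by (rule measurable_past_mapI) measurable

lemma space_past_sigma [simp]: "space (past_sigma t) = UNIV"
  by (simp add: past_sigma_eq)

lemma sets_past_sigma: "sets (past_sigma t) = {past_map t -` A |A. A \<in> sets past_space}"
  unfolding past_sigma_eq by (subst sets_vimage_algebra2) auto

lemma past_map_measurable_past_sigma: "past_map t \<in> past_sigma t \<rightarrow>\<^sub>M past_space"
  unfolding past_sigma_eq by (rule measurable_vimage_algebra1) simp

lemma subalgebra_past_sigma:
  assumes "sets Q = sets PE"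
  shows "subalgebra Q (past_sigma t)"
proof -
  have "past_map t -` A \<in> sets PE" if "A \<in> sets past_space" for A
    using measurable_sets[OF measurable_past_map that] by simp
  then show ?thesis
    using assms sets_eq_imp_space_eq[OF assms] by (auto simp: subalgebra_def sets_past_sigma)
qed

lemma clampY_vimage_in_past_sigma:
  assumes ab: "a \<le> b" and C: "C \<in> sets PE"
  shows "clampY a b -` C \<in> sets (past_sigma (b + 1) :: (int \<Rightarrow> 'e::topological_space \<times> 'f::topological_space) measure)"
proof -
  \<comment> \<open>\<open>past_map (b + 1)\<close> lists Y backwards from time b, so Y_s is its
    entry \<open>b - s\<close>; clamping s between a and b makes this index a natural
    number.\<close>
  define g :: "(int \<Rightarrow> 'f) \<times> (nat \<Rightarrow> 'e) \<Rightarrow> int \<Rightarrow> 'e \<times> 'f"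
    where "g z = (\<lambda>s. (snd z (nat (b - max a (min s b))), fst z s))" for z
  have g: "g \<in> past_space \<rightarrow>\<^sub>M PE"
    unfolding g_def
  proof (intro measurable_path_spaceI measurable_Pair)
    fix s
    show "(\<lambda>z. snd z (nat (b - max a (min s b)))) \<in> past_space \<rightarrow>\<^sub>M (borel :: 'e measure)"
      by (rule measurable_compose[OF measurable_snd measurable_component_singleton]) simp
    show "(\<lambda>z. fst z s) \<in> past_space \<rightarrow>\<^sub>M (borel :: 'f measure)"
      by (rule measurable_compose[OF measurable_fst measurable_coord])
  qed
  have "clampY a b \<omega> = g (past_map (b + 1) \<omega>)" for \<omega> :: "int \<Rightarrow> 'e \<times> 'f"
    using ab by (auto simp: clampY_def g_def past_map_def fun_eq_iff)
  then have "clampY a b -` C = past_map (b + 1) -` (g -` C)" by auto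
  moreover have "g -` C \<in> sets past_space" using measurable_sets[OF g C] by simp
  ultimately show ?thesis by (auto simp: sets_past_sigma)
qed

text \<open>Only the left end of the window varies. Two members are brought to a common window by
  moving that end further back, hence closure under intersection.\<close>

definition past_cylinders :: "int \<Rightarrow> (int \<Rightarrow> 'e::topological_space \<times> 'f::topological_space) set set" where
  "past_cylinders b = {clampY a b -` C |a C. a \<le> b \<and> C \<in> sets PE}"

lemma past_cylindersE_le:
  assumes "X \<in> past_cylinders b"
  obtains a where "a \<le> b" "\<And>a'. a' \<le> a \<Longrightarrow> \<exists>C\<in>sets PE. X = clampY a' b -` C"
proof -
  obtain a C where X: "X = clampY a b -` C" "a \<le> b" "C \<in> sets PE"
    using assms by (auto simp: past_cylinders_def)
  show thesis
  proof (rule that[OF X(2)])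
    fix a' assume "a' \<le> a"
    then have "X = clampY a' b -` (clampY a b -` C)"
      using X by (auto simp: clampY_clampY)
    moreover have "clampY a b -` C \<in> sets PE"
      using measurable_sets[OF measurable_clampY X(3)] by simp
    ultimately show "\<exists>C\<in>sets PE. X = clampY a' b -` C" by blast
  qed
qed

lemma Int_stable_past_cylinders:
  "Int_stable (past_cylinders b :: (int \<Rightarrow> 'e::topological_space \<times> 'f::topological_space) set set)"
proof (rule Int_stableI)
  fix X Y :: "(int \<Rightarrow> 'e \<times> 'f) set" assume "X \<in> past_cylinders b" "Y \<in> past_cylinders b"
  then obtain a1 a2 where *: "a1 \<le> b" "\<And>a'. a' \<le> a1 \<Longrightarrow> \<exists>C\<in>sets PE. X = clampY a' b -` C"
    "a2 \<le> b" "\<And>a'. a' \<le> a2 \<Longrightarrow> \<exists>C\<in>sets PE. Y = clampY a' b -` C"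
    by (elim past_cylindersE_le) blast
  from *(2)[of "min a1 a2"] *(4)[of "min a1 a2"] obtain C1 C2 where "C1 \<in> sets PE" "C2 \<in> sets PE"
    "X = clampY (min a1 a2) b -` C1" "Y = clampY (min a1 a2) b -` C2" by auto
  then show "X \<inter> Y \<in> past_cylinders b"
    using *(1) by (auto simp: past_cylinders_def intro!: exI[of _ "min a1 a2"] exI[of _ "C1 \<inter> C2"])
qed

text \<open>For the harder inclusion, each coordinate of the past is visible in some window ending
  at b: the environment in the window of the single time b, and Y_(b-j) in the window from
  \<open>b - j\<close> to b.\<close>

lemma sets_past_sigma_eq_sigma:
  "sets (past_sigma (b + 1)) =
    sigma_sets UNIV (past_cylinders b :: (int \<Rightarrow> 'e::topological_space \<times> 'f::topological_space) set set)"
proof (rule antisym)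
  show "sigma_sets UNIV (past_cylinders b :: (int \<Rightarrow> 'e \<times> 'f) set set) \<subseteq> sets (past_sigma (b + 1))"
    using sets.sigma_sets_subset[of "past_cylinders b" "past_sigma (b + 1)"] clampY_vimage_in_past_sigma
    by (auto simp: past_cylinders_def)
next
  let ?G = "sigma UNIV (past_cylinders b :: (int \<Rightarrow> 'e \<times> 'f) set set)"
  have sG: "sets ?G = sigma_sets UNIV (past_cylinders b :: (int \<Rightarrow> 'e \<times> 'f) set set)" by simp
  have spG: "space ?G = UNIV" by simp
  have G: "clampY a b -` C \<in> sets ?G" if "a \<le> b" "C \<in> sets PE" for a C
    using that by (auto simp: past_cylinders_def)
  have pm: "past_map (b + 1) \<in> ?G \<rightarrow>\<^sub>M past_space"
  proof (rule measurable_past_mapI)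
    fix s
    show "(\<lambda>\<omega>. snd (\<omega> s)) \<in> ?G \<rightarrow>\<^sub>M borel"
    proof (rule measurableI)
      fix B :: "'f set" assume [measurable]: "B \<in> sets borel"
      have "{\<omega> \<in> space (PE :: (int \<Rightarrow> 'e \<times> 'f) measure). snd (\<omega> s) \<in> B} \<in> sets PE" by measurable
      then have "{\<omega> :: int \<Rightarrow> 'e \<times> 'f. snd (\<omega> s) \<in> B} \<in> sets PE" by simp
      then have "clampY b b -` {\<omega> :: int \<Rightarrow> 'e \<times> 'f. snd (\<omega> s) \<in> B} \<in> sets ?G" by (intro G order_refl)
      also have "clampY b b -` {\<omega> :: int \<Rightarrow> 'e \<times> 'f. snd (\<omega> s) \<in> B} = (\<lambda>\<omega>. snd (\<omega> s)) -` B"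
        by (auto simp: clampY_def)
      finally show "(\<lambda>\<omega>. snd (\<omega> s)) -` B \<inter> space ?G \<in> sets ?G"
        unfolding spG Int_UNIV_right .
    qed simp
  next
    fix j :: nat
    show "(\<lambda>\<omega>. fst (\<omega> (b + 1 - 1 - int j))) \<in> ?G \<rightarrow>\<^sub>M borel"
    proof (rule measurableI)
      fix B :: "'e set" assume [measurable]: "B \<in> sets borel"
      have "{\<omega> \<in> space (PE :: (int \<Rightarrow> 'e \<times> 'f) measure). fst (\<omega> (b - int j)) \<in> B} \<in> sets PE" by measurable
      then have "{\<omega> :: int \<Rightarrow> 'e \<times> 'f. fst (\<omega> (b - int j)) \<in> B} \<in> sets PE" by simp
      then have "clampY (b - int j) b -` {\<omega> :: int \<Rightarrow> 'e \<times> 'f. fst (\<omega> (b - int j)) \<in> B} \<in> sets ?G" by (intro G) auto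
      also have "clampY (b - int j) b -` {\<omega> :: int \<Rightarrow> 'e \<times> 'f. fst (\<omega> (b - int j)) \<in> B} = (\<lambda>\<omega>. fst (\<omega> (b + 1 - 1 - int j))) -` B"
        by (auto simp: clampY_def)
      finally show "(\<lambda>\<omega>. fst (\<omega> (b + 1 - 1 - int j))) -` B \<inter> space ?G \<in> sets ?G"
        unfolding spG Int_UNIV_right .
    qed simp
  qed
  have "past_map (b + 1) -` A \<in> sets ?G" if "A \<in> sets past_space" for A
    using measurable_sets[OF pm that] unfolding spG Int_UNIV_right .
  then show "sets (past_sigma (b + 1)) \<subseteq> sigma_sets UNIV (past_cylinders b :: (int \<Rightarrow> 'e \<times> 'f) set set)"
    unfolding sets_past_sigma sG by blast
qed

lemma (in prob_space) set_integral_eq_nn_integral: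
  assumes [measurable]: "D \<in> sets M" "f \<in> borel_measurable M" and f: "\<And>x. 0 \<le> f x" "\<And>x. f x \<le> (1::real)"
  shows "ennreal (\<integral>x\<in>D. f x \<partial>M) = (\<integral>\<^sup>+x. indicator D x * ennreal (f x) \<partial>M)"
proof -
  have "integrable M (\<lambda>x. indicator D x *\<^sub>R f x)"
    by (rule integrable_const_bound[where B=1]) (auto simp: indicator_def f)
  then have "ennreal (\<integral>x\<in>D. f x \<partial>M) = (\<integral>\<^sup>+x. ennreal (indicator D x *\<^sub>R f x) \<partial>M)"
    unfolding set_lebesgue_integral_def by (intro nn_integral_eq_integral[symmetric]) (auto simp: f)
  also have "\<dots> = (\<integral>\<^sup>+x. indicator D x * ennreal (f x) \<partial>M)"
    by (intro nn_integral_cong) (auto simp: indicator_def)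
  finally show ?thesis .
qed

context random_kernel
begin

text \<open>Integrating the indicator and its candidate conditional expectation over past events
  gives two finite measures. The Markov identity says that they agree on
  \<open>past_cylinders\<close>, the characterization of conditional expectation that they agree on
  the whole past.\<close>

lemma markov_law_iff_cond_exp:
  fixes Q :: "(int \<Rightarrow> 'e \<times> 'f) measure"
  assumes "prob_space Q" and sQ[measurable_cong]: "sets Q = sets PE"
  shows "markov_law Q \<longleftrightarrow>
    (\<forall>t. \<forall>A\<in>sets borel. AE \<omega> in Q. real_cond_exp Q (past_sigma t) (\<lambda>\<omega>. indicator A (fst (\<omega> t))) \<omega>
      = measure (P (snd (\<omega> (t - 1))) (fst (\<omega> (t - 1)))) A)"
proof -
  interpret prob_space Q by fact
  have spQ: "space Q = UNIV" using sets_eq_imp_space_eq[OF sQ] by simp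
  have sub: "subalgebra Q (past_sigma t)" for t using sQ by (rule subalgebra_past_sigma)
  interpret C: sigma_finite_subalgebra Q "past_sigma t" for t
    using sub by (intro finite_measure_subalgebra_is_sigma_finite finite_measure_subalgebra.intro finite_measure_subalgebra_axioms.intro finite_measure_axioms)
  define f where "f t A \<omega> = (indicator A (fst (\<omega> t)) :: real)" for t A and \<omega> :: "int \<Rightarrow> 'e \<times> 'f"
  define g where "g t A \<omega> = measure (P (snd (\<omega> (t - 1))) (fst (\<omega> (t - 1)))) A" for t A and \<omega> :: "int \<Rightarrow> 'e \<times> 'f"
  have f[measurable]: "f t A \<in> borel_measurable Q" if "A \<in> sets borel" for t A
    using that unfolding f_def by measurable
  have gP: "g t A \<in> borel_measurable (past_sigma t)" if "A \<in> sets borel" for t A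
  proof -
    note pm = past_map_measurable_past_sigma[of t]
    have "(\<lambda>\<omega>. snd (\<omega> (t - 1))) \<in> past_sigma t \<rightarrow>\<^sub>M (borel :: 'f measure)"
      using measurable_compose[OF pm measurable_compose[OF measurable_fst measurable_coord[of "t - 1"]]]
      by (simp add: past_map_def)
    moreover have "(\<lambda>\<omega>. fst (\<omega> (t - 1))) \<in> past_sigma t \<rightarrow>\<^sub>M (borel :: 'e measure)"
      using measurable_compose[OF pm measurable_compose[OF measurable_snd measurable_component_singleton[of 0]]]
      by (simp add: past_map_def)
    ultimately show ?thesis
      unfolding g_def using that by (intro measurable_compose[OF measurable_P measurable_measure_prob_algebra])
  qed
  have g[measurable]: "g t A \<in> borel_measurable Q" if "A \<in> sets borel" for t A
    using measurable_from_subalg[OF sub gP[OF that]] .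
  have f01: "0 \<le> f t A \<omega>" "f t A \<omega> \<le> 1" and g01: "0 \<le> g t A \<omega>" "g t A \<omega> \<le> 1" for t A \<omega>
    using prob_space.prob_le_1[OF P_prob(1)] by (auto simp: f_def g_def indicator_def)
  have int: "integrable Q (f t A)" "integrable Q (g t A)" if [measurable]: "A \<in> sets borel" for t A
    using f01 g01 by (auto intro!: integrable_const_bound[where B=1] AE_I2)
  have eqI: "(\<integral>\<omega>\<in>D. f t A \<omega> \<partial>Q) = (\<integral>\<omega>\<in>D. g t A \<omega> \<partial>Q) \<longleftrightarrow>
      (\<integral>\<^sup>+\<omega>. indicator D \<omega> * ennreal (f t A \<omega>) \<partial>Q) = (\<integral>\<^sup>+\<omega>. indicator D \<omega> * ennreal (g t A \<omega>) \<partial>Q)"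
    if [measurable]: "A \<in> sets borel" "D \<in> sets Q" for D t A
  proof -
    have "0 \<le> (\<integral>\<omega>\<in>D. h \<omega> \<partial>Q)" if "\<And>\<omega>. 0 \<le> h \<omega>" for h :: "(int \<Rightarrow> 'e \<times> 'f) \<Rightarrow> real"
      unfolding set_lebesgue_integral_def using that by (intro integral_nonneg_AE) auto
    then show ?thesis
      by (simp add: f01 g01 flip: set_integral_eq_nn_integral)
  qed
  have markov: "(emeasure Q (clampY a b -` C \<inter> {\<omega>. fst (\<omega> (b + 1)) \<in> A}) =
     (\<integral>\<^sup>+\<omega>. indicator C (clampY a b \<omega>) * emeasure (P (snd (\<omega> b)) (fst (\<omega> b))) A \<partial>Q)) \<longleftrightarrow>
     (\<integral>\<^sup>+\<omega>. indicator (clampY a b -` C) \<omega> * ennreal (f (b + 1) A \<omega>) \<partial>Q) =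
     (\<integral>\<^sup>+\<omega>. indicator (clampY a b -` C) \<omega> * ennreal (g (b + 1) A \<omega>) \<partial>Q)"
    if [measurable]: "C \<in> sets PE" "A \<in> sets borel" for a b C A
  proof -
    have "clampY a b -` C \<in> sets PE" using measurable_sets[OF measurable_clampY that(1)] by simp
    moreover have "{\<omega> \<in> space PE. fst (\<omega> (b + 1)) \<in> A} \<in> sets PE" by measurable
    ultimately have "clampY a b -` C \<inter> {\<omega>. fst (\<omega> (b + 1)) \<in> A} \<in> sets Q" by (simp add: sQ)
    then have "emeasure Q (clampY a b -` C \<inter> {\<omega>. fst (\<omega> (b + 1)) \<in> A}) =
        (\<integral>\<^sup>+\<omega>. indicator (clampY a b -` C \<inter> {\<omega>. fst (\<omega> (b + 1)) \<in> A}) \<omega> \<partial>Q)" by simp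
    also have "\<dots> = (\<integral>\<^sup>+\<omega>. indicator (clampY a b -` C) \<omega> * ennreal (f (b + 1) A \<omega>) \<partial>Q)"
      by (intro nn_integral_cong) (auto simp: indicator_def f_def)
    finally have 1: "emeasure Q (clampY a b -` C \<inter> {\<omega>. fst (\<omega> (b + 1)) \<in> A}) =
        (\<integral>\<^sup>+\<omega>. indicator (clampY a b -` C) \<omega> * ennreal (f (b + 1) A \<omega>) \<partial>Q)" .
    have 2: "(\<integral>\<^sup>+\<omega>. indicator C (clampY a b \<omega>) * emeasure (P (snd (\<omega> b)) (fst (\<omega> b))) A \<partial>Q)
      = (\<integral>\<^sup>+\<omega>. indicator (clampY a b -` C) \<omega> * ennreal (g (b + 1) A \<omega>) \<partial>Q)"
      by (intro nn_integral_cong)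
         (auto simp: indicator_def g_def finite_measure.emeasure_eq_measure[OF prob_space.finite_measure[OF P_prob(1)]])
    show ?thesis unfolding 1 2 ..
  qed
  show ?thesis
  proof
    assume m: "markov_law Q"
    show "\<forall>t. \<forall>A\<in>sets borel. AE \<omega> in Q. real_cond_exp Q (past_sigma t) (\<lambda>\<omega>. indicator A (fst (\<omega> t))) \<omega>
        = measure (P (snd (\<omega> (t - 1))) (fst (\<omega> (t - 1)))) A"
    proof (intro allI ballI)
      fix t :: int and A :: "'e set" assume A[measurable]: "A \<in> sets borel"
      define b where "b = t - 1"
      have t: "t = b + 1" by (simp add: b_def)
      \<comment> \<open>The image under the identity merely restricts the measure with density h to
        the past, so that the uniqueness theorem for measures can be applied on the smaller
        sigma-algebra.\<close>
      let ?N = "\<lambda>h. distr (density Q (\<lambda>\<omega>. ennreal (h \<omega>))) (past_sigma t) (\<lambda>x. x)"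
      have id: "(\<lambda>x. x) \<in> Q \<rightarrow>\<^sub>M past_sigma t"
        using measurable_from_subalg[OF sub measurable_ident] by (simp add: id_def)
      have N: "emeasure (?N h) D = (\<integral>\<^sup>+\<omega>. indicator D \<omega> * ennreal (h \<omega>) \<partial>Q)"
        if "D \<in> sets (past_sigma t)" "h \<in> borel_measurable Q" for h D
      proof -
        have "D \<in> sets Q" using sub that(1) by (auto simp: subalgebra_def)
        then show ?thesis
          using that id by (subst emeasure_distr) (auto simp: emeasure_density spQ mult.commute)
      qed
      have eqN: "?N (f t A) = ?N (g t A)"
      proof (rule measure_eqI_generator_eq[OF Int_stable_past_cylinders[of b]])
        show "past_cylinders b \<subseteq> Pow UNIV" by simp
        show "sets (?N (f t A)) = sigma_sets UNIV (past_cylinders b)" "sets (?N (g t A)) = sigma_sets UNIV (past_cylinders b)"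
          by (simp_all add: t sets_past_sigma_eq_sigma)
        have "UNIV \<in> (past_cylinders b :: (int \<Rightarrow> 'e \<times> 'f) set set)"
          using sets.top[of PE] by (auto simp: past_cylinders_def intro!: exI[of _ b] exI[of _ UNIV])
        then show "range (\<lambda>_::nat. UNIV) \<subseteq> (past_cylinders b :: (int \<Rightarrow> 'e \<times> 'f) set set)" by simp
        show "(\<Union>i::nat. UNIV) = (UNIV :: (int \<Rightarrow> 'e \<times> 'f) set)" by simp
        have "(\<integral>\<^sup>+\<omega>. ennreal (f t A \<omega>) \<partial>Q) \<le> (\<integral>\<^sup>+\<omega>. 1 \<partial>Q)"
          using f01 by (intro nn_integral_mono) (auto simp: ennreal_le_1)
        also have "\<dots> = 1" by (simp add: emeasure_space_1)
        finally show "emeasure (?N (f t A)) UNIV \<noteq> \<infinity>" for i :: nat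
          using N[of UNIV "f t A"] by (auto simp: top_unique sets.top[of "past_sigma t", simplified])
        fix X :: "(int \<Rightarrow> 'e \<times> 'f) set" assume "X \<in> past_cylinders b"
        then obtain a C where X: "a \<le> b" "C \<in> sets PE" "X = clampY a b -` C" by (auto simp: past_cylinders_def)
        then have Xp: "X \<in> sets (past_sigma t)" by (simp add: t clampY_vimage_in_past_sigma)
        show "emeasure (?N (f t A)) X = emeasure (?N (g t A)) X"
          using m X A Xp markov[OF X(2) A, of a b] by (simp add: N) (simp add: t markov_law_def)
      qed
      have eq: "(\<integral>\<^sup>+\<omega>. indicator D \<omega> * ennreal (f t A \<omega>) \<partial>Q) = (\<integral>\<^sup>+\<omega>. indicator D \<omega> * ennreal (g t A \<omega>) \<partial>Q)"
        if "D \<in> sets (past_sigma t)" for D :: "(int \<Rightarrow> 'e \<times> 'f) set"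
        by (simp only: N[OF that f[OF A], symmetric] N[OF that g[OF A], symmetric] eqN)
      have "AE \<omega> in Q. real_cond_exp Q (past_sigma t) (f t A) \<omega> = g t A \<omega>"
      proof (rule C.real_cond_exp_charact[OF _ int[OF A] gP[OF A]])
        fix D :: "(int \<Rightarrow> 'e \<times> 'f) set" assume D: "D \<in> sets (past_sigma t)"
        then have "D \<in> sets Q" using sub by (auto simp: subalgebra_def)
        then show "(\<integral>\<omega>\<in>D. f t A \<omega> \<partial>Q) = (\<integral>\<omega>\<in>D. g t A \<omega> \<partial>Q)"
          using eqI[OF A] eq[OF D] by simp
      qed
      then show "AE \<omega> in Q. real_cond_exp Q (past_sigma t) (\<lambda>\<omega>. indicator A (fst (\<omega> t))) \<omega>
        = measure (P (snd (\<omega> (t - 1))) (fst (\<omega> (t - 1)))) A"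
        by (simp add: f_def[abs_def] g_def)
    qed
  next
    assume *: "\<forall>t. \<forall>A\<in>sets borel. AE \<omega> in Q. real_cond_exp Q (past_sigma t) (\<lambda>\<omega>. indicator A (fst (\<omega> t))) \<omega>
        = measure (P (snd (\<omega> (t - 1))) (fst (\<omega> (t - 1)))) A"
    show "markov_law Q"
      unfolding markov_law_def
    proof (intro allI ballI impI)
      fix a b :: int and C :: "(int \<Rightarrow> 'e \<times> 'f) set" and A :: "'e set"
      assume C: "C \<in> sets PE" and A[measurable]: "A \<in> sets borel" and ab: "a \<le> b"
      have ae: "AE \<omega> in Q. real_cond_exp Q (past_sigma (b + 1)) (f (b + 1) A) \<omega> = g (b + 1) A \<omega>"
        using bspec[OF spec[OF *, of "b + 1"] A] by (simp add: f_def[abs_def] g_def)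
      let ?D = "clampY a b -` C"
      have D: "?D \<in> sets (past_sigma (b + 1))" using clampY_vimage_in_past_sigma[OF ab C] .
      then have DQ[measurable]: "?D \<in> sets Q" using sub by (auto simp: subalgebra_def)
      have "(\<integral>\<omega>\<in>?D. f (b + 1) A \<omega> \<partial>Q) = (\<integral>\<omega>\<in>?D. real_cond_exp Q (past_sigma (b + 1)) (f (b + 1) A) \<omega> \<partial>Q)"
        using int(1)[OF A] D by (rule C.real_cond_exp_intA)
      also have "\<dots> = (\<integral>\<omega>\<in>?D. g (b + 1) A \<omega> \<partial>Q)"
        unfolding set_lebesgue_integral_def using ae by (intro integral_cong_AE) (auto elim: eventually_mono)
      finally show "emeasure Q (clampY a b -` C \<inter> {\<omega>. fst (\<omega> (b + 1)) \<in> A}) =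
         (\<integral>\<^sup>+\<omega>. indicator C (clampY a b \<omega>) * emeasure (P (snd (\<omega> b)) (fst (\<omega> b))) A \<partial>Q)"
        unfolding markov[OF C A] using eqI[OF A DQ] by simp
    qed
  qed
qed

lemma solution_law_iff:
  "solution_law P LX Q \<longleftrightarrow> prob_space Q \<and> sets Q = sets PE \<and> stationary_law (borel \<Otimes>\<^sub>M borel) Q \<and>
     distr Q PF (\<lambda>\<omega> s. snd (\<omega> s)) = LX \<and> markov_law Q"
  using markov_law_iff_cond_exp[of Q] by (auto simp: solution_law_def stationary_law_def)

end

section \<open>Extension of an invariant law to a two-sided process\<close>

instance prod :: (polish_space, polish_space) polish_space ..

lemma distr_bind_kernel:
  assumes J: "J \<in> S \<rightarrow>\<^sub>M prob_algebra K" and M: "sets M = sets S" and ne: "space S \<noteq> {}" and f: "f \<in> K \<rightarrow>\<^sub>M R"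
  shows "distr (M \<bind> J) R f = M \<bind> (\<lambda>x. distr (J x) R f)"
  using ne sets_eq_imp_space_eq[OF M] measurable_prob_algebraD[OF J] f
  by (intro distr_bind[where K=K]) (simp_all add: measurable_cong_sets[OF M refl])

lemma bind_distr_kernel:
  assumes f: "f \<in> S \<rightarrow>\<^sub>M X" and M: "sets M = sets S" and ne: "space S \<noteq> {}" and J: "J \<in> X \<rightarrow>\<^sub>M prob_algebra K"
  shows "distr M X f \<bind> J = M \<bind> (\<lambda>x. J (f x))"
  using ne sets_eq_imp_space_eq[OF M] measurable_prob_algebraD[OF J] f
  by (intro bind_distr[where K=K]) (simp_all add: measurable_cong_sets[OF M refl])

lemma bind_return_distr_kernel:
  assumes f: "f \<in> S \<rightarrow>\<^sub>M X" and M: "sets M = sets S" and ne: "space S \<noteq> {}"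
  shows "M \<bind> (\<lambda>x. return X (f x)) = distr M X f"
  using ne sets_eq_imp_space_eq[OF M] f
  by (intro bind_return_distr') (simp_all add: measurable_cong_sets[OF M refl])

lemma clampY_setY_Suc: "a \<le> b \<Longrightarrow> clampY a (b + 1) (setY (b + 1) \<omega> y) = setY (b + 1) (clampY a b \<omega>) y"
  by (auto simp: clampY_def setY_def fun_eq_iff max_def min_def)

lemma clampY_start: "clampY a b (start c z) = start c z"
  by (simp add: clampY_def start_def)

lemma clampY_self_setY: "clampY a a (setY a (start (a - 1) z) y) = start a (shift (fst z), y)"
  by (auto simp: clampY_def setY_def start_def shift_def fun_eq_iff max_def min_def algebra_simps)

lemma shift_start: "shift (start (a + 1) z) = start a z"
  by (auto simp: start_def shift_def fun_eq_iff)

lemma shift_setY: "shift (setY (t + 1) \<omega> y) = setY t (shift \<omega>) y"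
  by (auto simp: setY_def shift_def fun_eq_iff)

lemma eq_if_finite_marginals_eq:
  assumes Q: "prob_space Q" "sets Q = sets (path_space N)" and Q': "sets Q' = sets (path_space N)"
    and eq: "\<And>J. finite J \<Longrightarrow> distr Q (\<Pi>\<^sub>M i\<in>J. N) (\<lambda>\<omega>. restrict \<omega> J) = distr Q' (\<Pi>\<^sub>M i\<in>J. N) (\<lambda>\<omega>. restrict \<omega> J)"
  shows "Q = Q'"
proof (rule measure_eqI_PiM_infinite)
  interpret prob_space Q by fact
  show "finite_measure Q" by (rule finite_measure_axioms)
  show sets: "sets Q = sets (\<Pi>\<^sub>M s\<in>UNIV. N)" "sets Q' = sets (\<Pi>\<^sub>M s\<in>UNIV. N)"
    using Q Q' by (simp_all add: path_space_def)
  fix A :: "int \<Rightarrow> 'a set" and J :: "int set"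
  assume J: "finite J" "J \<subseteq> UNIV" and A: "\<And>i. i \<in> J \<Longrightarrow> A i \<in> sets N"
  have "emeasure L (prod_emb UNIV (\<lambda>s. N) J (Pi\<^sub>E J A)) = emeasure (distr L (\<Pi>\<^sub>M i\<in>J. N) (\<lambda>\<omega>. restrict \<omega> J)) (Pi\<^sub>E J A)"
    if s: "sets L = sets (\<Pi>\<^sub>M s\<in>UNIV. N)" for L
  proof -
    have m: "(\<lambda>\<omega>. restrict \<omega> J) \<in> L \<rightarrow>\<^sub>M (\<Pi>\<^sub>M i\<in>J. N)"
      unfolding measurable_cong_sets[OF s refl] by (rule measurable_restrict_subset) simp
    show ?thesis
      using J A sets_eq_imp_space_eq[OF s]
      by (subst emeasure_distr[OF m]) (auto simp: prod_emb_def space_PiM intro!: sets_PiM_I_finite)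
  qed
  then show "emeasure Q (prod_emb UNIV (\<lambda>s. N) J (Pi\<^sub>E J A)) = emeasure Q' (prod_emb UNIV (\<lambda>s. N) J (Pi\<^sub>E J A))"
    using eq[OF J(1)] sets by simp
qed

context random_kernel
begin

lemma distr_resamp:
  assumes f[measurable]: "f \<in> PE \<rightarrow>\<^sub>M R"
  shows "distr (resamp t \<omega>) R f = distr (P (snd (\<omega> (t - 1))) (fst (\<omega> (t - 1)))) R (\<lambda>y. f (setY t \<omega> y))"
  unfolding resamp_def by (subst distr_distr) (auto simp: o_def measurable_cong_sets[OF P_prob(2) refl])

lemma distr_resamp_clampY_Suc:
  assumes "a \<le> b"
  shows "distr (resamp (b + 1) \<omega>) PE (clampY a (b + 1)) = resamp (b + 1) (clampY a b \<omega>)"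
  using assms by (subst distr_resamp) (auto simp: clampY_setY_Suc resamp_def clampY_at[of a b b])

lemma distr_resamp_clampY:
  assumes "a \<le> b"
  shows "distr (resamp (b + 1) \<omega>) PE (clampY a b) = return PE (clampY a b \<omega>)"
proof -
  interpret prob_space "P (snd (\<omega> b)) (fst (\<omega> b))" by (rule P_prob)
  show ?thesis using assms by (subst distr_resamp) (auto simp: clampY_setY)
qed

lemma distr_resamp_shift: "distr (resamp (t + 1) \<omega>) PE shift = resamp t (shift \<omega>)"
proof -
  have "shift \<omega> (t - 1) = \<omega> t" by (simp add: shift_def)
  then show ?thesis by (subst distr_resamp) (simp_all add: shift_setY resamp_def)
qed

context
  fixes \<rho> :: "((int \<Rightarrow> 'f) \<times> 'e) measure"
  assumes \<rho>: "\<rho> \<in> space (prob_algebra (PF \<Otimes>\<^sub>M borel))" and \<rho>_inv: "\<rho> \<bind> kern = \<rho>"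
begin

text \<open>Law of the path with \<rho> at time a and n further draws, frozen before time a and
  after time \<open>a + n\<close>. The whole environment is present from the start, so each step
  only adds a value of Y.\<close>

primrec chain :: "int \<Rightarrow> nat \<Rightarrow> (int \<Rightarrow> 'e \<times> 'f) measure" where
  "chain a 0 = distr \<rho> PE (start a)"
| "chain a (Suc n) = chain a n \<bind> resamp (a + int n + 1)"

lemma sets_\<rho> [measurable_cong]: "sets \<rho> = sets (PF \<Otimes>\<^sub>M borel)" and prob_\<rho>: "prob_space \<rho>"
  using \<rho> by (auto simp: space_prob_algebra)

lemma chain_in: "chain a n \<in> space (prob_algebra PE)"
proof (induction n)
  case 0
  have "prob_space (distr \<rho> PE (start a))"
    by (rule prob_space.prob_space_distr[OF prob_\<rho>]) measurable
  then show ?case by (simp add: space_prob_algebra)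
next
  case (Suc n)
  then show ?case
    using prob_space_bind'[OF Suc measurable_resamp] sets_bind'[OF Suc measurable_resamp]
    by (simp add: space_prob_algebra)
qed

lemma sets_chain [measurable_cong]: "sets (chain a n) = sets PE" and prob_chain: "prob_space (chain a n)"
  using chain_in[of a n] by (auto simp: space_prob_algebra)

text \<open>Forgetting the last draws undoes them because every \<open>P\<close> has total mass one:
  clamping before the draw reduces \<open>resamp\<close> to a point mass at the clamped
  path.\<close>

lemma chain_clampY_right: "m \<le> n \<Longrightarrow> distr (chain a n) PE (clampY a (a + int m)) = chain a m"
proof (induction n arbitrary: m)
  case 0
  then show ?case
    by (simp add: distr_distr o_def clampY_start)
next
  case (Suc n)
  show ?case
  proof (cases "m = Suc n")
    case True
    have "distr (chain a (Suc n)) PE (clampY a (a + int n + 1)) =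
        chain a n \<bind> (\<lambda>\<omega>. distr (resamp (a + int n + 1) \<omega>) PE (clampY a (a + int n + 1)))"
      unfolding chain.simps by (rule distr_bind_kernel[OF measurable_resamp sets_chain]) auto
    also have "\<dots> = chain a n \<bind> (\<lambda>\<omega>. resamp (a + int n + 1) (clampY a (a + int n) \<omega>))"
      by (simp add: distr_resamp_clampY_Suc)
    also have "\<dots> = distr (chain a n) PE (clampY a (a + int n)) \<bind> resamp (a + int n + 1)"
      by (rule bind_distr_kernel[symmetric, OF measurable_clampY sets_chain _ measurable_resamp]) auto
    also have "\<dots> = chain a (Suc n)"
      by (simp add: Suc.IH)
    finally show ?thesis by (simp add: True algebra_simps)
  next
    case False
    then have mn: "m \<le> n" using Suc.prems by simp
    have "distr (chain a (Suc n)) PE (clampY a (a + int n)) =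
        chain a n \<bind> (\<lambda>\<omega>. distr (resamp (a + int n + 1) \<omega>) PE (clampY a (a + int n)))"
      unfolding chain.simps by (rule distr_bind_kernel[OF measurable_resamp sets_chain]) auto
    also have "\<dots> = chain a n \<bind> (\<lambda>\<omega>. return PE (clampY a (a + int n) \<omega>))"
      by (simp add: distr_resamp_clampY)
    also have "\<dots> = distr (chain a n) PE (clampY a (a + int n))"
      by (rule bind_return_distr_kernel[OF measurable_clampY sets_chain]) simp
    also have "\<dots> = chain a n" by (simp add: Suc.IH)
    finally have "distr (chain a (Suc n)) PE (clampY a (a + int n)) = chain a n" .
    then have "distr (distr (chain a (Suc n)) PE (clampY a (a + int n))) PE (clampY a (a + int m)) = chain a m"
      using Suc.IH[OF mn] by simp
    moreover have "clampY a (a + int m) (clampY a (a + int n) \<omega>) = clampY a (a + int m) \<omega>" for \<omega> :: "int \<Rightarrow> 'e \<times> 'f"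
      using mn by (intro clampY_clampY) auto
    ultimately show ?thesis
      by (subst (asm) distr_distr) (auto simp: o_def simp del: chain.simps)
  qed
qed

text \<open>Consistency to the left is where invariance of \<rho> is needed: forgetting the value at
  time \<open>a - 1\<close> leaves \<rho> after one step of \<open>kern\<close>, placed at time
  a.\<close>

lemma chain_clampY_left: "distr (chain (a - 1) (Suc n)) PE (clampY a (a + int n)) = chain a n"
proof (induction n)
  case 0
  have "distr (chain (a - 1) (Suc 0)) PE (clampY a a) =
      distr \<rho> PE (start (a - 1)) \<bind> (\<lambda>\<omega>. distr (resamp a \<omega>) PE (clampY a a))"
    using distr_bind_kernel[OF measurable_resamp sets_chain[of "a - 1" 0], of "clampY a a" PE a] by simp
  also have "\<dots> = \<rho> \<bind> (\<lambda>z. distr (resamp a (start (a - 1) z)) PE (clampY a a))"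
    by (rule bind_distr_kernel[OF measurable_start sets_\<rho>, where K=PE])
       (auto simp: space_pair_measure intro: measurable_distr_prob_space2[OF measurable_resamp])
  also have "\<dots> = \<rho> \<bind> (\<lambda>z. distr (kern z) PE (start a))"
  proof (rule bind_cong[OF refl])
    fix z
    show "distr (resamp a (start (a - 1) z)) PE (clampY a a) = distr (kern z) PE (start a)"
      unfolding kern_def
      by (subst distr_distr, simp, simp add: measurable_cong_sets[OF P_prob(2) refl])
         (simp add: distr_resamp clampY_self_setY o_def, simp add: start_def)
  qed
  also have "\<dots> = distr (\<rho> \<bind> kern) PE (start a)"
    by (rule distr_bind_kernel[symmetric, OF measurable_kern sets_\<rho>]) (auto simp: space_pair_measure)
  finally show ?case by (simp add: \<rho>_inv)
next
  case (Suc n)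
  have e: "a - 1 + int (Suc n) + 1 = a + int n + 1" by simp
  have "distr (chain (a - 1) (Suc (Suc n))) PE (clampY a (a + int n + 1)) =
      chain (a - 1) (Suc n) \<bind> (\<lambda>\<omega>. distr (resamp (a + int n + 1) \<omega>) PE (clampY a (a + int n + 1)))"
    unfolding chain.simps(2)[of _ "Suc n"] e by (rule distr_bind_kernel[OF measurable_resamp sets_chain]) auto
  also have "\<dots> = chain (a - 1) (Suc n) \<bind> (\<lambda>\<omega>. resamp (a + int n + 1) (clampY a (a + int n) \<omega>))"
    by (simp add: distr_resamp_clampY_Suc)
  also have "\<dots> = distr (chain (a - 1) (Suc n)) PE (clampY a (a + int n)) \<bind> resamp (a + int n + 1)"
    by (rule bind_distr_kernel[symmetric, OF measurable_clampY sets_chain _ measurable_resamp]) auto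
  also have "\<dots> = chain a (Suc n)"
    unfolding Suc.IH by simp
  finally show ?case by (simp add: algebra_simps)
qed

definition window :: "int \<Rightarrow> int \<Rightarrow> (int \<Rightarrow> 'e \<times> 'f) measure" where
  "window a b = chain a (nat (b - a))"

lemma sets_window [measurable_cong]: "sets (window a b) = sets PE" and prob_window: "prob_space (window a b)"
  by (simp_all add: window_def sets_chain prob_chain)

lemma window_step: "a \<le> b \<Longrightarrow> window a (b + 1) = window a b \<bind> resamp (b + 1)"
proof -
  assume "a \<le> b"
  then have "nat (b + 1 - a) = Suc (nat (b - a))" "a + int (nat (b - a)) = b" by auto
  then show ?thesis by (simp add: window_def)
qed

lemma window_clampY:
  assumes "a' \<le> a" "a \<le> b" "b \<le> b'"
  shows "distr (window a' b') PE (clampY a b) = window a b"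
  using assms(1)
proof (induction a' rule: int_le_induct)
  case base
  show ?case
    using chain_clampY_right[of "nat (b - a)" "nat (b' - a)" a] assms by (simp add: window_def)
next
  case (step i)
  have n: "nat (b' - (i - 1)) = Suc (nat (b' - i))" "i + int (nat (b' - i)) = b'" using step assms by auto
  have cl: "clampY a b (clampY i b' \<omega>) = clampY a b \<omega>" for \<omega> :: "int \<Rightarrow> 'e \<times> 'f"
    using step(1) assms by (intro clampY_clampY) auto
  have l: "distr (window (i - 1) b') PE (clampY i b') = window i b'"
    unfolding window_def n(1) using chain_clampY_left[of i "nat (b' - i)"] unfolding n(2) .
  have "window a b = distr (distr (window (i - 1) b') PE (clampY i b')) PE (clampY a b)"
    using step(2) by (simp only: l)
  also have "\<dots> = distr (window (i - 1) b') PE (clampY a b)"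
    by (subst distr_distr) (auto simp: o_def cl)
  finally show ?case ..
qed

lemma window_shift: "distr (window (a + 1) (b + 1)) PE shift = window a b"
proof -
  have "distr (chain (a + 1) n) PE shift = chain a n" for n
  proof (induction n)
    case 0
    show ?case by (simp add: distr_distr o_def shift_start)
  next
    case (Suc n)
    have "distr (chain (a + 1) (Suc n)) PE shift = chain (a + 1) n \<bind> (\<lambda>\<omega>. distr (resamp (a + 1 + int n + 1) \<omega>) PE shift)"
      unfolding chain.simps by (rule distr_bind_kernel[OF measurable_resamp sets_chain]) auto
    also have "\<dots> = chain (a + 1) n \<bind> (\<lambda>\<omega>. resamp (a + int n + 1) (shift \<omega>))"
      using distr_resamp_shift[of "a + int n + 1"] by (simp add: algebra_simps)
    also have "\<dots> = distr (chain (a + 1) n) PE shift \<bind> resamp (a + int n + 1)"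
      by (rule bind_distr_kernel[symmetric, OF measurable_shift sets_chain _ measurable_resamp]) auto
    finally show ?case by (simp add: Suc)
  qed
  then show ?thesis by (simp add: window_def)
qed

text \<open>An interval enclosing J that grows with J; this monotonicity makes the marginals read
  off from these windows consistent.\<close>

definition lo :: "int set \<Rightarrow> int" where "lo J = - (\<Sum>j\<in>J. \<bar>j\<bar>)"
definition hi :: "int set \<Rightarrow> int" where "hi J = (\<Sum>j\<in>J. \<bar>j\<bar>)"

lemma lo_hi: "lo J \<le> hi J" "finite J \<Longrightarrow> j \<in> J \<Longrightarrow> lo J \<le> j" "finite J \<Longrightarrow> j \<in> J \<Longrightarrow> j \<le> hi J"
proof -
  show "lo J \<le> hi J" using sum_nonneg[of J "\<lambda>j. \<bar>j\<bar>"] by (simp add: lo_def hi_def)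
  assume "finite J" "j \<in> J"
  then have "\<bar>j\<bar> \<le> (\<Sum>j\<in>J. \<bar>j\<bar>)" by (intro member_le_sum) auto
  then show "lo J \<le> j" "j \<le> hi J" by (auto simp: lo_def hi_def)
qed

lemma lo_hi_mono: "finite H \<Longrightarrow> J \<subseteq> H \<Longrightarrow> lo H \<le> lo J \<and> hi J \<le> hi H"
  by (auto simp: lo_def hi_def intro!: sum_mono2)

definition marginal :: "int set \<Rightarrow> (int \<Rightarrow> 'e \<times> 'f) measure" where
  "marginal J = distr (window (lo J) (hi J)) (\<Pi>\<^sub>M i\<in>J. borel \<Otimes>\<^sub>M borel) (\<lambda>\<omega>. restrict \<omega> J)"

lemma measurable_restrict_path [measurable]: "(\<lambda>\<omega>. restrict \<omega> J) \<in> path_space N \<rightarrow>\<^sub>M (\<Pi>\<^sub>M i\<in>J. N)"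
  unfolding path_space_def by (rule measurable_restrict_subset) simp

lemma marginal_eq:
  assumes "finite J" "a \<le> lo J" "hi J \<le> b"
  shows "distr (window a b) (\<Pi>\<^sub>M i\<in>J. borel \<Otimes>\<^sub>M borel) (\<lambda>\<omega>. restrict \<omega> J) = marginal J"
proof -
  have r: "restrict (clampY (lo J) (hi J) \<omega>) J = restrict \<omega> J" for \<omega> :: "int \<Rightarrow> 'e \<times> 'f"
    using assms by (intro restrict_ext) (auto intro!: clampY_at lo_hi)
  have "marginal J = distr (distr (window a b) PE (clampY (lo J) (hi J))) (\<Pi>\<^sub>M i\<in>J. borel \<Otimes>\<^sub>M borel) (\<lambda>\<omega>. restrict \<omega> J)"
    using assms by (simp add: window_clampY lo_hi marginal_def)
  also have "\<dots> = distr (window a b) (\<Pi>\<^sub>M i\<in>J. borel \<Otimes>\<^sub>M borel) (\<lambda>\<omega>. restrict \<omega> J)"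
    by (subst distr_distr) (auto simp: o_def r)
  finally show ?thesis ..
qed

text \<open>Kolmogorov's theorem yields the laws of finitely many coordinates, whereas a window
  carries the environment at all times. The law of a window is therefore compared with its target on
  each finite index set.\<close>

lemma ex_path_law:
  obtains Q where "prob_space Q" "sets Q = sets PE" "\<And>a b. a \<le> b \<Longrightarrow> distr Q PE (clampY a b) = window a b"
proof -
  have proj: "marginal J = distr (marginal H) (PiM J (\<lambda>_. borel)) (\<lambda>f. restrict f J)"
    if JH: "J \<subseteq> H" "finite H" for J H
  proof -
    have fJ: "finite J" using JH finite_subset by auto
    have "distr (marginal H) (\<Pi>\<^sub>M i\<in>J. borel \<Otimes>\<^sub>M borel) (\<lambda>f. restrict f J) =
      distr (window (lo H) (hi H)) (\<Pi>\<^sub>M i\<in>J. borel \<Otimes>\<^sub>M borel) (\<lambda>\<omega>. restrict (restrict \<omega> H) J)"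
      unfolding marginal_def using measurable_restrict_subset[OF JH(1)]
      by (subst distr_distr) (auto simp: o_def)
    also have "(\<lambda>\<omega>. restrict (restrict \<omega> H) J) = (\<lambda>\<omega> :: int \<Rightarrow> 'e \<times> 'f. restrict \<omega> J)"
      using JH by (auto simp: fun_eq_iff restrict_def)
    also have "distr (window (lo H) (hi H)) (\<Pi>\<^sub>M i\<in>J. borel \<Otimes>\<^sub>M borel) (\<lambda>\<omega>. restrict \<omega> J) = marginal J"
      using lo_hi_mono[OF JH(2,1)] fJ by (intro marginal_eq) auto
    finally show ?thesis by (simp only: borel_prod)
  qed
  have prob: "prob_space (marginal J)" for J
    unfolding marginal_def by (rule prob_space.prob_space_distr[OF prob_window]) measurable
  interpret PP: polish_projective UNIV marginal
    by (intro polish_projective.intro projective_family.intro proj prob)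
  define Q where "Q = PP.lim"
  have sQ[measurable_cong]: "sets Q = sets PE" by (simp add: Q_def path_space_def borel_prod)
  have pQ: "prob_space Q" unfolding Q_def by (rule PP.P.prob_space_axioms)
  have spQ: "space Q = UNIV" using sets_eq_imp_space_eq[OF sQ] by simp
  have marg: "distr Q (\<Pi>\<^sub>M i\<in>J. borel \<Otimes>\<^sub>M borel) (\<lambda>\<omega>. restrict \<omega> J) = marginal J" if J: "finite J" for J
  proof (rule measure_eqI)
    show "sets (distr Q (\<Pi>\<^sub>M i\<in>J. borel \<Otimes>\<^sub>M borel) (\<lambda>\<omega>. restrict \<omega> J)) = sets (marginal J)"
      by (simp add: marginal_def)
    fix X assume "X \<in> sets (distr Q (\<Pi>\<^sub>M i\<in>J. borel \<Otimes>\<^sub>M borel) (\<lambda>\<omega>. restrict \<omega> J))"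
    then have X: "X \<in> sets (\<Pi>\<^sub>M i\<in>J. borel \<Otimes>\<^sub>M borel)" by simp
    have "emeasure (distr Q (\<Pi>\<^sub>M i\<in>J. borel \<Otimes>\<^sub>M borel) (\<lambda>\<omega>. restrict \<omega> J)) X = emeasure Q ((\<lambda>\<omega>. restrict \<omega> J) -` X \<inter> space Q)"
      using X by (intro emeasure_distr) auto
    also have "(\<lambda>\<omega>. restrict \<omega> J) -` X \<inter> space Q = prod_emb UNIV (\<lambda>_. borel) J X"
      by (auto simp: prod_emb_def spQ PiE_UNIV_domain)
    also have "emeasure Q \<dots> = emeasure (marginal J) X"
      unfolding Q_def using X J by (intro PP.emeasure_lim_emb) (auto simp: borel_prod)
    finally show "emeasure (distr Q (\<Pi>\<^sub>M i\<in>J. borel \<Otimes>\<^sub>M borel) (\<lambda>\<omega>. restrict \<omega> J)) X = emeasure (marginal J) X" .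
  qed
  show thesis
  proof (rule that[OF pQ sQ])
    fix a b :: int assume ab: "a \<le> b"
    show "distr Q PE (clampY a b) = window a b"
    proof (rule eq_if_finite_marginals_eq)
      show "prob_space (distr Q PE (clampY a b))"
        by (rule prob_space.prob_space_distr[OF pQ]) measurable
      fix J :: "int set" assume J: "finite J"
      \<comment> \<open>At the times in J a clamped path uses the environment at J but Y at the
        clamped times, so the finite marginal on the union \<open>H\<close> decides.\<close>
      define c where "c s = max a (min s b)" for s
      define H where "H = J \<union> c ` J"
      have H: "finite H" using J by (simp add: H_def)
      let ?N = "borel \<Otimes>\<^sub>M borel :: ('e \<times> 'f) measure"
      define h where "h \<omega> = (\<lambda>j\<in>J. (fst (\<omega> (c j)), snd (\<omega> j)))" for \<omega> :: "int \<Rightarrow> 'e \<times> 'f"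
      have h[measurable]: "h \<in> (\<Pi>\<^sub>M i\<in>H. ?N) \<rightarrow>\<^sub>M (\<Pi>\<^sub>M i\<in>J. ?N)"
      proof -
        have [measurable]: "(\<lambda>\<omega>. \<omega> i) \<in> (\<Pi>\<^sub>M i\<in>H. ?N) \<rightarrow>\<^sub>M ?N" if "i \<in> H" for i
          using that by (rule measurable_component_singleton)
        have "c j \<in> H" "j \<in> H" if "j \<in> J" for j using that by (auto simp: H_def)
        then show ?thesis unfolding h_def by (intro measurable_restrict) measurable
      qed
      have hr: "h (restrict \<omega> H) = restrict (clampY a b \<omega>) J" for \<omega> :: "int \<Rightarrow> 'e \<times> 'f"
        by (auto simp: h_def clampY_def c_def H_def restrict_def fun_eq_iff)
      have both: "distr (distr L (\<Pi>\<^sub>M i\<in>H. ?N) (\<lambda>\<omega>. restrict \<omega> H)) (\<Pi>\<^sub>M i\<in>J. ?N) h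
          = distr (distr L PE (clampY a b)) (\<Pi>\<^sub>M i\<in>J. ?N) (\<lambda>\<omega>. restrict \<omega> J)" 
        if [measurable_cong]: "sets L = sets PE" for L
        by (subst (1 2) distr_distr) (auto simp: o_def hr)
      define a' b' where "a' = min a (lo H)" and "b' = max b (hi H)"
      have "distr (distr Q PE (clampY a b)) (\<Pi>\<^sub>M i\<in>J. ?N) (\<lambda>\<omega>. restrict \<omega> J) = distr (marginal H) (\<Pi>\<^sub>M i\<in>J. ?N) h"
        by (simp add: both[symmetric] sQ marg H)
      also have "marginal H = distr (window a' b') (\<Pi>\<^sub>M i\<in>H. ?N) (\<lambda>\<omega>. restrict \<omega> H)"
        using H by (intro marginal_eq[symmetric]) (auto simp: a'_def b'_def)
      also have "distr \<dots> (\<Pi>\<^sub>M i\<in>J. ?N) h = distr (distr (window a' b') PE (clampY a b)) (\<Pi>\<^sub>M i\<in>J. ?N) (\<lambda>\<omega>. restrict \<omega> J)"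
        by (rule both) (rule sets_window)
      also have "distr (window a' b') PE (clampY a b) = window a b"
        using ab by (intro window_clampY) (auto simp: a'_def b'_def)
      finally show "distr (distr Q PE (clampY a b)) (\<Pi>\<^sub>M i\<in>J. ?N) (\<lambda>\<omega>. restrict \<omega> J) = distr (window a b) (\<Pi>\<^sub>M i\<in>J. ?N) (\<lambda>\<omega>. restrict \<omega> J)" .
    qed (simp_all add: sets_window)
  qed
qed

end

lemma ex_stationary_markov_law:
  assumes \<rho>: "\<rho> \<in> space (prob_algebra (PF \<Otimes>\<^sub>M borel))" and inv: "\<rho> \<bind> kern = \<rho>"
  obtains Q where "prob_space Q" "sets Q = sets PE" "stationary_law (borel \<Otimes>\<^sub>M borel) Q" "markov_law Q"
    "distr Q (PF \<Otimes>\<^sub>M borel) obs = \<rho>"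
proof -
  have s\<rho>[measurable_cong]: "sets \<rho> = sets (PF \<Otimes>\<^sub>M borel)" using \<rho> by (simp add: space_prob_algebra)
  obtain Q where Q: "prob_space Q" "sets Q = sets PE"
    and cl: "\<And>a b. a \<le> b \<Longrightarrow> distr Q PE (clampY a b) = window \<rho> a b"
    using ex_path_law[OF assms] by metis
  note [measurable_cong] = Q(2)
  have "distr Q PE shift = Q"
  proof (rule eq_if_clampY_eq)
    show "prob_space (distr Q PE shift)" by (rule prob_space.prob_space_distr[OF Q(1)]) measurable
    show "sets (distr Q PE shift) = sets PE" by simp
    fix a b :: int assume ab: "a \<le> b"
    have "distr (distr Q PE shift) PE (clampY a b) = distr (distr Q PE (clampY (a + 1) (b + 1))) PE shift"
      by (subst (1 2) distr_distr) (auto simp: o_def shift_eq_shiftk clampY_shiftk)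
    also have "\<dots> = window \<rho> a b"
      using ab by (simp add: cl window_shift[OF assms])
    finally show "distr (distr Q PE shift) PE (clampY a b) = distr Q PE (clampY a b)"
      by (simp add: cl[OF ab])
  qed (rule Q)
  then have stat: "stationary_law (borel \<Otimes>\<^sub>M borel) Q" using Q by (simp add: stationary_law_def)
  have m: "markov_law Q"
    using Q by (rule markov_lawI) (simp add: cl window_step[OF assms])
  have st: "start 0 \<in> \<rho> \<rightarrow>\<^sub>M PE"
    unfolding measurable_cong_sets[OF s\<rho> refl] by (rule measurable_start)
  have "distr Q (PF \<Otimes>\<^sub>M borel) obs = distr (distr Q PE (clampY 0 0)) (PF \<Otimes>\<^sub>M borel) obs"
    by (subst distr_distr) (auto simp: o_def obs_clampY)
  also have "\<dots> = distr (distr \<rho> PE (start 0)) (PF \<Otimes>\<^sub>M borel) obs"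
    by (simp add: cl window_def[OF assms] chain.simps[OF assms])
  also have "\<dots> = distr \<rho> (PF \<Otimes>\<^sub>M borel) (\<lambda>z. z)"
    using st by (subst distr_distr) (auto simp: o_def obs_def start_def)
  also have "\<dots> = \<rho>" by (rule distr_id2) (simp add: s\<rho>)
  finally show thesis using that Q stat m by blast
qed

end

section \<open>Powers of the skew-product kernel and uniqueness\<close>

lemma measurable_kcomp:
  assumes "\<And>K. K \<in> set Ks \<Longrightarrow> K \<in> N \<rightarrow>\<^sub>M prob_algebra N"
  shows "kcomp N Ks \<in> N \<rightarrow>\<^sub>M prob_algebra N"
  using assms
proof (induction Ks)
  case Nil
  then show ?case by simp
next
  case (Cons K Ks)
  then show ?case by (auto intro!: measurable_bind_prob_space)
qed

lemma map_int_upt_Suc: "map (\<lambda>i. f (int i)) [0..<Suc n] = f 0 # map (\<lambda>i. f (int i + 1)) [0..<n]"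
  by (simp add: map_upt_Suc add.commute del: upt_Suc)

context random_kernel
begin

abbreviation SP :: "((int \<Rightarrow> 'f) \<times> 'e) measure" where
  "SP \<equiv> PF \<Otimes>\<^sub>M borel"

lemma space_SP [simp]: "space SP = UNIV"
  by (simp add: space_pair_measure)

definition block :: "nat \<Rightarrow> (int \<Rightarrow> 'f) \<Rightarrow> 'e \<Rightarrow> 'e measure" where
  "block n x = kcomp borel (map (\<lambda>i. P (x (int i))) [0..<n])"

primrec Kpow :: "nat \<Rightarrow> (int \<Rightarrow> 'f) \<times> 'e \<Rightarrow> ((int \<Rightarrow> 'f) \<times> 'e) measure" where
  "Kpow 0 = return SP"
| "Kpow (Suc n) = (\<lambda>z. kern z \<bind> Kpow n)"

lemma measurable_Kpow [measurable]: "Kpow n \<in> SP \<rightarrow>\<^sub>M prob_algebra SP"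
  by (induction n) (auto intro: measurable_bind_prob_space)

lemma measurable_block [measurable]: "block n x \<in> borel \<rightarrow>\<^sub>M prob_algebra borel"
  unfolding block_def by (intro measurable_kcomp) auto

lemma block_prob: "prob_space (block n x y)" "sets (block n x y) = sets borel" "space (block n x y) = UNIV"
  using measurable_space[OF measurable_block[of n x], of y]
  by (auto simp: space_prob_algebra dest: sets_eq_imp_space_eq)

text \<open>The environment moves deterministically, so n steps of the skew product amount to
  composing the fibre kernels and shifting n times. This connects the \<open>kcomp\<close> of the
  hypotheses with powers of \<open>kern\<close>.\<close>

lemma Kpow_eq_block: "Kpow n z = distr (block n (fst z) (snd z)) SP (\<lambda>y. (shiftk (int n) (fst z), y))"
proof (induction n arbitrary: z)
  case 0
  show ?case by (simp add: block_def distr_return shiftk_def)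
next
  case (Suc n)
  obtain x y where z: "z = (x, y)" by (cases z)
  have m: "(\<lambda>y. (shift x, y)) \<in> borel \<rightarrow>\<^sub>M SP" by measurable
  have "Kpow (Suc n) z = P (x 0) y \<bind> (\<lambda>y'. Kpow n (shift x, y'))"
    unfolding Kpow.simps kern_def z fst_conv snd_conv
    by (rule bind_distr_kernel[OF m P_prob(2) _ measurable_Kpow]) simp
  also have "\<dots> = P (x 0) y \<bind> (\<lambda>y'. distr (block n (shift x) y') SP (\<lambda>y. (shiftk (int n) (shift x), y)))"
    by (simp add: Suc.IH)
  also have "\<dots> = distr (P (x 0) y \<bind> block n (shift x)) SP (\<lambda>y. (shiftk (int n) (shift x), y))"
    by (rule distr_bind_kernel[symmetric, OF measurable_block P_prob(2)]) auto
  also have "P (x 0) y \<bind> block n (shift x) = block (Suc n) x y"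
    using map_int_upt_Suc[of "\<lambda>j. P (x j)" n] by (simp add: block_def shift_def del: upt_Suc)
  also have "shiftk (int n) (shift x) = shiftk (int (Suc n)) x"
    by (simp add: shift_eq_shiftk shiftk_shiftk add.commute)
  finally show ?case by (simp add: z)
qed

lemma measurable_Pair_SP: "(\<lambda>y. (x, y)) \<in> block n x' y' \<rightarrow>\<^sub>M SP"
  unfolding measurable_cong_sets[OF block_prob(2) refl] by measurable

lemma nn_integral_Kpow:
  assumes [measurable]: "h \<in> borel_measurable SP"
  shows "(\<integral>\<^sup>+z'. h z' \<partial>Kpow n z) = (\<integral>\<^sup>+y. h (shiftk (int n) (fst z), y) \<partial>block n (fst z) (snd z))"
  unfolding Kpow_eq_block by (rule nn_integral_distr[OF measurable_Pair_SP]) simp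

lemma nn_integral_kern:
  assumes [measurable]: "h \<in> borel_measurable SP"
  shows "(\<integral>\<^sup>+z'. h z' \<partial>kern z) = (\<integral>\<^sup>+y. h (shift (fst z), y) \<partial>P (fst z 0) (snd z))"
  unfolding kern_def
  by (rule nn_integral_distr) (simp_all add: measurable_cong_sets[OF P_prob(2) refl])

text \<open>\<open>Kpow\<close> splits off its first step, to match \<open>kcomp\<close>; invariance
  arguments append a last step.\<close>

lemma Kpow_Suc_right: "Kpow n z \<bind> kern = Kpow (Suc n) z"
proof (induction n arbitrary: z)
  case 0
  have "return SP z \<bind> kern = kern z"
    using measurable_prob_algebraD[OF measurable_kern] by (rule bind_return) simp
  moreover have "kern z \<bind> return SP = kern z"
    using sets_eq_imp_space_eq measurable_space[OF measurable_kern, of z]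
    by (intro bind_return'') (auto simp: space_prob_algebra)
  ultimately show ?case by simp
next
  case (Suc n)
  have s: "sets (kern z) = sets SP" by (simp add: kern_def)
  have "kern z \<bind> Kpow n \<bind> kern = kern z \<bind> (\<lambda>z'. Kpow n z' \<bind> kern)"
    using measurable_prob_algebraD[OF measurable_kern] measurable_prob_algebraD[OF measurable_Kpow]
    by (intro bind_assoc[where N=SP and R=SP]) (simp_all add: measurable_cong_sets[OF s refl])
  then show ?case by (simp add: Suc.IH)
qed

lemma bind_Kpow_kern:
  assumes s: "sets M = sets SP"
  shows "M \<bind> Kpow n \<bind> kern = M \<bind> Kpow (Suc n)"
  unfolding Kpow_Suc_right[symmetric]
  using measurable_prob_algebraD[OF measurable_kern] measurable_prob_algebraD[OF measurable_Kpow]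
  by (intro bind_assoc[where N=SP and R=SP]) (simp_all add: measurable_cong_sets[OF s refl])

lemma bind_Kpow_0: "sets M = sets SP \<Longrightarrow> M \<bind> Kpow 0 = M"
  by (simp add: bind_return'')

lemma bind_Kpow_invariant:
  assumes "sets \<rho> = sets SP" "\<rho> \<bind> kern = \<rho>"
  shows "\<rho> \<bind> Kpow n = \<rho>"
proof (induction n)
  case 0
  then show ?case using assms by (simp add: bind_return'')
next
  case (Suc n)
  then show ?case using assms bind_Kpow_kern[of \<rho> n] by simp
qed

end

section \<open>Uniqueness under minorization\<close>

text \<open>The radii are integers: they still exhaust the state space through
  \<open>V \<le> R\<close>, and exceptional null sets can be united over them. The constant and the
  minorizing measure are functions of the whole environment path, so that fibres are points of the
  environment space.\<close>

locale minorized_chain = random_kernel P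
  for P :: "'f::polish_space \<Rightarrow> 'e::polish_space \<Rightarrow> 'e measure" +
  fixes p :: nat and V :: "'e \<Rightarrow> real" and c :: "nat \<Rightarrow> (int \<Rightarrow> 'f) \<Rightarrow> ennreal"
    and \<nu> :: "nat \<Rightarrow> (int \<Rightarrow> 'f) \<Rightarrow> 'e measure"
  assumes V_meas [measurable]: "V \<in> borel_measurable borel"
    and c_meas: "\<And>R. 0 < R \<Longrightarrow> c R \<in> borel_measurable PF"
    and c_pos: "\<And>R x. 0 < R \<Longrightarrow> 0 < c R x" and c_le_1: "\<And>R x. 0 < R \<Longrightarrow> c R x \<le> 1"
    and \<nu>_meas: "\<And>R. 0 < R \<Longrightarrow> \<nu> R \<in> PF \<rightarrow>\<^sub>M prob_algebra borel"
    and minor: "\<And>R x y A. 0 < R \<Longrightarrow> V y \<le> real R \<Longrightarrow> A \<in> sets borel \<Longrightarrow>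
      c R x * emeasure (\<nu> R x) A \<le> emeasure (block p x y) A"
begin

text \<open>Indexed by the environment before the block, but carried by the fibre over the
  environment after it.\<close>

definition small :: "nat \<Rightarrow> (int \<Rightarrow> 'f) \<Rightarrow> ((int \<Rightarrow> 'f) \<times> 'e) measure" where
  "small R x = distr (\<nu> R x) SP (\<lambda>y. (shiftk (int p) x, y))"

lemma measurable_small: "0 < R \<Longrightarrow> small R \<in> PF \<rightarrow>\<^sub>M prob_algebra SP"
  unfolding small_def using \<nu>_meas by (rule measurable_distr_prob_space2) measurable

lemma \<nu>_prob: "0 < R \<Longrightarrow> prob_space (\<nu> R x)" "0 < R \<Longrightarrow> sets (\<nu> R x) = sets borel" "0 < R \<Longrightarrow> space (\<nu> R x) = UNIV"
  using measurable_space[OF \<nu>_meas[of R], of x]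
  by (auto simp: space_prob_algebra dest: sets_eq_imp_space_eq)

lemma emeasure_small:
  assumes R: "0 < R" and A: "A \<in> sets SP"
  shows "emeasure (small R x) A = emeasure (\<nu> R x) ((\<lambda>y. (shiftk (int p) x, y)) -` A)"
  unfolding small_def using A R
  by (subst emeasure_distr) (simp_all add: measurable_cong_sets[OF \<nu>_prob(2)[OF R] refl] \<nu>_prob)

lemma Kpow_minor:
  assumes R: "0 < R" and z: "V (snd z) \<le> real R" and A: "A \<in> sets SP"
  shows "c R (fst z) * emeasure (small R (fst z)) A \<le> emeasure (Kpow p z) A"
proof -
  have "(\<lambda>y. (shiftk (int p) (fst z), y)) -` A \<inter> space borel \<in> sets borel"
    by (rule measurable_sets[OF _ A]) measurable
  then have "(\<lambda>y. (shiftk (int p) (fst z), y)) -` A \<in> sets borel" by simp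
  then show ?thesis
    unfolding emeasure_small[OF R A] Kpow_eq_block emeasure_distr[OF measurable_Pair_SP A]
    using minor[OF R z] by (simp add: block_prob)
qed

text \<open>Invariance under one step implies invariance under p steps, and the p-step kernel is the
  one that is minorized on the fibres of \<open>fst\<close>.\<close>

lemma kern_invariant_unique:
  assumes \<rho>: "\<rho> \<in> space (prob_algebra SP)" "\<rho> \<bind> kern = \<rho>"
    and \<rho>': "\<rho>' \<in> space (prob_algebra SP)" "\<rho>' \<bind> kern = \<rho>'"
    and marg: "distr \<rho> PF fst = distr \<rho>' PF fst"
  shows "\<rho> = \<rho>'"
proof (rule fibred_minorization_unique[OF \<rho>(1) \<rho>'(1) measurable_Kpow _ _ measurable_fst _ marg])
  show "\<rho> \<bind> Kpow p = \<rho>" "\<rho>' \<bind> Kpow p = \<rho>'"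
    using \<rho> \<rho>' by (auto intro!: bind_Kpow_invariant simp: space_prob_algebra)
  show "(\<lambda>z. V (snd z)) \<in> borel_measurable SP" by measurable
  show "0 < R \<Longrightarrow> small R \<in> PF \<rightarrow>\<^sub>M prob_algebra SP" for R by (rule measurable_small)
  show "0 < R \<Longrightarrow> 0 < c R x" for R x by (rule c_pos)
  show "c R (fst z) * emeasure (small R (fst z)) A \<le> emeasure (Kpow p z) A"
    if "0 < R" "V (snd z) \<le> real R" "A \<in> sets SP" for R z A
    using that by (rule Kpow_minor)
qed

lemma solution_law_unique:
  assumes "solution_law P LX Q" "solution_law P LX Q'"
  shows "Q = Q'"
proof -
  have obs: "distr L SP obs \<in> space (prob_algebra SP)" "distr L SP obs \<bind> kern = distr L SP obs"
    "distr (distr L SP obs) PF fst = LX" if "solution_law P LX L" for L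
  proof -
    have L: "prob_space L" "sets L = sets PE" "stationary_law (borel \<Otimes>\<^sub>M borel) L"
      "distr L PF (\<lambda>\<omega> s. snd (\<omega> s)) = LX" "markov_law L"
      using that by (auto simp: solution_law_iff)
    note [measurable_cong] = L(2)
    have "prob_space (distr L SP obs)" by (rule prob_space.prob_space_distr[OF L(1)]) measurable
    then show "distr L SP obs \<in> space (prob_algebra SP)" by (simp add: space_prob_algebra)
    show "distr L SP obs \<bind> kern = distr L SP obs"
      using L by (intro markov_law_kern_invariant)
    show "distr (distr L SP obs) PF fst = LX"
      using L(4) by (subst distr_distr) (auto simp: o_def obs_def)
  qed
  have "distr Q SP obs = distr Q' SP obs"
    by (rule kern_invariant_unique) (simp_all add: obs[OF assms(1)] obs[OF assms(2)])
  then show ?thesis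
    using assms by (intro markov_law_unique) (auto simp: solution_law_iff)
qed

end

section \<open>Existence\<close>

locale drift_chain = minorized_chain P p V c \<nu>
  for P :: "'f::polish_space \<Rightarrow> 'e::polish_space \<Rightarrow> 'e measure" and p V c \<nu> +
  fixes LX :: "(int \<Rightarrow> 'f) measure" and L B :: "(int \<Rightarrow> 'f) \<Rightarrow> ennreal" and y0 :: 'e
  assumes LX_prob: "prob_space LX" and LX_stat: "stationary_law borel LX"
    and p_pos: "0 < p"
    and L_meas [measurable]: "L \<in> borel_measurable PF" and B_meas [measurable]: "B \<in> borel_measurable PF"
    and drift: "\<And>x y. (\<integral>\<^sup>+y'. ennreal (V y') \<partial>block p x y) \<le> L x * ennreal (V y) + B x"
begin

text \<open>Bound for the conditional mean of \<open>V\<close> after n blocks, given the environment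
  seen from the final time. The last block used the environment p steps earlier, hence
  \<open>shiftk (- int p)\<close>: the recursion looks backwards from a fixed present, which makes a
  supremum over n meaningful.\<close>

primrec w :: "nat \<Rightarrow> (int \<Rightarrow> 'f) \<Rightarrow> ennreal" where
  "w 0 x = ennreal (V y0)"
| "w (Suc n) x = L (shiftk (- int p) x) * w n (shiftk (- int p) x) + B (shiftk (- int p) x)"

lemma measurable_w [measurable]: "w n \<in> borel_measurable PF"
  by (induction n) simp_all

definition W :: "(int \<Rightarrow> 'f) \<Rightarrow> ennreal" where
  "W x = (SUP n. w n x)"

lemma measurable_W [measurable]: "W \<in> borel_measurable PF"
  unfolding W_def by measurable

lemma sets_W_le [measurable]: "{x. W x \<le> r} \<in> sets PF"
proof -
  have "{x\<in>space PF. W x \<le> r} \<in> sets PF" by measurable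
  then show ?thesis by simp
qed

lemma sets_LX [measurable_cong]: "sets LX = sets PF"
  using LX_stat by (simp add: stationary_law_def)

lemma space_LX [simp]: "space LX = UNIV"
  using sets_eq_imp_space_eq[OF sets_LX] by simp

lemma LX_shiftk: "distr LX PF (shiftk k) = LX"
  using LX_stat by (rule stationary_shiftk)

lemma nn_integral_LX_shiftk:
  assumes [measurable]: "f \<in> borel_measurable PF"
  shows "(\<integral>\<^sup>+x. f (shiftk k x) \<partial>LX) = (\<integral>\<^sup>+x. f x \<partial>LX)"
proof -
  have "(\<integral>\<^sup>+x. f x \<partial>distr LX PF (shiftk k)) = (\<integral>\<^sup>+x. f (shiftk k x) \<partial>LX)"
    by (rule nn_integral_distr) auto
  then show ?thesis by (simp add: LX_shiftk)
qed

text \<open>Seen from the end, this is the chain started in \<open>y0\<close> at time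
  \<open>- n p\<close> and observed at time 0; by stationarity its environment always has law
  \<open>LX\<close>.\<close>

primrec approx :: "nat \<Rightarrow> ((int \<Rightarrow> 'f) \<times> 'e) measure" where
  "approx 0 = distr LX SP (\<lambda>x. (x, y0))"
| "approx (Suc n) = approx n \<bind> Kpow p"

lemma approx_in: "approx n \<in> space (prob_algebra SP)"
proof (induction n)
  case 0
  have "prob_space (approx 0)"
    unfolding approx.simps by (rule prob_space.prob_space_distr[OF LX_prob]) measurable
  then show ?case by (simp add: space_prob_algebra)
next
  case (Suc n)
  then show ?case
    using prob_space_bind'[OF Suc measurable_Kpow] sets_bind'[OF Suc measurable_Kpow]
    by (simp add: space_prob_algebra)
qed

lemma sets_approx [measurable_cong]: "sets (approx n) = sets SP"
  using approx_in by (simp add: space_prob_algebra)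

lemma measurable_approx [simp]: "measurable (approx n) N = measurable SP N"
  by (rule measurable_cong_sets[OF sets_approx refl])

lemma nn_integral_approx_fst:
  assumes [measurable]: "g \<in> borel_measurable PF"
  shows "(\<integral>\<^sup>+z. g (fst z) \<partial>approx n) = (\<integral>\<^sup>+x. g x \<partial>LX)"
  using assms
proof (induction n arbitrary: g)
  case 0
  note [measurable] = 0
  show ?case by (simp add: nn_integral_distr)
next
  case (Suc n)
  note [measurable] = Suc.prems
  have "(\<integral>\<^sup>+z. g (fst z) \<partial>approx (Suc n)) = (\<integral>\<^sup>+z. \<integral>\<^sup>+z'. g (fst z') \<partial>Kpow p z \<partial>approx n)"
    unfolding approx.simps by (rule nn_integral_bind_kernel[OF measurable_Kpow sets_approx]) measurable
  also have "\<dots> = (\<integral>\<^sup>+z. g (shiftk (int p) (fst z)) \<partial>approx n)"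
    by (simp add: nn_integral_Kpow block_prob prob_space.emeasure_space_1[OF block_prob(1), unfolded block_prob(3)])
  also have "\<dots> = (\<integral>\<^sup>+x. g (shiftk (int p) x) \<partial>LX)"
    by (rule Suc.IH) measurable
  also have "\<dots> = (\<integral>\<^sup>+x. g x \<partial>LX)" by (rule nn_integral_LX_shiftk) measurable
  finally show ?case .
qed

text \<open>A bound on a conditional mean, expressed by weights g that depend on the environment
  alone. The induction needs arbitrary g, since the drift turns g into \<open>L\<close> times the
  shifted g.\<close>

lemma nn_integral_approx_V:
  assumes [measurable]: "g \<in> borel_measurable PF"
  shows "(\<integral>\<^sup>+z. ennreal (V (snd z)) * g (fst z) \<partial>approx n) \<le> (\<integral>\<^sup>+x. w n x * g x \<partial>LX)"
  using assms
proof (induction n arbitrary: g)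
  case 0
  note [measurable] = 0
  show ?case by (simp add: nn_integral_distr)
next
  case (Suc n)
  note [measurable] = Suc.prems
  let ?s = "shiftk (int p) :: (int \<Rightarrow> 'f) \<Rightarrow> _"
  have "(\<integral>\<^sup>+z. ennreal (V (snd z)) * g (fst z) \<partial>approx (Suc n))
      = (\<integral>\<^sup>+z. \<integral>\<^sup>+z'. ennreal (V (snd z')) * g (fst z') \<partial>Kpow p z \<partial>approx n)"
    unfolding approx.simps by (rule nn_integral_bind_kernel[OF measurable_Kpow sets_approx]) measurable
  also have "\<dots> = (\<integral>\<^sup>+z. (\<integral>\<^sup>+y. ennreal (V y) \<partial>block p (fst z) (snd z)) * g (?s (fst z)) \<partial>approx n)"
    by (simp add: nn_integral_Kpow nn_integral_multc measurable_cong_sets[OF block_prob(2) refl])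
  also have "\<dots> \<le> (\<integral>\<^sup>+z. (L (fst z) * ennreal (V (snd z)) + B (fst z)) * g (?s (fst z)) \<partial>approx n)"
    by (intro nn_integral_mono mult_right_mono drift) auto
  also have "\<dots> = (\<integral>\<^sup>+z. ennreal (V (snd z)) * (L (fst z) * g (?s (fst z))) + B (fst z) * g (?s (fst z)) \<partial>approx n)"
    by (simp add: algebra_simps)
  also have "\<dots> = (\<integral>\<^sup>+z. ennreal (V (snd z)) * (L (fst z) * g (?s (fst z))) \<partial>approx n) + (\<integral>\<^sup>+z. B (fst z) * g (?s (fst z)) \<partial>approx n)"
    by (intro nn_integral_add) auto
  also have "(\<integral>\<^sup>+z. ennreal (V (snd z)) * (L (fst z) * g (?s (fst z))) \<partial>approx n) \<le> (\<integral>\<^sup>+x. w n x * (L x * g (?s x)) \<partial>LX)"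
    by (rule Suc.IH[of "\<lambda>x. L x * g (?s x)"]) measurable
  also have "(\<integral>\<^sup>+z. B (fst z) * g (?s (fst z)) \<partial>approx n) = (\<integral>\<^sup>+x. B x * g (?s x) \<partial>LX)"
    by (rule nn_integral_approx_fst[of "\<lambda>x. B x * g (?s x)"]) measurable
  also have "(\<integral>\<^sup>+x. w n x * (L x * g (?s x)) \<partial>LX) + (\<integral>\<^sup>+x. B x * g (?s x) \<partial>LX)
      = (\<integral>\<^sup>+x. w n x * (L x * g (?s x)) + B x * g (?s x) \<partial>LX)"
    by (intro nn_integral_add[symmetric]) auto
  also have "\<dots> = (\<integral>\<^sup>+x. w (Suc n) (?s x) * g (?s x) \<partial>LX)"
    by (simp add: shiftk_shiftk algebra_simps)
  also have "\<dots> = (\<integral>\<^sup>+x. w (Suc n) x * g x \<partial>LX)"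
    by (rule nn_integral_LX_shiftk) measurable
  finally show ?case by (simp add: add_right_mono)
qed

text \<open>Markov's inequality, localised to the environments with \<open>W \<le> R / 2\<close>.\<close>
lemma approx_small_V:
  assumes R: "0 < R" and g[measurable]: "g \<in> borel_measurable PF" and g1: "\<And>x. g x \<le> 1"
  shows "(\<integral>\<^sup>+x. g x * indicator {x. W x \<le> ennreal (real R / 2)} x \<partial>LX) / 2
    \<le> (\<integral>\<^sup>+z. g (fst z) * indicator {z. V (snd z) \<le> real R} z \<partial>approx n)"
proof -
  have [measurable]: "{z. V (snd z) \<le> real R} \<in> sets SP" "{z. real R < V (snd z)} \<in> sets SP"
  proof -
    have "{z\<in>space SP. V (snd z) \<le> real R} \<in> sets SP" "{z\<in>space SP. real R < V (snd z)} \<in> sets SP" by measurable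
    then show "{z. V (snd z) \<le> real R} \<in> sets SP" "{z. real R < V (snd z)} \<in> sets SP" by simp_all
  qed
  define G where "G x = g x * indicator {x. W x \<le> ennreal (real R / 2)} x" for x
  have [measurable]: "G \<in> borel_measurable PF" unfolding G_def by measurable
  define I where "I = (\<integral>\<^sup>+x. G x \<partial>LX)"
  \<comment> \<open>Finiteness of \<open>I\<close> is what permits \<open>I / 2\<close> to be
    cancelled in the end.\<close>
  have I1: "I \<le> 1"
  proof -
    have "I \<le> (\<integral>\<^sup>+x. 1 \<partial>LX)"
      unfolding I_def using g1 by (intro nn_integral_mono) (auto simp: G_def indicator_def)
    also have "\<dots> = 1" using prob_space.emeasure_space_1[OF LX_prob] by simp
    finally show ?thesis .
  qed
  have big: "(\<integral>\<^sup>+z. G (fst z) * indicator {z. real R < V (snd z)} z \<partial>approx n) \<le> I / 2"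
  proof -
    have "(\<integral>\<^sup>+z. G (fst z) * indicator {z. real R < V (snd z)} z \<partial>approx n)
        \<le> (\<integral>\<^sup>+z. ennreal (1 / real R) * (ennreal (V (snd z)) * G (fst z)) \<partial>approx n)"
    proof (intro nn_integral_mono)
      fix z :: "(int \<Rightarrow> 'f) \<times> 'e"
      have "1 \<le> ennreal (1 / real R) * ennreal (V (snd z))" if "real R < V (snd z)"
        using that R by (subst ennreal_mult[symmetric]) (auto simp: ennreal_1[symmetric] field_simps simp del: ennreal_1 intro!: ennreal_leI)
      then show "G (fst z) * indicator {z. real R < V (snd z)} z \<le> ennreal (1 / real R) * (ennreal (V (snd z)) * G (fst z))"
        using mult_right_mono[of 1 "ennreal (1 / real R) * ennreal (V (snd z))" "G (fst z)"]
        by (auto simp: indicator_def mult.assoc)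
    qed
    also have "\<dots> = ennreal (1 / real R) * (\<integral>\<^sup>+z. ennreal (V (snd z)) * G (fst z) \<partial>approx n)"
      by (intro nn_integral_cmult) simp
    also have "\<dots> \<le> ennreal (1 / real R) * (\<integral>\<^sup>+x. w n x * G x \<partial>LX)"
      by (intro mult_left_mono nn_integral_approx_V) auto
    also have "\<dots> \<le> ennreal (1 / real R) * (\<integral>\<^sup>+x. ennreal (real R / 2) * G x \<partial>LX)"
    proof (intro mult_left_mono nn_integral_mono)
      fix x
      have "w n x \<le> W x" unfolding W_def by (rule SUP_upper) simp
      then show "w n x * G x \<le> ennreal (real R / 2) * G x"
        by (auto simp: G_def indicator_def intro!: mult_right_mono elim: order_trans)
    qed auto
    also have "\<dots> = ennreal (1 / real R) * (ennreal (real R / 2) * I)"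
      unfolding I_def by (subst nn_integral_cmult) auto
    also have "\<dots> = (ennreal (1 / real R) * ennreal (real R / 2)) * I" by (simp add: mult.assoc)
    also have "ennreal (1 / real R) * ennreal (real R / 2) = ennreal (1 / 2)"
      using R by (subst ennreal_mult[symmetric]) (auto simp: field_simps)
    also have "ennreal (1 / 2) * I = I / 2"
      using divide_ennreal[of 1 2] by (metis ennreal_1 ennreal_numeral ennreal_times_divide mult.commute mult.right_neutral zero_le_one zero_less_numeral zero_le_numeral)
    finally show ?thesis .
  qed
  have "I = (\<integral>\<^sup>+z. G (fst z) \<partial>approx n)"
    unfolding I_def by (rule nn_integral_approx_fst[symmetric]) measurable
  also have "\<dots> = (\<integral>\<^sup>+z. G (fst z) * indicator {z. V (snd z) \<le> real R} z + G (fst z) * indicator {z. real R < V (snd z)} z \<partial>approx n)"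
    by (intro nn_integral_cong) (auto simp: indicator_def)
  also have "\<dots> = (\<integral>\<^sup>+z. G (fst z) * indicator {z. V (snd z) \<le> real R} z \<partial>approx n)
     + (\<integral>\<^sup>+z. G (fst z) * indicator {z. real R < V (snd z)} z \<partial>approx n)"
    by (intro nn_integral_add) auto
  also have "\<dots> \<le> (\<integral>\<^sup>+z. G (fst z) * indicator {z. V (snd z) \<le> real R} z \<partial>approx n) + I / 2"
    by (intro add_left_mono big)
  finally have le: "I \<le> (\<integral>\<^sup>+z. G (fst z) * indicator {z. V (snd z) \<le> real R} z \<partial>approx n) + I / 2" .
  obtain r where r: "I = ennreal r" "0 \<le> r" using I1 by (cases I) (auto simp: top_unique)
  have half: "I / 2 = ennreal (r / 2)" using divide_ennreal[of r 2] r by simp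
  have "ennreal (r / 2) \<le> X" if "ennreal r \<le> X + ennreal (r / 2)" for X
    using that r by (cases X) (simp_all flip: ennreal_plus)
  then have "I / 2 \<le> (\<integral>\<^sup>+z. G (fst z) * indicator {z. V (snd z) \<le> real R} z \<partial>approx n)"
    using le unfolding half unfolding r(1) by blast
  also have "\<dots> \<le> (\<integral>\<^sup>+z. g (fst z) * indicator {z. V (snd z) \<le> real R} z \<partial>approx n)"
    by (intro nn_integral_mono) (auto simp: G_def indicator_def)
  finally show ?thesis unfolding I_def G_def .
qed

section \<open>A common lower bound and the invariant law above it\<close>

text \<open>If \<open>W \<le> R / 2\<close>, at least half of the conditional mass lies in
  \<open>V \<le> R\<close>, for every n; this half is the factor 1/2. On it the next block is
  bounded below by \<open>c R\<close> times \<open>small R\<close>.\<close>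

definition minorant :: "nat \<Rightarrow> ((int \<Rightarrow> 'f) \<times> 'e) measure" where
  "minorant R = density LX (\<lambda>x. c R x * indicator {x. W x \<le> ennreal (real R / 2)} x / 2) \<bind> small R"

lemma emeasure_minorant:
  assumes R: "0 < R" and A: "A \<in> sets SP"
  shows "emeasure (minorant R) A =
    (\<integral>\<^sup>+x. c R x * emeasure (small R x) A * indicator {x. W x \<le> ennreal (real R / 2)} x \<partial>LX) / 2"
proof -
  note [measurable] = c_meas[OF R] measurable_emeasure_prob_kernel[OF measurable_small[OF R] A]
  have "emeasure (minorant R) A = (\<integral>\<^sup>+x. emeasure (small R x) A \<partial>density LX (\<lambda>x. c R x * indicator {x. W x \<le> ennreal (real R / 2)} x / 2))"
    unfolding minorant_def by (rule emeasure_bind_kernel[OF measurable_small[OF R] _ _ A]) (auto simp: sets_LX)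
  also have "\<dots> = (\<integral>\<^sup>+x. (c R x * indicator {x. W x \<le> ennreal (real R / 2)} x / 2) * emeasure (small R x) A \<partial>LX)"
    by (intro nn_integral_density) auto
  also have "\<dots> = (\<integral>\<^sup>+x. c R x * emeasure (small R x) A * indicator {x. W x \<le> ennreal (real R / 2)} x / 2 \<partial>LX)"
    by (intro nn_integral_cong) (auto simp: indicator_def divide_ennreal_def ac_simps)
  also have "\<dots> = (\<integral>\<^sup>+x. c R x * emeasure (small R x) A * indicator {x. W x \<le> ennreal (real R / 2)} x \<partial>LX) / 2"
    by (intro nn_integral_divide) auto
  finally show ?thesis .
qed

lemma sets_minorant: "0 < R \<Longrightarrow> sets (minorant R) = sets SP"
  unfolding minorant_def by (rule sets_bind_kernel[OF measurable_small]) (auto simp: sets_LX)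

text \<open>One block is spent: the mass in \<open>V \<le> R\<close> is estimated at stage n, and
  the minorization of the following p steps takes effect at stage \<open>Suc n\<close>. Hence the
  bound starts at index 1.\<close>

lemma minorant_le_approx:
  assumes R: "0 < R"
  shows "minorant R \<le> approx (Suc n)"
proof (subst le_measure)
  show "sets (minorant R) = sets (approx (Suc n))"
    using sets_minorant[OF R] sets_approx[of "Suc n"] by simp
  have "emeasure (minorant R) A \<le> emeasure (approx (Suc n)) A" if A: "A \<in> sets SP" for A
  proof -
    note [measurable] = c_meas[OF R] measurable_emeasure_prob_kernel[OF measurable_small[OF R] A]
    have p1: "emeasure (small R x) A \<le> 1" for x
      using measurable_space[OF measurable_small[OF R], of x]
      by (auto simp: space_prob_algebra intro: prob_space.emeasure_le_1)
    have "emeasure (minorant R) A \<le> (\<integral>\<^sup>+z. c R (fst z) * emeasure (small R (fst z)) A * indicator {z. V (snd z) \<le> real R} z \<partial>approx n)"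
      unfolding emeasure_minorant[OF R A]
    proof (rule approx_small_V[OF R])
      show "c R x * emeasure (small R x) A \<le> 1" for x
        using mult_mono[OF c_le_1[OF R, of x] p1[of x]] by simp
    qed measurable
    also have "\<dots> \<le> (\<integral>\<^sup>+z. emeasure (Kpow p z) A \<partial>approx n)"
      using Kpow_minor[OF R _ A] by (intro nn_integral_mono) (auto simp: indicator_def)
    also have "\<dots> = emeasure (approx (Suc n)) A"
      unfolding approx.simps by (rule emeasure_bind_kernel[symmetric, OF measurable_Kpow sets_approx _ A]) simp
    finally show ?thesis .
  qed
  then show "\<forall>A\<in>sets (minorant R). emeasure (minorant R) A \<le> emeasure (approx (Suc n)) A"
    using sets_minorant[OF R] by simp
qed

lemma distr_bind_kern_fst:
  assumes s[measurable_cong]: "sets M = sets SP"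
  shows "distr (M \<bind> kern) PF fst = distr (distr M PF fst) PF shift"
proof -
  have "distr (M \<bind> kern) PF fst = M \<bind> (\<lambda>z. distr (kern z) PF fst)"
    by (rule distr_bind_kernel[OF measurable_kern s]) auto
  also have "\<dots> = M \<bind> (\<lambda>z. return PF (shift (fst z)))"
  proof (rule bind_cong[OF refl])
    fix z :: "(int \<Rightarrow> 'f) \<times> 'e"
    interpret prob_space "P (fst z 0) (snd z)" by (rule P_prob)
    show "distr (kern z) PF fst = return PF (shift (fst z))"
      unfolding kern_def by (subst distr_distr) (auto simp: o_def measurable_cong_sets[OF P_prob(2) refl])
  qed
  also have "\<dots> = distr M PF (\<lambda>z. shift (fst z))"
    by (rule bind_return_distr_kernel[OF _ s]) auto
  also have "\<dots> = distr (distr M PF fst) PF shift"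
    by (subst distr_distr) (auto simp: o_def measurable_cong_sets[OF s refl])
  finally show ?thesis .
qed

text \<open>The lattice infimum of the laws started at time \<open>- n * p\<close> is invariant under \<open>p\<close> steps only;
  summing its translates over one period gives invariance under a single step.\<close>
lemma ex_kern_invariant_dominating:
  obtains \<theta> where "sets \<theta> = sets SP" "finite_measure \<theta>" "\<theta> \<bind> kern = \<theta>" "\<And>R. 0 < R \<Longrightarrow> minorant R \<le> \<theta>"
proof -
  obtain \<theta> where s\<theta>[measurable_cong]: "sets \<theta> = sets SP" and sub: "subprob_space \<theta>" and inv: "\<theta> \<bind> Kpow p = \<theta>"
    and dom: "\<And>\<kappa>. sets \<kappa> = sets SP \<Longrightarrow> (\<And>n. 1 \<le> n \<Longrightarrow> \<kappa> \<le> approx n) \<Longrightarrow> \<kappa> \<le> \<theta>"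
    using invariant_below[of "Kpow p" SP approx, OF measurable_Kpow approx_in] approx.simps(2) by metis
  have dom': "minorant R \<le> \<theta>" if "0 < R" for R
  proof (rule dom[OF sets_minorant[OF that]])
    fix n :: nat assume "1 \<le> n"
    then show "minorant R \<le> approx n" using minorant_le_approx[OF that, of "n - 1"] by simp
  qed
  define T where "T r = \<theta> \<bind> Kpow r" for r
  have sT: "sets (T r) = sets SP" for r
    unfolding T_def by (rule sets_bind_kernel[OF measurable_Kpow s\<theta>]) simp
  have T_le: "emeasure (T r) (space SP) \<le> 1" for r
    using bind_kernel_mass[OF measurable_Kpow s\<theta>, of r] subprob_space.subprob_emeasure_le_1[OF sub, of UNIV]
    by (simp add: T_def)
  have T_sub: "T r \<in> space (subprob_algebra SP)" for r
    using T_le[of r] sets_eq_imp_space_eq[OF sT[of r]] sT[of r]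
    by (auto simp: space_subprob_algebra intro!: subprob_spaceI)
  have T0: "T 0 = \<theta>" and Tp: "T p = \<theta>" using inv by (simp_all add: T_def bind_Kpow_0[OF s\<theta>] del: Kpow.simps)
  have Tk: "T r \<bind> kern = T (Suc r)" for r
    unfolding T_def by (rule bind_Kpow_kern[OF s\<theta>])
  have Tm: "T \<in> count_space {..<p} \<rightarrow>\<^sub>M subprob_algebra SP" using T_sub by simp
  \<comment> \<open>Binding the counting measure on a period with \<open>T\<close> realizes the sum
    of the translates \<open>T r\<close> for r < p as a measure.\<close>
  define \<theta>' where "\<theta>' = count_space {..<p} \<bind> T"
  have ne: "{..<p} \<noteq> {}" using p_pos by auto
  have s\<theta>': "sets \<theta>' = sets SP"
    unfolding \<theta>'_def using Tm ne by (intro sets_bind_measurable) auto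
  have int: "(\<integral>\<^sup>+z. h z \<partial>\<theta>') = (\<Sum>r<p. \<integral>\<^sup>+z. h z \<partial>T r)" if "h \<in> borel_measurable SP" for h
    unfolding \<theta>'_def using nn_integral_bind[OF that Tm] by (simp add: nn_integral_count_space_finite)
  have em: "emeasure \<theta>' A = (\<Sum>r<p. emeasure (T r) A)" if "A \<in> sets SP" for A
    using int[of "indicator A"] that by (simp add: sT s\<theta>')
  have "emeasure \<theta>' (space SP) \<le> (\<Sum>r<p. 1)"
    unfolding em[OF sets.top] by (intro sum_mono T_le)
  then have fin: "finite_measure \<theta>'"
    using sets_eq_imp_space_eq[OF s\<theta>'] by (intro finite_measureI) (auto simp: top_unique)
  have "\<theta>' \<bind> kern = \<theta>'"
  proof (rule measure_eqI)
    show "sets (\<theta>' \<bind> kern) = sets \<theta>'"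
      using sets_bind_kernel[OF measurable_kern s\<theta>'] s\<theta>' by simp
    fix A assume "A \<in> sets (\<theta>' \<bind> kern)"
    then have A: "A \<in> sets SP" using sets_bind_kernel[OF measurable_kern s\<theta>'] by simp
    have "emeasure (\<theta>' \<bind> kern) A = (\<integral>\<^sup>+z. emeasure (kern z) A \<partial>\<theta>')"
      by (rule emeasure_bind_kernel[OF measurable_kern s\<theta>' _ A]) simp
    also have "\<dots> = (\<Sum>r<p. \<integral>\<^sup>+z. emeasure (kern z) A \<partial>T r)"
      by (rule int) (rule measurable_emeasure_prob_kernel[OF measurable_kern A])
    also have "\<dots> = (\<Sum>r<p. emeasure (T (Suc r)) A)"
      by (intro sum.cong refl, subst Tk[symmetric], subst emeasure_bind_kernel[OF measurable_kern sT _ A]) simp_all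
    also have "\<dots> = (\<Sum>r<p. emeasure (T r) A)"
    \<comment> \<open>One step permutes the summands cyclically, because
      \<open>T p = T 0\<close>.\<close>
    proof -
      obtain m where m: "p = Suc m" using p_pos by (cases p) auto
      have "(\<Sum>r<p. emeasure (T r) A) = emeasure (T 0) A + (\<Sum>r<m. emeasure (T (Suc r)) A)"
        unfolding m by (rule sum.lessThan_Suc_shift)
      moreover have "(\<Sum>r<p. emeasure (T (Suc r)) A) = (\<Sum>r<m. emeasure (T (Suc r)) A) + emeasure (T p) A"
        unfolding m by simp
      ultimately show ?thesis by (simp add: T0 Tp add.commute)
    qed
    finally show "emeasure (\<theta>' \<bind> kern) A = emeasure \<theta>' A" by (simp add: em[OF A])
  qed
  moreover have "minorant R \<le> \<theta>'" if R: "0 < R" for R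
  proof -
    have "\<theta> \<le> \<theta>'"
    proof (subst le_measure)
      show "sets \<theta> = sets \<theta>'" by (simp add: s\<theta> s\<theta>')
      have "emeasure (T 0) A \<le> (\<Sum>r<p. emeasure (T r) A)" for A
        using p_pos by (intro member_le_sum) auto
      then show "\<forall>A\<in>sets \<theta>. emeasure \<theta> A \<le> emeasure \<theta>' A"
        by (simp add: s\<theta> em T0)
    qed
    with dom'[OF R] show ?thesis by (rule order_trans)
  qed
  ultimately show thesis using that s\<theta>' fin by blast
qed

text \<open>The dominating invariant \<theta> may have the wrong environment marginal \<alpha>. The
  minorants show that \<open>LX\<close> is absolutely continuous with respect to \<alpha>, and both
  are shift-invariant, so weighting \<theta> by the density e of \<open>LX\<close> corrects the
  marginal without destroying invariance.\<close>

lemma ex_kern_invariant: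
  assumes W_fin: "AE x in LX. W x < \<infinity>"
  obtains \<rho> where "\<rho> \<in> space (prob_algebra SP)" "\<rho> \<bind> kern = \<rho>" "distr \<rho> PF fst = LX"
proof -
  obtain \<theta> where s\<theta>[measurable_cong]: "sets \<theta> = sets SP" and fin: "finite_measure \<theta>" and inv: "\<theta> \<bind> kern = \<theta>"
    and dom: "\<And>R. 0 < R \<Longrightarrow> minorant R \<le> \<theta>"
    using ex_kern_invariant_dominating by metis
  interpret \<theta>: finite_measure \<theta> by fact
  have sp\<theta>: "space \<theta> = UNIV" using sets_eq_imp_space_eq[OF s\<theta>] by simp
  define \<alpha> where "\<alpha> = distr \<theta> PF fst"
  interpret \<alpha>: finite_measure \<alpha> unfolding \<alpha>_def
    by (rule \<theta>.finite_measure_distr) (simp add: measurable_cong_sets[OF s\<theta> refl])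
  have s\<alpha>[measurable_cong]: "sets \<alpha> = sets PF" by (simp add: \<alpha>_def)
  have sp\<alpha>: "space \<alpha> = UNIV" by (simp add: \<alpha>_def)
  note [simp] = measurable_cong_sets[OF s\<theta> refl] measurable_cong_sets[OF s\<alpha> refl]
  have \<alpha>_inv: "distr \<alpha> PF shift = \<alpha>"
    using distr_bind_kern_fst[OF s\<theta>] by (simp add: inv \<alpha>_def)
  have ac: "absolutely_continuous \<alpha> LX"
    unfolding absolutely_continuous_def
  proof
    fix X assume "X \<in> null_sets \<alpha>"
    then have X[measurable]: "X \<in> sets PF" and X0: "emeasure \<alpha> X = 0" by (auto simp: s\<alpha>)
    \<comment> \<open>Over an \<alpha>-null event the minorant vanishes, and its density
      \<open>c R\<close> is positive where \<open>W \<le> R / 2\<close>; so almost no such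
      environment reaches the event in p steps. Finiteness of \<open>W\<close> lets integer radii
      cover almost all environments.\<close>
    have cc: "AE x in LX. \<not> (W x \<le> ennreal (real R / 2) \<and> shiftk (int p) x \<in> X)" if R: "0 < R" for R
    proof -
      note [measurable] = c_meas[OF R]
      have XU: "X \<times> UNIV \<in> sets SP" by measurable
      have XU': "X \<times> UNIV = fst -` X" by auto
      have "emeasure (minorant R) (X \<times> UNIV) \<le> emeasure \<theta> (X \<times> UNIV)"
        using dom[OF R] by (rule le_measureD3) (simp add: sets_minorant[OF R] s\<theta>)
      also have "emeasure \<theta> (X \<times> UNIV) = emeasure \<alpha> X"
        unfolding \<alpha>_def XU' by (subst emeasure_distr) (auto simp: sp\<theta>)
      finally have "emeasure (minorant R) (X \<times> UNIV) = 0" by (simp add: X0)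
      moreover have "emeasure (small R x) (X \<times> UNIV) = indicator X (shiftk (int p) x)" for x
        unfolding emeasure_small[OF R XU] using prob_space.emeasure_space_1[OF \<nu>_prob(1)[OF R], of x]
        by (cases "shiftk (int p) x \<in> X") (auto simp: \<nu>_prob(3)[OF R])
      ultimately have "(\<integral>\<^sup>+x. c R x * indicator X (shiftk (int p) x) * indicator {x. W x \<le> ennreal (real R / 2)} x \<partial>LX) = 0"
        unfolding emeasure_minorant[OF R XU] by (simp add: ennreal_divide_eq_0_iff)
      then have "AE x in LX. c R x * indicator X (shiftk (int p) x) * indicator {x. W x \<le> ennreal (real R / 2)} x = 0"
        by (subst (asm) nn_integral_0_iff_AE) auto
      then show ?thesis
        by eventually_elim (use c_pos[OF R] in \<open>auto simp: indicator_def zero_less_iff_neq_zero split: if_splits\<close>)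
    qed
    have "AE x in LX. \<forall>R. \<not> (W x \<le> ennreal (real (Suc R) / 2) \<and> shiftk (int p) x \<in> X)"
      unfolding AE_all_countable by (intro allI cc) simp
    with W_fin have "AE x in LX. shiftk (int p) x \<notin> X"
    proof eventually_elim
      case (elim x)
      obtain r where r: "W x = ennreal r" "0 \<le> r" using elim(1) by (cases "W x") auto
      obtain R where R: "2 * r < real R" using reals_Archimedean2 by blast
      then have "W x \<le> ennreal (real (Suc R) / 2)" unfolding r by (intro ennreal_leI) simp
      with elim(2) show ?case by blast
    qed
    moreover have "{x. x \<notin> X} \<in> sets PF"
      using sets.compl_sets[OF X] by (simp add: Collect_neg_eq Compl_eq_Diff_UNIV)
    ultimately have "AE x in distr LX PF (shiftk (int p)). x \<notin> X"
      by (subst AE_distr_iff) auto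
    then have "AE x in LX. x \<notin> X" unfolding LX_shiftk .
    then show "X \<in> null_sets LX"
      using X by (subst AE_iff_null_sets) (auto simp: sets_LX)
  qed
  obtain e where e[measurable]: "e \<in> borel_measurable PF" and LX_e: "density \<alpha> e = LX"
  proof -
    obtain e where "e \<in> borel_measurable \<alpha>" "density \<alpha> e = LX"
      using \<alpha>.Radon_Nikodym[OF ac] by (auto simp: sets_LX s\<alpha>)
    then show thesis using that by (simp add: measurable_cong_sets[OF s\<alpha> refl])
  qed
  have "AE x in \<alpha>. e (shift x) = e x"
  proof (rule invariant_density[OF \<alpha>.finite_measure_axioms])
    show "shift \<in> \<alpha> \<rightarrow>\<^sub>M \<alpha>" "shiftk (- 1) \<in> \<alpha> \<rightarrow>\<^sub>M \<alpha>" by measurable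
    show "shiftk (- 1) (shift x) = x" for x :: "int \<Rightarrow> 'f" by (simp add: shift_eq_shiftk shiftk_shiftk)
    have "distr \<alpha> \<alpha> shift = distr \<alpha> PF shift" by (rule distr_cong) (auto simp: s\<alpha>)
    then show "distr \<alpha> \<alpha> shift = \<alpha>" by (simp add: \<alpha>_inv)
    have "distr LX \<alpha> shift = distr LX PF shift" by (rule distr_cong) (auto simp: s\<alpha>)
    also have "\<dots> = LX" using LX_shiftk[of 1] by (simp add: shift_eq_shiftk)
    finally show "distr (density \<alpha> e) \<alpha> shift = density \<alpha> e" by (simp add: LX_e)
  qed measurable
  then have "AE z in \<theta>. e (shift (fst z)) = e (fst z)"
  proof -
    have "{x \<in> space PF. e (shift x) = e x} \<in> sets PF" by measurable
    then have "{x. e (shift x) = e x} \<in> sets PF" by simp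
    then show ?thesis using \<open>AE x in \<alpha>. e (shift x) = e x\<close>
      unfolding \<alpha>_def by (subst (asm) AE_distr_iff) auto
  qed
  then have ae: "AE z in \<theta>. e (fst z) = e (shift (fst z))" by eventually_elim simp
  define \<rho> where "\<rho> = density \<theta> (\<lambda>z. e (fst z))"
  have s\<rho>: "sets \<rho> = sets SP" by (simp add: \<rho>_def s\<theta>)
  have marg: "distr \<rho> PF fst = LX"
  proof (rule measure_eqI)
    fix X assume "X \<in> sets (distr \<rho> PF fst)"
    then have X[measurable]: "X \<in> sets PF" by simp
    have "emeasure (distr \<rho> PF fst) X = (\<integral>\<^sup>+z. e (fst z) * indicator (fst -` X \<inter> space \<theta>) z \<partial>\<theta>)"
    proof -
      have "fst \<in> SP \<rightarrow>\<^sub>M PF" by simp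
      from measurable_sets[OF this X] have "fst -` X \<inter> space \<theta> \<in> sets \<theta>"
        by (simp add: sp\<theta> s\<theta>)
      then show ?thesis
        unfolding \<rho>_def by (subst emeasure_distr) (auto simp: emeasure_density)
    qed
    also have "\<dots> = (\<integral>\<^sup>+z. e (fst z) * indicator X (fst z) \<partial>\<theta>)"
      by (intro nn_integral_cong) (auto simp: indicator_def)
    also have "\<dots> = (\<integral>\<^sup>+x. e x * indicator X x \<partial>\<alpha>)"
      unfolding \<alpha>_def by (subst nn_integral_distr) auto
    also have "\<dots> = emeasure (density \<alpha> e) X" by (simp add: emeasure_density)
    finally show "emeasure (distr \<rho> PF fst) X = emeasure LX X" by (simp add: LX_e)
  qed (simp add: sets_LX)
  have "prob_space \<rho>"
  proof
    have "emeasure (distr \<rho> PF fst) UNIV = emeasure \<rho> (space \<rho>)"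
      using sets.top[of PF] by (subst emeasure_distr) (auto simp: measurable_cong_sets[OF s\<rho> refl])
    then show "emeasure \<rho> (space \<rho>) = 1"
      using prob_space.emeasure_space_1[OF LX_prob] by (simp add: marg)
  qed
  then have "\<rho> \<in> space (prob_algebra SP)" by (simp add: space_prob_algebra s\<rho>)
  moreover have "\<rho> \<bind> kern = \<rho>"
  proof (rule measure_eqI)
    show "sets (\<rho> \<bind> kern) = sets \<rho>" using sets_bind_kernel[OF measurable_kern s\<rho>] s\<rho> by simp
    fix A assume "A \<in> sets (\<rho> \<bind> kern)"
    then have A[measurable]: "A \<in> sets SP" using sets_bind_kernel[OF measurable_kern s\<rho>] by simp
    note [measurable] = measurable_emeasure_prob_kernel[OF measurable_kern A]
    have "emeasure (\<rho> \<bind> kern) A = (\<integral>\<^sup>+z. emeasure (kern z) A \<partial>\<rho>)"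
      by (rule emeasure_bind_kernel[OF measurable_kern s\<rho> _ A]) simp
    also have "\<dots> = (\<integral>\<^sup>+z. e (fst z) * emeasure (kern z) A \<partial>\<theta>)"
      unfolding \<rho>_def by (intro nn_integral_density) auto
    \<comment> \<open>After this replacement the weight is evaluated at the environment following
      the step. It is constant under \<open>kern z\<close> and can be moved inside, where invariance
      of \<theta> applies.\<close>
    also have "\<dots> = (\<integral>\<^sup>+z. e (shift (fst z)) * emeasure (kern z) A \<partial>\<theta>)"
      using ae by (intro nn_integral_cong_AE) (auto elim: eventually_mono)
    also have "\<dots> = (\<integral>\<^sup>+z. \<integral>\<^sup>+z'. e (fst z') * indicator A z' \<partial>kern z \<partial>\<theta>)"
    proof (intro nn_integral_cong)
      fix z :: "(int \<Rightarrow> 'f) \<times> 'e"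
      have kA: "(\<lambda>y. indicator A (shift (fst z), y) :: ennreal) \<in> borel_measurable (P (fst z 0) (snd z))"
        unfolding measurable_cong_sets[OF P_prob(2) refl] by measurable
      have "(\<integral>\<^sup>+z'. e (fst z') * indicator A z' \<partial>kern z) = (\<integral>\<^sup>+y. e (shift (fst z)) * indicator A (shift (fst z), y) \<partial>P (fst z 0) (snd z))"
        by (subst nn_integral_kern) auto
      also have "\<dots> = e (shift (fst z)) * (\<integral>\<^sup>+y. indicator A (shift (fst z), y) \<partial>P (fst z 0) (snd z))"
        using kA by (rule nn_integral_cmult)
      also have "(\<integral>\<^sup>+y. indicator A (shift (fst z), y) \<partial>P (fst z 0) (snd z)) = (\<integral>\<^sup>+z'. indicator A z' \<partial>kern z)"
        by (subst nn_integral_kern) auto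
      also have "\<dots> = emeasure (kern z) A" by (rule nn_integral_indicator) (simp add: kern_def)
      finally show "e (shift (fst z)) * emeasure (kern z) A = (\<integral>\<^sup>+z'. e (fst z') * indicator A z' \<partial>kern z)" ..
    qed
    also have "\<dots> = (\<integral>\<^sup>+z. e (fst z) * indicator A z \<partial>(\<theta> \<bind> kern))"
      by (rule nn_integral_bind_kernel[symmetric, OF measurable_kern s\<theta>]) measurable
    also have "\<dots> = emeasure \<rho> A"
      unfolding inv \<rho>_def by (simp add: emeasure_density)
    finally show "emeasure (\<rho> \<bind> kern) A = emeasure \<rho> A" .
  qed
  ultimately show thesis using that marg by blast
qed

lemma ex_solution_law:
  assumes "AE x in LX. W x < \<infinity>"
  shows "\<exists>Q. solution_law P LX Q"
proof -
  obtain \<rho> where \<rho>: "\<rho> \<in> space (prob_algebra SP)" "\<rho> \<bind> kern = \<rho>" "distr \<rho> PF fst = LX"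
    using ex_kern_invariant[OF assms] .
  obtain Q where Q: "prob_space Q" "sets Q = sets PE" "stationary_law (borel \<Otimes>\<^sub>M borel) Q" "markov_law Q"
    and obs: "distr Q SP obs = \<rho>"
    using ex_stationary_markov_law[OF \<rho>(1,2)] .
  note [measurable_cong] = Q(2)
  have "distr (distr Q SP obs) PF fst = distr Q PF (\<lambda>\<omega> s. snd (\<omega> s))"
    by (subst distr_distr) (auto simp: o_def obs_def)
  then show ?thesis using Q \<rho>(3) by (auto simp: solution_law_iff obs)
qed

end

section \<open>Ergodicity\<close>

text \<open>Both measures lie below \<open>Q\<close>, so exchanging B for D changes each by no more
  than the \<open>Q\<close>-measure of the symmetric difference.\<close>

lemma emeasure_eq_by_approximation:
  assumes "finite_measure Q" and sets: "sets N1 = sets Q" "sets N2 = sets Q"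
    and le: "N1 \<le> Q" "N2 \<le> Q" and B: "B \<in> sets Q"
    and approx: "\<And>e. 0 < e \<Longrightarrow> \<exists>D\<in>sets Q. measure Q ((B - D) \<union> (D - B)) < e \<and> emeasure N1 D = emeasure N2 D"
  shows "emeasure N1 B = emeasure N2 B"
proof -
  interpret Q: finite_measure Q by fact
  have sub: "emeasure N1 B \<le> emeasure N2 B + ennreal e"
    if N: "sets N1 = sets Q" "sets N2 = sets Q" "N1 \<le> Q" "N2 \<le> Q" and e: "0 < e"
      and ap: "\<And>e. 0 < e \<Longrightarrow> \<exists>D\<in>sets Q. measure Q ((B - D) \<union> (D - B)) < e \<and> emeasure N1 D = emeasure N2 D"
    for N1 N2 e
  proof -
    obtain D where D: "D \<in> sets Q" "measure Q ((B - D) \<union> (D - B)) < e / 2" "emeasure N1 D = emeasure N2 D"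
      using ap[of "e / 2"] e by auto
    have small: "emeasure L (B - D) \<le> ennreal (e / 2)" "emeasure L (D - B) \<le> ennreal (e / 2)"
      if "sets L = sets Q" "L \<le> Q" for L
    proof -
      have "emeasure L X \<le> ennreal (e / 2)" if X: "X \<subseteq> (B - D) \<union> (D - B)" "X \<in> sets Q" for X
      proof -
        have "emeasure L X \<le> emeasure Q X" using \<open>L \<le> Q\<close> \<open>sets L = sets Q\<close> by (rule le_measureD3)
        also have "\<dots> \<le> emeasure Q ((B - D) \<union> (D - B))" using X B D by (intro emeasure_mono) auto
        also have "\<dots> \<le> ennreal (e / 2)" using D(2) by (simp add: Q.emeasure_eq_measure ennreal_leI)
        finally show ?thesis .
      qed
      then show "emeasure L (B - D) \<le> ennreal (e / 2)" "emeasure L (D - B) \<le> ennreal (e / 2)"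
        using B D by auto
    qed
    have "emeasure N1 B \<le> emeasure N1 (D \<union> (B - D))"
      using B D N by (intro emeasure_mono) auto
    also have "\<dots> \<le> emeasure N1 D + emeasure N1 (B - D)"
      using B D N by (intro emeasure_subadditive) auto
    also have "\<dots> \<le> emeasure N2 D + ennreal (e / 2)"
      unfolding D(3) using small N by (intro add_left_mono) auto
    also have "emeasure N2 D \<le> emeasure N2 (B \<union> (D - B))"
      using B D N by (intro emeasure_mono) auto
    also have "\<dots> \<le> emeasure N2 B + emeasure N2 (D - B)"
      using B D N by (intro emeasure_subadditive) auto
    also have "\<dots> \<le> emeasure N2 B + ennreal (e / 2)"
      using small N by (intro add_left_mono) auto
    also have "emeasure N2 B + ennreal (e / 2) + ennreal (e / 2) = emeasure N2 B + ennreal e"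
    proof -
      have "ennreal (e / 2) + ennreal (e / 2) = ennreal e"
        using ennreal_plus[of "e / 2" "e / 2"] e by simp
      then show ?thesis by (simp only: add.assoc)
    qed
    finally show ?thesis by (simp add: add_right_mono)
  qed
  have "\<exists>D\<in>sets Q. measure Q ((B - D) \<union> (D - B)) < e \<and> emeasure N2 D = emeasure N1 D" if "0 < e" for e
    using approx[OF that] by metis
  then have "emeasure N2 B \<le> emeasure N1 B + ennreal e" if "0 < e" for e
    using that by (intro sub sets le) auto
  moreover have "emeasure N1 B \<le> emeasure N2 B + ennreal e" if "0 < e" for e
    using that approx by (intro sub sets le) auto
  ultimately show ?thesis
    by (auto intro: antisym[OF ennreal_le_epsilon ennreal_le_epsilon])
qed

section \<open>Shift-invariant events and the remote past\<close>

text \<open>In contrast to \<open>past_cylinders\<close>, both ends vary. Any two windows fit into a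
  common one, so these sets are an algebra, and they generate the sigma-algebra of the path
  space.\<close>

definition cylinders :: "(int \<Rightarrow> 'e::topological_space \<times> 'f::topological_space) set set" where
  "cylinders = {clampY a b -` C |a b C. a \<le> b \<and> C \<in> sets PE}"

lemma cylindersI: "a \<le> b \<Longrightarrow> C \<in> sets PE \<Longrightarrow> clampY a b -` C \<in> cylinders"
  by (auto simp: cylinders_def)

lemma clampY_vimage_widen:
  assumes "a' \<le> a" "a \<le> b" "b \<le> b'" "C \<in> sets PE"
  shows "\<exists>C'\<in>sets PE. clampY a b -` C = clampY a' b' -` C'"
proof
  show "clampY a b -` C = clampY a' b' -` (clampY a b -` C)"
    using assms by (auto simp: clampY_clampY)
  show "clampY a b -` C \<in> sets PE"
    using measurable_sets[OF measurable_clampY assms(4)] by simp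
qed

lemma algebra_cylinders:
  "algebra UNIV (cylinders :: (int \<Rightarrow> 'e::topological_space \<times> 'f::topological_space) set set)"
  unfolding algebra_iff_Int
proof (intro conjI ballI)
  have "clampY 0 0 -` {} \<in> (cylinders :: (int \<Rightarrow> 'e \<times> 'f) set set)" by (rule cylindersI) auto
  then show "{} \<in> (cylinders :: (int \<Rightarrow> 'e \<times> 'f) set set)" by simp
  fix X :: "(int \<Rightarrow> 'e \<times> 'f) set" assume "X \<in> cylinders"
  then obtain a b C where X: "a \<le> b" "C \<in> sets PE" "X = clampY a b -` C" by (auto simp: cylinders_def)
  have "- C \<in> sets PE" using sets.compl_sets[OF X(2)] by (simp add: Compl_eq_Diff_UNIV)
  then have "clampY a b -` (- C) \<in> cylinders" using X by (intro cylindersI)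
  then show "UNIV - X \<in> cylinders" by (simp add: X vimage_Compl Compl_eq_Diff_UNIV[symmetric])
  fix Y :: "(int \<Rightarrow> 'e \<times> 'f) set" assume "Y \<in> cylinders"
  then obtain a2 b2 D where Y: "a2 \<le> b2" "D \<in> sets PE" "Y = clampY a2 b2 -` D" by (auto simp: cylinders_def)
  obtain C' where C': "C' \<in> sets PE" "X = clampY (min a a2) (max b b2) -` C'"
    using clampY_vimage_widen[of "min a a2" a b "max b b2" C] X by auto
  obtain D' where D': "D' \<in> sets PE" "Y = clampY (min a a2) (max b b2) -` D'"
    using clampY_vimage_widen[of "min a a2" a2 b2 "max b b2" D] Y by auto
  have "clampY (min a a2) (max b b2) -` (C' \<inter> D') \<in> cylinders"
    using X Y C' D' by (intro cylindersI) auto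
  then show "X \<inter> Y \<in> cylinders" by (simp add: C' D')
qed simp

lemma sets_PE_eq_sigma_cylinders:
  "sets (PE :: (int \<Rightarrow> 'e::topological_space \<times> 'f::topological_space) measure) = sigma_sets UNIV cylinders"
proof (rule antisym)
  have "clampY a b -` C \<in> sets PE" if "C \<in> sets PE" for a b and C :: "(int \<Rightarrow> 'e \<times> 'f) set"
    using measurable_sets[OF measurable_clampY that] by simp
  then show "sigma_sets UNIV cylinders \<subseteq> sets (PE :: (int \<Rightarrow> 'e \<times> 'f) measure)"
    using sets.sigma_sets_subset[of cylinders PE] by (auto simp: cylinders_def)
next
  let ?G = "sigma UNIV (cylinders :: (int \<Rightarrow> 'e \<times> 'f) set set)"
  have sG: "sets ?G = sigma_sets UNIV cylinders" and spG: "space ?G = UNIV" by simp_all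
  have "(\<lambda>\<omega>. \<omega>) \<in> ?G \<rightarrow>\<^sub>M PE"
  proof (intro measurable_path_spaceI measurableI)
    fix s and B :: "('e \<times> 'f) set" assume [measurable]: "B \<in> sets (borel \<Otimes>\<^sub>M borel)"
    have "{\<omega> \<in> space (PE :: (int \<Rightarrow> 'e \<times> 'f) measure). \<omega> s \<in> B} \<in> sets PE" by measurable
    then have "{\<omega> :: int \<Rightarrow> 'e \<times> 'f. \<omega> s \<in> B} \<in> sets PE" by simp
    then have "clampY s s -` {\<omega> :: int \<Rightarrow> 'e \<times> 'f. \<omega> s \<in> B} \<in> cylinders" by (intro cylindersI order_refl)
    also have "clampY s s -` {\<omega> :: int \<Rightarrow> 'e \<times> 'f. \<omega> s \<in> B} = (\<lambda>\<omega>. \<omega> s) -` B" by (auto simp: clampY_def)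
    finally show "(\<lambda>\<omega> :: int \<Rightarrow> 'e \<times> 'f. \<omega> s) -` B \<inter> space ?G \<in> sets ?G"
      unfolding spG sG Int_UNIV_right by (rule sigma_sets.Basic)
  qed (simp add: space_pair_measure)
  then have "X \<in> sets ?G" if "X \<in> sets PE" for X
    using measurable_sets[OF _ that, of "\<lambda>\<omega>. \<omega>" ?G] by (simp only: spG Int_UNIV_right vimage_ident)
  then show "sets (PE :: (int \<Rightarrow> 'e \<times> 'f) measure) \<subseteq> sigma_sets UNIV cylinders"
    unfolding sG by blast
qed

lemma shift_invariant_shiftk:
  assumes B: "shift -` B = B"
  shows "shiftk k -` B = B"
proof -
  have n: "shiftk (int n) \<omega> \<in> B \<longleftrightarrow> \<omega> \<in> B" for n \<omega>
  proof (induction n arbitrary: \<omega>)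
    case (Suc n)
    have "shiftk (int (Suc n)) \<omega> = shift (shiftk (int n) \<omega>)"
      by (simp add: shift_eq_shiftk shiftk_shiftk add.commute)
    then show ?case using Suc B by (metis vimage_eq)
  qed simp
  show ?thesis
  proof (cases "0 \<le> k")
    case True
    then show ?thesis using n[of "nat k"] by auto
  next
    case False
    then have "shiftk (int (nat (- k))) (shiftk k \<omega>) = \<omega>" for \<omega> :: "int \<Rightarrow> 'a"
      by (simp add: shiftk_shiftk)
    then show ?thesis using n[of "nat (- k)"] by (metis (no_types, lifting) set_eqI vimage_eq)
  qed
qed

text \<open>A shift-invariant event is determined by the distant past, up to arbitrarily small errors:
  approximate it by a cylinder and move the cylinder to the left.\<close>
lemma invariant_event_approximation:
  fixes Q :: "(int \<Rightarrow> 'e::topological_space \<times> 'f::topological_space) measure"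
  assumes "prob_space Q" and sQ: "sets Q = sets PE" and stat: "stationary_law (borel \<Otimes>\<^sub>M borel) Q"
    and B: "B \<in> sets Q" "shift -` B = B" and e: "0 < e"
  obtains a' C where "a' \<le> a" "a' \<le> b" "C \<in> sets PE" "measure Q ((B - clampY a' b -` C) \<union> (clampY a' b -` C - B)) < e"
proof -
  interpret prob_space Q by fact
  have "sets Q = sigma_sets UNIV cylinders" using sQ sets_PE_eq_sigma_cylinders by simp
  then obtain D where D: "D \<in> cylinders" "measure Q ((B - D) \<union> (D - B)) < e"
    using algebra_approximation[OF finite_measure_axioms algebra_cylinders _ B(1) e] by auto
  obtain a1 b1 C1 where D1: "a1 \<le> b1" "C1 \<in> sets PE" "D = clampY a1 b1 -` C1"
    using D(1) by (auto simp: cylinders_def)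
  have DQ: "D \<in> sets Q" using measurable_sets[OF measurable_clampY D1(2)] by (simp add: D1 sQ)
  \<comment> \<open>The shift by j carries the right end of the window to b; the left end becomes
    \<open>a1 + j\<close> and is then widened to lie below a as well.\<close>
  define j where "j = b - b1"
  have C2: "shiftk j -` C1 \<in> sets PE" using measurable_sets[OF measurable_shiftk D1(2)] by simp
  have "shiftk j -` D = clampY (a1 + j) b -` (shiftk j -` C1)"
    by (auto simp: D1 clampY_shiftk j_def)
  moreover obtain C where C: "C \<in> sets PE"
    "clampY (a1 + j) b -` (shiftk j -` C1) = clampY (min a (a1 + j)) b -` C"
    using clampY_vimage_widen[OF _ _ order_refl C2, of "min a (a1 + j)" "a1 + j" b] D1(1) by (auto simp: j_def)
  ultimately have eq: "shiftk j -` D = clampY (min a (a1 + j)) b -` C" by simp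
  have m: "shiftk j \<in> Q \<rightarrow>\<^sub>M PE" unfolding measurable_cong_sets[OF sQ refl] by measurable
  have "measure Q ((B - D) \<union> (D - B)) = measure (distr Q PE (shiftk j)) ((B - D) \<union> (D - B))"
    by (simp add: stationary_shiftk[OF stat])
  also have "\<dots> = measure Q (shiftk j -` ((B - D) \<union> (D - B)))"
    using B DQ m sets_eq_imp_space_eq[OF sQ] by (subst measure_distr) (auto simp: sQ)
  also have "shiftk j -` ((B - D) \<union> (D - B)) = (B - shiftk j -` D) \<union> (shiftk j -` D - B)"
    using shift_invariant_shiftk[OF B(2), of j] by auto
  finally have "measure Q ((B - clampY (min a (a1 + j)) b -` C) \<union> (clampY (min a (a1 + j)) b -` C - B)) < e"
    using D(2) by (simp add: eq)
  moreover have "min a (a1 + j) \<le> a" "min a (a1 + j) \<le> b" using D1(1) by (auto simp: j_def)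
  ultimately show thesis using that C(1) by blast
qed

context random_kernel
begin

text \<open>The Markov identity survives intersection with any event of the past of
  \<open>b + 1\<close>. A shift-invariant event is a limit of such events, so it survives
  conditioning on it too.\<close>

lemma markov_law_conditioned:
  assumes m: "markov_law Q" and "prob_space Q" and sQ: "sets Q = sets PE"
    and stat: "stationary_law (borel \<Otimes>\<^sub>M borel) Q"
    and B: "B \<in> sets Q" "shift -` B = B"
  shows "markov_law (uniform_measure Q B)"
  unfolding markov_law_def
proof (intro allI ballI impI)
  interpret prob_space Q by fact
  note [simp] = measurable_cong_sets[OF sQ refl]
  fix a b :: int and C :: "(int \<Rightarrow> 'e \<times> 'f) set" and A :: "'e set"
  assume C[measurable]: "C \<in> sets PE" and A[measurable]: "A \<in> sets borel" and ab: "a \<le> b"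
  define E where "E = clampY a b -` C \<inter> {\<omega>. fst (\<omega> (b + 1)) \<in> A}"
  define h where "h \<omega> = indicator C (clampY a b \<omega>) * emeasure (P (snd (\<omega> b)) (fst (\<omega> b))) A" for \<omega>
  have E[measurable]: "E \<in> sets PE"
  proof -
    have "{\<omega> \<in> space PE. clampY a b \<omega> \<in> C \<and> fst (\<omega> (b + 1)) \<in> A} \<in> sets PE" by measurable
    moreover have "{\<omega> \<in> space PE. clampY a b \<omega> \<in> C \<and> fst (\<omega> (b + 1)) \<in> A} = E" by (auto simp: E_def)
    ultimately show ?thesis by simp
  qed
  have [measurable]: "(\<lambda>\<omega>. emeasure (P (snd (\<omega> b)) (fst (\<omega> b))) A) \<in> borel_measurable PE"
    by (rule measurable_emeasure_P) measurable
  have h[measurable]: "h \<in> borel_measurable PE" unfolding h_def by measurable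
  have h1: "h \<omega> \<le> 1" for \<omega>
    using prob_space.emeasure_le_1[OF P_prob(1)] by (auto simp: h_def indicator_def)
  \<comment> \<open>The two sides of the Markov identity, restricted to a further event and viewed
    as measures in that event. Both lie below \<open>Q\<close>, so it suffices to compare them on
    past cylinders close to \<open>B\<close>.\<close>
  let ?N1 = "density Q (indicator E)" and ?N2 = "density Q h"
  have N: "emeasure ?N1 D = emeasure Q (D \<inter> E)" "emeasure ?N2 D = (\<integral>\<^sup>+\<omega>. h \<omega> * indicator D \<omega> \<partial>Q)"
    if "D \<in> sets Q" for D
    using that E sQ by (auto simp: emeasure_density Int_commute simp flip: indicator_inter_arith)
  have "emeasure ?N1 B = emeasure ?N2 B"
  proof (rule emeasure_eq_by_approximation[OF finite_measure_axioms _ _ _ _ B(1)])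
    show "?N1 \<le> Q"
      using E sQ by (subst le_measure) (auto simp: N intro!: emeasure_mono)
    have "(\<integral>\<^sup>+\<omega>. h \<omega> * indicator D \<omega> \<partial>Q) \<le> emeasure Q D" if D: "D \<in> sets Q" for D
    proof -
      have "(\<integral>\<^sup>+\<omega>. h \<omega> * indicator D \<omega> \<partial>Q) \<le> (\<integral>\<^sup>+\<omega>. indicator D \<omega> \<partial>Q)"
        using h1 by (intro nn_integral_mono) (auto simp: indicator_def)
      then show ?thesis using D by simp
    qed
    then show "?N2 \<le> Q" by (subst le_measure) (auto simp: N)
    fix e :: real assume "0 < e"
    \<comment> \<open>With \<open>a' \<le> a\<close> the window from a' to b contains the one of
      \<open>C\<close>, so both events can be intersected over a window ending at b and the Markov
      identity applied once.\<close>
    then obtain a' D' where D': "a' \<le> a" "a' \<le> b" "D' \<in> sets PE"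
      "measure Q ((B - clampY a' b -` D') \<union> (clampY a' b -` D' - B)) < e"
      using invariant_event_approximation[OF \<open>prob_space Q\<close> sQ stat B] by metis
    let ?D = "clampY a' b -` D'"
    have D: "?D \<in> sets Q" using measurable_sets[OF measurable_clampY D'(3)] sQ by simp
    have C': "clampY a b -` C \<in> sets PE" using measurable_sets[OF measurable_clampY C] by simp
    have DC: "clampY a' b \<omega> \<in> D' \<inter> clampY a b -` C \<longleftrightarrow> clampY a' b \<omega> \<in> D' \<and> clampY a b \<omega> \<in> C" for \<omega>
      using D' ab by (simp add: clampY_clampY)
    have "emeasure ?N1 ?D = emeasure Q (clampY a' b -` (D' \<inter> clampY a b -` C) \<inter> {\<omega>. fst (\<omega> (b + 1)) \<in> A})"
      unfolding N(1)[OF D] using DC by (intro arg_cong[where f="emeasure Q"]) (auto simp: E_def)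
    also have "\<dots> = (\<integral>\<^sup>+\<omega>. indicator (D' \<inter> clampY a b -` C) (clampY a' b \<omega>) * emeasure (P (snd (\<omega> b)) (fst (\<omega> b))) A \<partial>Q)"
      using m[unfolded markov_law_def] D' A C' by blast
    also have "\<dots> = emeasure ?N2 ?D"
      unfolding N(2)[OF D] using DC by (intro nn_integral_cong) (auto simp: h_def indicator_def)
    finally show "\<exists>D\<in>sets Q. measure Q ((B - D) \<union> (D - B)) < e \<and> emeasure ?N1 D = emeasure ?N2 D"
      using D D'(4) by blast
  qed simp_all
  then have eq: "emeasure Q (B \<inter> E) = (\<integral>\<^sup>+\<omega>. h \<omega> * indicator B \<omega> \<partial>Q)" by (simp only: N[OF B(1)])
  have "emeasure (uniform_measure Q B) E = emeasure Q (B \<inter> E) / emeasure Q B"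
    using B(1) E sQ by (intro emeasure_uniform_measure) auto
  also have "\<dots> = (\<integral>\<^sup>+\<omega>. h \<omega> \<partial>uniform_measure Q B)"
    unfolding eq using B(1) by (intro nn_integral_uniform_measure[symmetric]) auto
  finally show "emeasure (uniform_measure Q B) (clampY a b -` C \<inter> {\<omega>. fst (\<omega> (b + 1)) \<in> A}) =
     (\<integral>\<^sup>+\<omega>. indicator C (clampY a b \<omega>) * emeasure (P (snd (\<omega> b)) (fst (\<omega> b))) A \<partial>uniform_measure Q B)"
    by (simp add: E_def h_def)
qed

end

text \<open>Ergodicity of the environment is used to see that conditioning on an invariant event
  does not change the environment law: the conditioned marginal is invariant and absolutely
  continuous with respect to \<open>LX\<close>.\<close>

lemma (in minorized_chain) solution_law_ergodic:
  assumes erg: "ergodic_law LX" and sol: "solution_law P LX Q"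
  shows "ergodic_law Q"
  unfolding ergodic_law_def
proof (intro ballI impI)
  have "prob_space Q" and sQ[measurable_cong]: "sets Q = sets PE" and stat: "stationary_law (borel \<Otimes>\<^sub>M borel) Q"
    and marg: "distr Q PF (\<lambda>\<omega> s. snd (\<omega> s)) = LX" and m: "markov_law Q"
    using sol by (auto simp: solution_law_iff)
  interpret prob_space Q by fact
  have spQ: "space Q = UNIV" using sets_eq_imp_space_eq[OF sQ] by simp
  have sLX: "sets LX = sets PF" using marg by auto
  have spLX: "space LX = UNIV" using sets_eq_imp_space_eq[OF sLX] by simp
  have pLX: "prob_space LX" unfolding marg[symmetric] by (rule prob_space_distr) measurable
  fix B assume B: "B \<in> sets Q" and "shift -` B \<inter> space Q = B"
  then have inv: "shift -` B = B" by (simp add: spQ)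
  show "measure Q B = 0 \<or> measure Q B = 1"
  proof (rule ccontr)
    assume "\<not> ?thesis"
    then have B0: "emeasure Q B \<noteq> 0" and B1: "emeasure Q B \<noteq> 1"
      by (auto simp: emeasure_eq_measure)
    define QB where "QB = uniform_measure Q B"
    interpret QB: prob_space QB
      unfolding QB_def using B0 by (intro prob_space_uniform_measure) auto
    have sQB[measurable_cong]: "sets QB = sets PE" by (simp add: QB_def sQ)
    have spQB: "space QB = UNIV" using sets_eq_imp_space_eq[OF sQB] by simp
    have eQB: "emeasure QB X = emeasure Q (B \<inter> X) / emeasure Q B" if "X \<in> sets PE" for X
      unfolding QB_def using B that by (intro emeasure_uniform_measure) (auto simp: sQ)
    have stQ: "distr Q PE shift = Q" using stat by (simp add: stationary_law_def)
    have "distr QB PE shift = QB"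
    proof (rule measure_eqI)
      fix X assume "X \<in> sets (distr QB PE shift)"
      then have X[measurable]: "X \<in> sets PE" by simp
      have X': "shift -` X \<in> sets PE" using measurable_sets[OF measurable_shift X] by simp
      have "emeasure (distr QB PE shift) X = emeasure QB (shift -` X)"
        using X by (subst emeasure_distr) (auto simp: spQB)
      also have "\<dots> = emeasure Q (shift -` (B \<inter> X)) / emeasure Q B"
        unfolding eQB[OF X'] by (simp add: inv)
      also have "emeasure Q (shift -` (B \<inter> X)) = emeasure (distr Q PE shift) (B \<inter> X)"
        using B X by (subst emeasure_distr) (auto simp: spQ sQ)
      also have "\<dots> = emeasure Q (B \<inter> X)" by (simp only: stQ)
      finally show "emeasure (distr QB PE shift) X = emeasure QB X" by (simp add: eQB[OF X])
    qed (simp add: sQB)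
    then have statB: "stationary_law (borel \<Otimes>\<^sub>M borel) QB" by (simp add: stationary_law_def sQB)
    have "distr QB PF (\<lambda>\<omega> s. snd (\<omega> s)) = LX"
    proof (rule ergodic_absolutely_continuous_unique[OF pLX])
      note [simp] = measurable_cong_sets[OF sLX sLX] measurable_cong_sets[OF refl sLX] measurable_cong_sets[OF sLX refl]
      show "shift \<in> LX \<rightarrow>\<^sub>M LX" "shiftk (- 1) \<in> LX \<rightarrow>\<^sub>M LX" by simp_all
      show "shiftk (- 1) (shift x) = x" for x :: "int \<Rightarrow> 'f" by (simp add: shift_eq_shiftk shiftk_shiftk)
      have env: "(\<lambda>s. snd (shift \<omega> s)) = shift (\<lambda>s. snd (\<omega> s))" for \<omega> :: "int \<Rightarrow> 'e \<times> 'f"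
        by (simp add: shift_def)
      have st: "distr (distr L PF (\<lambda>\<omega> s. snd (\<omega> s))) LX shift = distr L PF (\<lambda>\<omega> s. snd (\<omega> s))"
        if sL[measurable_cong]: "sets L = sets PE" and "distr L PE shift = L" for L :: "(int \<Rightarrow> 'e \<times> 'f) measure"
      proof -
        have "distr (distr L PF (\<lambda>\<omega> s. snd (\<omega> s))) LX shift = distr (distr L PF (\<lambda>\<omega> s. snd (\<omega> s))) PF shift"
          by (rule distr_cong) (auto simp: sLX)
        also have "\<dots> = distr L PF (\<lambda>\<omega> s. snd (shift \<omega> s))"
          by (subst distr_distr) (auto simp: o_def env)
        also have "\<dots> = distr (distr L PE shift) PF (\<lambda>\<omega> s. snd (\<omega> s))"
          by (subst distr_distr) (auto simp: o_def)
        finally show ?thesis by (simp add: that(2))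
      qed
      show "distr LX LX shift = LX"
        using st[OF sQ stQ] by (simp add: marg)
      show "distr (distr QB PF (\<lambda>\<omega> s. snd (\<omega> s))) LX shift = distr QB PF (\<lambda>\<omega> s. snd (\<omega> s))"
        using \<open>distr QB PE shift = QB\<close> by (rule st[OF sQB])
      show "measure LX B = 0 \<or> measure LX B = 1" if "B \<in> sets LX" "shift -` B \<inter> space LX = B" for B
        using erg that by (auto simp: ergodic_law_def)
      show "prob_space (distr QB PF (\<lambda>\<omega> s. snd (\<omega> s)))" by (rule QB.prob_space_distr) measurable
      show "sets (distr QB PF (\<lambda>\<omega> s. snd (\<omega> s))) = sets LX" by (simp add: sLX)
      show "absolutely_continuous LX (distr QB PF (\<lambda>\<omega> s. snd (\<omega> s)))"
        unfolding absolutely_continuous_def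
      proof
        fix X assume "X \<in> null_sets LX"
        then have X: "X \<in> sets PF" and X0: "emeasure LX X = 0" by (auto simp: sLX)
        let ?X = "(\<lambda>\<omega> s. snd (\<omega> s)) -` X :: (int \<Rightarrow> 'e \<times> 'f) set"
        have X': "?X \<in> sets PE" using measurable_sets[OF measurable_envpath X] by simp
        have "emeasure Q ?X = 0"
          using X0 X unfolding marg[symmetric] by (subst (asm) emeasure_distr) (auto simp: spQ)
        then have "emeasure Q (B \<inter> ?X) \<le> 0"
          using X' B sQ by (metis Int_lower2 emeasure_mono)
        then have "emeasure QB ?X = 0" by (simp add: eQB[OF X'])
        then show "X \<in> null_sets (distr QB PF (\<lambda>\<omega> s. snd (\<omega> s)))"
          using X by (auto simp: null_sets_def emeasure_distr spQB)
      qed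
    qed
    moreover have "markov_law QB"
      unfolding QB_def by (rule markov_law_conditioned[OF m \<open>prob_space Q\<close> sQ stat B inv])
    ultimately have "solution_law P LX QB"
      using QB.prob_space_axioms sQB statB by (simp add: solution_law_iff)
    then have "QB = Q" using solution_law_unique sol by blast
    \<comment> \<open>Evaluated at \<open>B\<close> itself, the conditioned law is 1, which
      contradicts a probability strictly below 1.\<close>
    then have "emeasure Q B = emeasure Q (B \<inter> B) / emeasure Q B" using eQB B sQ by metis
    then show False using B0 B1 by (simp add: emeasure_eq_measure ennreal_divide_self)
  qed
qed

section \<open>Finiteness of the drift bound\<close>

text \<open>The left side is the affine recursion unrolled into the past. By the root condition the
  products decay geometrically, and subexponential weights do not destroy summability.\<close>

lemma affine_recursion_bounded:
  fixes l \<beta> :: "nat \<Rightarrow> real"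
  assumes l: "\<And>k. 0 < l k" and \<beta>: "\<And>k. 0 < \<beta> k" and v: "0 \<le> v"
    and contr: "limsup (\<lambda>n. ereal ((\<Prod>k<n. l k) powr (1 / real n))) < 1"
    and growth: "\<And>s. 1 < s \<Longrightarrow> eventually (\<lambda>k. \<beta> k \<le> s ^ k) sequentially"
  shows "\<exists>K. \<forall>n. v * (\<Prod>k<n. l k) + (\<Sum>j<n. \<beta> j * (\<Prod>k<j. l k)) \<le> K"
proof -
  define pr where "pr n = (\<Prod>k<n. l k)" for n
  have pr: "0 < pr n" for n unfolding pr_def using l by (intro prod_pos) auto
  obtain r0 where r0: "limsup (\<lambda>n. ereal (pr n powr (1 / real n))) < ereal r0" "ereal r0 < 1"
    using ereal_dense2[OF contr] unfolding pr_def by auto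
  have ev: "eventually (\<lambda>n. pr n powr (1 / real n) < r0) sequentially"
    using Limsup_lessD[OF r0(1)] by simp
  \<comment> \<open>Positivity of \<open>r0\<close> follows from a single index at which a
    nonnegative root lies below it.\<close>
  then obtain n0 where "pr n0 powr (1 / real n0) < r0" by (auto simp: eventually_sequentially)
  then have r: "0 < r0" "r0 < 1" using r0(2) le_less_trans[OF powr_ge_zero] by auto
  have pr_le: "eventually (\<lambda>n. pr n \<le> r0 ^ n) sequentially"
    using ev eventually_gt_at_top[of 0]
  proof eventually_elim
    case (elim n)
    have "pr n = (pr n powr (1 / real n)) powr real n"
      using elim(2) pr[of n] by (simp add: powr_powr)
    also have "\<dots> \<le> r0 powr real n"
      using elim by (intro powr_mono2) auto
    also have "\<dots> = r0 ^ n" using r by (simp add: powr_realpow)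
    finally show ?case .
  qed
  \<comment> \<open>The square root divides the decay: \<beta> may grow like
    \<open>(1 / q) ^ n\<close> against products below \<open>q ^ (2 * n)\<close>, and a geometric
    bound \<open>q ^ n\<close> is left.\<close>
  define q where "q = sqrt r0"
  have q: "0 < q" "q < 1" "q * q = r0" using r by (auto simp: q_def)
  have "summable pr"
  proof (rule summable_comparison_test_ev)
    show "eventually (\<lambda>n. norm (pr n) \<le> r0 ^ n) sequentially"
      using pr_le by eventually_elim (use pr in \<open>simp add: less_imp_le\<close>)
    show "summable (\<lambda>n. r0 ^ n)" using r by (intro summable_geometric) auto
  qed
  moreover have "summable (\<lambda>j. \<beta> j * pr j)"
  proof (rule summable_comparison_test_ev)
    have "1 < 1 / q" using q by simp
    from growth[OF this] pr_le show "eventually (\<lambda>n. norm (\<beta> n * pr n) \<le> q ^ n) sequentially"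
    proof eventually_elim
      case (elim n)
      have "\<beta> n * pr n \<le> (1 / q) ^ n * r0 ^ n"
        using elim q pr[of n] by (intro mult_mono) (auto simp: less_imp_le)
      also have "\<dots> = q ^ n"
        using q(1) unfolding q(3)[symmetric] by (simp add: power_mult_distrib[symmetric])
      finally show ?case using pr[of n] \<beta>[of n] by (simp add: less_imp_le)
    qed
    show "summable (\<lambda>n. q ^ n)" using q by (intro summable_geometric) auto
  qed
  ultimately have "v * pr n + (\<Sum>j<n. \<beta> j * pr j) \<le> v * suminf pr + (\<Sum>j. \<beta> j * pr j)" for n
    using sum_le_suminf[of pr "{n}"] sum_le_suminf[of "\<lambda>j. \<beta> j * pr j" "{..<n}"] pr \<beta> v
    by (intro add_mono mult_left_mono) (auto simp: less_imp_le)
  then show ?thesis unfolding pr_def by blast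
qed

section \<open>Sublinear growth along a stationary sequence\<close>

text \<open>The sum counts the multiples of e below z, 0 included, so there are at most the ceiling
  of z/e of them. Integrated over z it becomes the tail-sum bound for an expectation.\<close>

lemma suminf_indicator_multiples_le:
  assumes e: "0 < e" and z: "0 \<le> z"
  shows "(\<Sum>k. indicator {k. real k * e < z} k) \<le> ennreal (z / e + 1)"
proof (rule suminf_le_const)
  show "summable (indicator {k. real k * e < z} :: nat \<Rightarrow> ennreal)" by (rule summableI)
  fix n
  have "(\<Sum>k<n. indicator {k. real k * e < z} k) = (of_nat (card ({..<n} \<inter> {k. real k * e < z})) :: ennreal)"
    by (simp add: indicator_def sum.If_cases)
  also have "card ({..<n} \<inter> {k. real k * e < z}) \<le> card {..<nat \<lceil>z / e\<rceil>}"
  proof (intro card_mono subsetI)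
    fix k assume "k \<in> {..<n} \<inter> {k. real k * e < z}"
    then have "real k < z / e" using e by (simp add: field_simps)
    then show "k \<in> {..<nat \<lceil>z / e\<rceil>}" by (simp add: zless_nat_eq_int_zless less_ceiling_iff)
  qed simp
  then have "(of_nat (card ({..<n} \<inter> {k. real k * e < z})) :: ennreal) \<le> of_nat (nat \<lceil>z / e\<rceil>)"
    by (simp only: of_nat_mono card_lessThan)
  also have "\<dots> = ennreal (real (nat \<lceil>z / e\<rceil>))" by (rule ennreal_of_nat_eq_real_of_nat)
  also have "\<dots> \<le> ennreal (z / e + 1)"
  proof (rule ennreal_leI)
    have "0 \<le> z / e" using e z by simp
    then have "real (nat \<lceil>z / e\<rceil>) = of_int \<lceil>z / e\<rceil>" by (intro of_nat_nat) simp
    then show "real (nat \<lceil>z / e\<rceil>) \<le> z / e + 1" using ceiling_correct[of "z / e"] by linarith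
  qed
  finally show "(\<Sum>k<n. indicator {k. real k * e < z} k) \<le> ennreal (z / e + 1)" .
qed

text \<open>Invariance gives \<open>Z\<close> after \<open>T k\<close> the same tails as
  \<open>Z\<close>. Summed at the levels k e they are at most E Z / e + 1, so Borel-Cantelli
  applies.\<close>

lemma stationary_sublinear:
  fixes Z :: "'a \<Rightarrow> real"
  assumes "prob_space M" and Z[measurable]: "Z \<in> borel_measurable M" and Z0: "\<And>x. 0 \<le> Z x"
    and T[measurable]: "\<And>k::nat. T k \<in> M \<rightarrow>\<^sub>M M" and inv: "\<And>k. distr M M (T k) = M"
    and fin: "(\<integral>\<^sup>+x. ennreal (Z x) \<partial>M) < \<infinity>" and e: "0 < e"
  shows "AE x in M. eventually (\<lambda>k. Z (T k x) \<le> real k * e) sequentially"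
proof -
  interpret prob_space M by fact
  let ?A = "\<lambda>k. {x\<in>space M. real k * e < Z (T k x)}"
  have [measurable]: "?A k \<in> sets M" for k by measurable
  have A: "emeasure M (?A k) = (\<integral>\<^sup>+x. indicator {k. real k * e < Z x} k \<partial>M)" for k
  proof -
    have "emeasure M (?A k) = (\<integral>\<^sup>+x. indicator (?A k) x \<partial>M)" by simp
    also have "\<dots> = (\<integral>\<^sup>+x. indicator {x\<in>space M. real k * e < Z x} (T k x) \<partial>M)"
      by (intro nn_integral_cong) (auto simp: indicator_def measurable_space[OF T])
    also have "\<dots> = (\<integral>\<^sup>+x. indicator {x\<in>space M. real k * e < Z x} x \<partial>distr M M (T k))"
      by (subst nn_integral_distr) auto
    also have "\<dots> = (\<integral>\<^sup>+x. indicator {k. real k * e < Z x} k \<partial>M)"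
      unfolding inv by (intro nn_integral_cong) (auto simp: indicator_def)
    finally show ?thesis .
  qed
  have [measurable]: "(\<lambda>x. indicator {k. real k * e < Z x} k :: ennreal) \<in> borel_measurable M" for k
    unfolding indicator_def mem_Collect_eq by measurable
  have "(\<Sum>k. ennreal (measure M (?A k))) = (\<integral>\<^sup>+x. (\<Sum>k. indicator {k. real k * e < Z x} k) \<partial>M)"
    by (simp add: A nn_integral_suminf flip: emeasure_eq_measure)
  also have "\<dots> \<le> (\<integral>\<^sup>+x. ennreal (Z x / e + 1) \<partial>M)"
    using suminf_indicator_multiples_le[OF e Z0] by (intro nn_integral_mono) auto
  also have "\<dots> = (\<integral>\<^sup>+x. ennreal (1 / e) * ennreal (Z x) + 1 \<partial>M)"
    using e Z0 by (intro nn_integral_cong) (simp add: ennreal_mult[symmetric])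
  also have "\<dots> = ennreal (1 / e) * (\<integral>\<^sup>+x. ennreal (Z x) \<partial>M) + 1"
    by (simp add: nn_integral_add nn_integral_cmult emeasure_space_1)
  also have "\<dots> < top" using fin by (simp add: ennreal_mult_less_top)
  finally have "summable (\<lambda>k. measure M (?A k))"
    by (intro summable_suminf_not_top) auto
  then have "AE x in M. eventually (\<lambda>k. x \<in> space M - ?A k) sequentially"
    by (intro borel_cantelli_AE1) (auto simp: emeasure_eq_measure)
  then show ?thesis
    by eventually_elim (auto elim!: eventually_mono simp: not_less)
qed

text \<open>The tuple \<open>(x_(p-1), ..., x_0)\<close>.\<close>
definition tup :: "nat \<Rightarrow> (int \<Rightarrow> 'f) \<Rightarrow> nat \<Rightarrow> 'f" where
  "tup p x = revtup p (\<lambda>i. x (int i - 1))"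

lemma measurable_tup [measurable]: "tup p \<in> PF \<rightarrow>\<^sub>M (\<Pi>\<^sub>M k\<in>{1..p}. borel)"
  unfolding tup_def revtup_def by (rule measurable_restrict) measurable

lemma tup_in_space: "tup p x \<in> space (\<Pi>\<^sub>M k\<in>{1..p}. borel)"
  by (simp add: tup_def revtup_def space_PiM)

text \<open>Going back \<open>k + 1\<close> blocks turns the tuple at the origin into the one of the
  contraction hypothesis, (x_(-1-kp), ..., x_(-(k+1)p)).\<close>

lemma tup_shiftk: "tup p (shiftk (- (int k * int p) - int p) x) = (\<lambda>k'\<in>{1..p}. x (- 1 - int k * int p - (int k' - 1)))"
  by (auto simp: tup_def revtup_def shiftk_def restrict_def fun_eq_iff of_nat_diff intro!: arg_cong[where f=x])

text \<open>Reconciles two conventions: the hypotheses number the kernels of a block from 1, the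
  environment path from 0.\<close>

lemma (in random_kernel) block_eq_kcomp:
  "block p x = kcomp borel (map (\<lambda>i. P (x (int i - 1))) [1..<p + 1])"
proof -
  have "[1..<p + 1] = map Suc [0..<p]" by (simp add: map_Suc_upt)
  then show ?thesis by (simp add: block_def comp_def del: upt_Suc)
qed

text \<open>Along a fixed environment, \<open>w n\<close> is the recursion of
  \<open>affine_recursion_bounded\<close> with the values of \<open>lam\<close> and \<open>b\<close>
  on successive past blocks. The logarithmic moment makes \<open>b\<close> subexponential
  there.\<close>

lemma (in drift_chain) W_finite:
  fixes lam b :: "(nat \<Rightarrow> 'f) \<Rightarrow> real"
  assumes L: "\<And>x. L x = ennreal (lam (tup p x))" and B: "\<And>x. B x = ennreal (b (tup p x))"
    and lam_pos: "\<And>x. 0 < lam (tup p x)" and b_pos: "\<And>x. 0 < b (tup p x)"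
    and b_meas[measurable]: "b \<in> borel_measurable (\<Pi>\<^sub>M k\<in>{1..p}. borel)"
    and V_pos: "\<And>y. 0 < V y"
    and b_log: "(\<integral>\<^sup>+x. ennreal (logplus (b (tup p x))) \<partial>LX) < \<infinity>"
    and contr: "AE x in LX. limsup (\<lambda>n. ereal ((\<Prod>k<n. lam (tup p (shiftk (- (int k * int p) - int p) x))) powr (1 / real n))) < 1"
  shows "AE x in LX. W x < \<infinity>"
proof -
  define s where "s k = - (int k * int p) - int p" for k
  have logplus_nonneg: "0 \<le> logplus u" for u by (simp add: logplus_def)
  have lp[measurable]: "(\<lambda>x. logplus (b (tup p x))) \<in> borel_measurable PF"
    unfolding logplus_def by measurable
  have sub: "AE x in LX. eventually (\<lambda>k. logplus (b (tup p (shiftk (s k) x))) \<le> real k * e) sequentially"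
    if "0 < e" for e
  proof (rule stationary_sublinear[OF LX_prob _ logplus_nonneg])
    note [simp] = measurable_cong_sets[OF sets_LX sets_LX] measurable_cong_sets[OF sets_LX refl]
    show "(\<lambda>x. logplus (b (tup p x))) \<in> borel_measurable LX" by simp
    show "shiftk (s k) \<in> LX \<rightarrow>\<^sub>M LX" for k by simp
    have "distr LX LX (shiftk (s k)) = distr LX PF (shiftk (s k))" for k
      by (rule distr_cong) (auto simp: sets_LX)
    then show "distr LX LX (shiftk (s k)) = LX" for k by (simp add: LX_shiftk)
  qed (fact b_log that)+
  \<comment> \<open>The countably many rates 1/(m+1) get below \<open>ln t\<close> for every t > 1,
    so one null set serves all growth rates.\<close>
  have "AE x in LX. \<forall>m. eventually (\<lambda>k. logplus (b (tup p (shiftk (s k) x))) \<le> real k * (1 / real (Suc m))) sequentially"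
    unfolding AE_all_countable by (intro allI sub) simp
  with contr show ?thesis
  proof eventually_elim
    case (elim x)
    define l where "l k = lam (tup p (shiftk (s k) x))" for k
    define \<beta> where "\<beta> k = b (tup p (shiftk (s k) x))" for k
    have pos: "0 < l k" "0 < \<beta> k" for k using lam_pos b_pos by (simp_all add: l_def \<beta>_def)
    have growth: "eventually (\<lambda>k. \<beta> k \<le> t ^ k) sequentially" if t: "1 < t" for t
    proof -
      have "0 < ln t" using t by simp
      then obtain m where m: "1 / real (Suc m) < ln t" using nat_approx_posE by blast
      show ?thesis using elim(2)[rule_format, of m]
      proof eventually_elim
        case (elim k)
        have "ln (\<beta> k) \<le> logplus (\<beta> k)"
          using pos(2)[of k] by (simp add: logplus_def)
        also have "\<dots> \<le> real k * (1 / real (Suc m))" using elim by (simp add: \<beta>_def)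
        also have "\<dots> \<le> real k * ln t" using m by (intro mult_left_mono) auto
        also have "\<dots> = ln (t ^ k)" using t by (simp add: ln_realpow)
        finally show ?case using pos(2)[of k] t by (subst (asm) ln_le_cancel_iff) auto
      qed
    qed
    have "limsup (\<lambda>n. ereal ((\<Prod>k<n. l k) powr (1 / real n))) < 1"
      using elim(1) by (simp add: l_def s_def)
    from affine_recursion_bounded[OF pos less_imp_le[OF V_pos[of y0]] this growth]
    obtain K where K: "\<And>n. V y0 * (\<Prod>k<n. l k) + (\<Sum>j<n. \<beta> j * (\<Prod>k<j. l k)) \<le> K"
      by blast
    \<comment> \<open>Generalized over the number i of blocks already gone back, because one
      unfolding of \<open>w\<close> moves from i to \<open>Suc i\<close>. The case i = 0 is the one
      used.\<close>
    have w: "w n (shiftk (- (int i * int p)) x) =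
        ennreal (V y0 * (\<Prod>k<n. l (i + k)) + (\<Sum>j<n. \<beta> (i + j) * (\<Prod>k<j. l (i + k))))" for n i
    proof (induction n arbitrary: i)
      case (Suc n)
      let ?r = "V y0 * (\<Prod>k<n. l (Suc i + k)) + (\<Sum>j<n. \<beta> (Suc i + j) * (\<Prod>k<j. l (Suc i + k)))"
      have sh: "shiftk (- int p) (shiftk (- (int i * int p)) x) = shiftk (s i) x"
        "shiftk (s i) x = shiftk (- (int (Suc i) * int p)) x"
        by (auto simp: shiftk_shiftk s_def distrib_right intro!: arg_cong[where f="\<lambda>k. shiftk k x"])
      have r0: "0 \<le> ?r" using V_pos[of y0] pos
        by (intro add_nonneg_nonneg mult_nonneg_nonneg sum_nonneg prod_nonneg) (auto simp: less_imp_le)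
      have "w (Suc n) (shiftk (- (int i * int p)) x) = ennreal (l i) * ennreal ?r + ennreal (\<beta> i)"
      proof -
        have "w n (shiftk (s i) x) = ennreal ?r"
          using Suc.IH[of "Suc i"] unfolding sh(2) .
        then show ?thesis
          by (simp only: w.simps sh(1) L[of "shiftk (s i) x"] B[of "shiftk (s i) x"] l_def \<beta>_def)
      qed
      also have "\<dots> = ennreal (l i * ?r + \<beta> i)"
        using r0 pos[of i] by (simp add: ennreal_mult[symmetric] less_imp_le)
      also have "l i * ?r + \<beta> i = V y0 * (\<Prod>k<Suc n. l (i + k)) + (\<Sum>j<Suc n. \<beta> (i + j) * (\<Prod>k<j. l (i + k)))"
        by (simp add: prod.lessThan_Suc_shift sum.lessThan_Suc_shift sum_distrib_left algebra_simps del: prod.lessThan_Suc sum.lessThan_Suc)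
      finally show ?case .
    qed simp
    have "W x \<le> ennreal K"
      unfolding W_def
    proof (rule SUP_least)
      fix n show "w n x \<le> ennreal K"
        using w[of n 0] K[of n] by (simp add: ennreal_leI)
    qed
    then show ?case by (auto simp: less_top[symmetric] top_unique)
  qed
qed

theorem theorem2:
  fixes P :: "'f::polish_space \<Rightarrow> 'e::polish_space \<Rightarrow> 'e measure"
    and M :: "'w measure" and X :: "int \<Rightarrow> 'w \<Rightarrow> 'f" and p :: nat
    and V :: "'e \<Rightarrow> real" and lam b :: "(nat \<Rightarrow> 'f) \<Rightarrow> real"
    and eta :: "real \<Rightarrow> (nat \<Rightarrow> 'f) \<Rightarrow> real"
    and \<nu> :: "real \<Rightarrow> (nat \<Rightarrow> 'f) \<Rightarrow> 'e measure"
  assumes kernel: "\<And>x. prob_kernel_on (borel::'e measure) (borel::'e measure) (P x)"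
    and joint_meas: "\<And>A. A \<in> sets (borel::'e measure) \<Longrightarrow>
          (\<lambda>(x, y). emeasure (P x y) A) \<in> borel_measurable (borel \<Otimes>\<^sub>M borel)"
    and M: "prob_space M"
    and X_meas: "\<And>t. X t \<in> measurable M borel"
    and X_stat: "stationary_law borel (law M borel X)"
    and p: "p \<ge> 1"
    \<comment> \<open>(A4)\<close>
    and V_meas: "V \<in> borel_measurable borel" and V_pos: "\<And>y. V y > 0"
    and lam_meas: "lam \<in> borel_measurable (\<Pi>\<^sub>M k\<in>{1..p}. (borel::'f measure))"
    and b_meas: "b \<in> borel_measurable (\<Pi>\<^sub>M k\<in>{1..p}. (borel::'f measure))"
    and lam_pos: "\<And>z. z \<in> space (\<Pi>\<^sub>M k\<in>{1..p}. (borel::'f measure)) \<Longrightarrow> lam z > 0"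
    and b_pos: "\<And>z. z \<in> space (\<Pi>\<^sub>M k\<in>{1..p}. (borel::'f measure)) \<Longrightarrow> b z > 0"
    and drift: "\<And>xs y. (\<integral>\<^sup>+ y'. ennreal (V y') \<partial>(kcomp borel (map (\<lambda>i. P (xs i)) [1..<p+1]) y))
                  \<le> ennreal (lam (revtup p xs) * V y + b (revtup p xs))"
    and lam_log: "(\<integral>\<^sup>+ \<omega>. ennreal (logplus (lam (revtup p (\<lambda>i. X (int i) \<omega>)))) \<partial>M) < \<infinity>"
    and b_log: "(\<integral>\<^sup>+ \<omega>. ennreal (logplus (b (revtup p (\<lambda>i. X (int i) \<omega>)))) \<partial>M) < \<infinity>"
    and contr: "AE \<omega> in M. limsup (\<lambda>n. ereal ((\<Prod>k<n.
                   lam (\<lambda>k'\<in>{1..p}. X (- 1 - int k * int p - (int k' - 1)) \<omega>)) powr (1 / real n))) < 1"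
    \<comment> \<open>(A5)\<close>
    and eta_meas: "(\<lambda>(R, z). eta R z) \<in> borel_measurable
                     (restrict_space borel {0<..} \<Otimes>\<^sub>M (\<Pi>\<^sub>M k\<in>{1..p}. (borel::'f measure)))"
    and eta_range: "\<And>R z. R > 0 \<Longrightarrow> z \<in> space (\<Pi>\<^sub>M k\<in>{1..p}. (borel::'f measure)) \<Longrightarrow>
                      0 < eta R z \<and> eta R z < 1"
    and nu_kernel: "\<And>R. R > 0 \<Longrightarrow>
          prob_kernel_on (\<Pi>\<^sub>M k\<in>{1..p}. (borel::'f measure)) (borel::'e measure) (\<nu> R)"
    and minor: "\<And>R xs y A. R > 0 \<Longrightarrow> V y \<le> R \<Longrightarrow> A \<in> sets (borel::'e measure) \<Longrightarrow>
          emeasure (kcomp borel (map (\<lambda>i. P (xs i)) [1..<p+1]) y) A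
            \<ge> ennreal (eta R (revtup p xs)) * emeasure (\<nu> R (revtup p xs)) A"
  shows "(\<exists>Q. solution_law P (law M borel X) Q)
       \<and> (\<forall>Q Q'. solution_law P (law M borel X) Q \<longrightarrow> solution_law P (law M borel X) Q' \<longrightarrow> Q = Q')
       \<and> (ergodic_law (law M borel X) \<longrightarrow>
            (\<forall>Q. solution_law P (law M borel X) Q \<longrightarrow> ergodic_law Q))"
proof -
  note [measurable] = V_meas lam_meas b_meas X_meas
  let ?LX = "law M borel X" and ?T = "\<Pi>\<^sub>M k\<in>{1..p}. (borel::'f measure)"
  have Xp[measurable]: "(\<lambda>\<omega> s. X s \<omega>) \<in> M \<rightarrow>\<^sub>M PF" by (rule measurable_path_spaceI) (rule X_meas)
  have prob_P: "prob_space (P x y)" "sets (P x y) = sets borel" for x y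
    using kernel[of x] by (auto simp: prob_kernel_on_def)
  interpret random_kernel P
  proof
    show "(\<lambda>(x, y). P x y) \<in> borel \<Otimes>\<^sub>M borel \<rightarrow>\<^sub>M prob_algebra borel"
    proof (rule measurable_prob_algebraI)
      show "prob_space (case z of (x, y) \<Rightarrow> P x y)" for z by (cases z) (simp add: prob_P)
      show "(\<lambda>(x, y). P x y) \<in> borel \<Otimes>\<^sub>M borel \<rightarrow>\<^sub>M subprob_algebra borel"
        using joint_meas prob_P
        by (intro measurable_subprob_algebra) (auto intro: prob_space_imp_subprob_space simp: case_prod_beta)
    qed
  qed
  define c where "c R x = ennreal (eta (real R) (tup p x))" for R :: nat and x :: "int \<Rightarrow> 'f"
  define N where "N R x = \<nu> (real R) (tup p x)" for R :: nat and x :: "int \<Rightarrow> 'f"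
  define L where "L x = ennreal (lam (tup p x))" for x :: "int \<Rightarrow> 'f"
  define B where "B x = ennreal (b (tup p x))" for x :: "int \<Rightarrow> 'f"
  have eta: "0 < eta (real R) (tup p x)" "eta (real R) (tup p x) < 1" if "0 < R" for R x
    using eta_range[OF _ tup_in_space, of "real R"] that by auto
  interpret minorized_chain P p V c N
  proof
    show "V \<in> borel_measurable borel" by fact
  next
    fix R :: nat assume R: "0 < R"
    have "real R \<in> space (restrict_space borel {0<..})" using R by (simp add: space_restrict_space)
    then have "(\<lambda>z. eta (real R) z) \<in> borel_measurable ?T"
      using measurable_compose[OF measurable_Pair1' eta_meas, of "real R"] by simp
    then show "c R \<in> borel_measurable PF"
      unfolding c_def by (intro measurable_compose[OF measurable_compose[OF measurable_tup] measurable_ennreal])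
    show "0 < c R x" "c R x \<le> 1" for x using eta[OF R] by (auto simp: c_def less_imp_le)
    have "\<nu> (real R) \<in> ?T \<rightarrow>\<^sub>M prob_algebra borel"
      using nu_kernel[of "real R"] R
      by (intro measurable_prob_algebraI measurable_subprob_algebra)
         (auto simp: prob_kernel_on_def intro: prob_space_imp_subprob_space)
    then show "N R \<in> PF \<rightarrow>\<^sub>M prob_algebra borel"
      unfolding N_def by (rule measurable_compose[OF measurable_tup])
  next
    fix R :: nat and x :: "int \<Rightarrow> 'f" and y :: 'e and A :: "'e set" assume "0 < R" "V y \<le> real R" "A \<in> sets borel"
    then show "c R x * emeasure (N R x) A \<le> emeasure (block p x y) A"
      using minor[of "real R" y A "\<lambda>i. x (int i - 1)"]
      by (simp add: c_def N_def block_eq_kcomp tup_def del: upt_Suc)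
  qed
  \<comment> \<open>The starting state is arbitrary, since \<open>V\<close> is finite
    everywhere.\<close>
  interpret drift_chain P p V c N ?LX L B undefined
  proof (intro drift_chain.intro drift_chain_axioms.intro minorized_chain_axioms)
    show "prob_space ?LX"
      unfolding law_def by (rule prob_space.prob_space_distr[OF M Xp])
    show "stationary_law borel ?LX" by fact
    show "0 < p" using p by simp
    show "L \<in> borel_measurable PF" "B \<in> borel_measurable PF"
      unfolding L_def B_def by measurable
    fix x :: "int \<Rightarrow> 'f" and y
    have "ennreal (lam (tup p x) * V y + b (tup p x)) = L x * ennreal (V y) + B x"
      using lam_pos[OF tup_in_space] b_pos[OF tup_in_space] V_pos[of y]
      by (simp add: L_def B_def ennreal_mult less_imp_le)
    then show "(\<integral>\<^sup>+y'. ennreal (V y') \<partial>block p x y) \<le> L x * ennreal (V y) + B x"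
      using drift[of "\<lambda>i. x (int i - 1)" y] by (simp add: block_eq_kcomp tup_def del: upt_Suc)
  qed
  have "AE x in ?LX. W x < \<infinity>"
  proof (rule W_finite[OF L_def B_def])
    show "0 < lam (tup p x)" "0 < b (tup p x)" for x
      using lam_pos[OF tup_in_space] b_pos[OF tup_in_space] by auto
    show "b \<in> borel_measurable ?T" "\<And>y. 0 < V y" by fact+
    have [measurable]: "(\<lambda>x. ennreal (logplus (b (tup p x)))) \<in> borel_measurable PF"
      unfolding logplus_def by measurable
    \<comment> \<open>The moment is assumed for (X_p, ..., X_1), whereas \<open>tup\<close> reads
      (x_(p-1), ..., x_0); stationarity absorbs the shift by one.\<close>
    have "(\<integral>\<^sup>+x. ennreal (logplus (b (tup p x))) \<partial>?LX) = (\<integral>\<^sup>+x. ennreal (logplus (b (tup p (shiftk 1 x)))) \<partial>?LX)"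
      by (rule nn_integral_LX_shiftk[symmetric]) measurable
    also have "\<dots> = (\<integral>\<^sup>+\<omega>. ennreal (logplus (b (tup p (shiftk 1 (\<lambda>s. X s \<omega>))))) \<partial>M)"
      unfolding law_def by (rule nn_integral_distr[OF Xp]) measurable
    also have "\<dots> = (\<integral>\<^sup>+\<omega>. ennreal (logplus (b (revtup p (\<lambda>i. X (int i) \<omega>)))) \<partial>M)"
      by (simp add: tup_def shiftk_def)
    finally show "(\<integral>\<^sup>+x. ennreal (logplus (b (tup p x))) \<partial>?LX) < \<infinity>" using b_log by simp
    let ?g = "\<lambda>x. limsup (\<lambda>n. ereal ((\<Prod>k<n. lam (tup p (shiftk (- (int k * int p) - int p) x))) powr (1 / real n)))"
    have [measurable]: "?g \<in> borel_measurable PF" by measurable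
    have "{x \<in> space PF. ?g x < 1} \<in> sets PF" by measurable
    moreover have "AE \<omega> in M. ?g (\<lambda>s. X s \<omega>) < 1"
      using contr unfolding tup_shiftk by simp
    ultimately show "AE x in ?LX. ?g x < 1"
      unfolding law_def by (subst AE_distr_iff[OF Xp]) auto
  qed
  then show ?thesis
    using ex_solution_law solution_law_unique solution_law_ergodic by blast
qed

end
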